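(* Let $(B,\|\cdot\|)$ be a real separable Banach space, let $X, X_1, X_2, \ldots$ be i.i.d. mean zero $B$-valued random variables and $S_n=\sum_{i=1}^nX_i$. Let $\{c_n\}$ be a sequence of positive real numbers such that $c_n/\sqrt n$ is non-decreasing and tends to $\infty$, and such that for every $\epsilon>0$ there exists $m_\epsilon\ge1$ with $c_n/c_m\le(1+\epsilon)(n/m)$ whenever $m_\epsilon\le m<n$. Assume $$\sum_{n=1}^\infty\mathbb{P}\{\|X\|\ge c_n\}<\infty.$$ Then with probability one, $$\alpha_0\vee\beta_0\le\limsup_{n\to\infty}\|S_n\|/c_n\le\alpha_0+\beta_0,$$ where $\beta_0=\limsup_{n\to\infty}\mathbb{E}\|S_n\|/c_n$ and $$\alpha_0=\sup\left\{\alpha\ge0:\ \sum_{n=1}^\infty n^{-1}\exp\left(-\frac{\alpha^2c_n^2}{2nH(c_n)}\right)=\infty\right\}.$$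
   Context: $B_1^*$ denotes the closed unit ball of the dual $B^*$ of $B$, and $H(t)=\sup_{f\in B_1^*}\mathbb{E} f^2(X)I\{\|X\|\le t\}$ for $t\ge0$. The quantities $\alpha_0,\beta_0$ take values in $[0,\infty]$. *)

theory Defs
  imports "HOL-Probability.Probability"
begin

definition trunc_var :: "'a measure \<Rightarrow> ('a \<Rightarrow> 'b::{banach,second_countable_topology}) \<Rightarrow> real \<Rightarrow> real" where
  "trunc_var M X t =
     (SUP f \<in> {f :: 'b \<Rightarrow>\<^sub>L real. norm f \<le> 1}.
        integral\<^sup>L M (\<lambda>\<omega>. if norm (X \<omega>) \<le> t then (blinfun_apply f (X \<omega>))\<^sup>2 else 0))"

text \<open>The n-th term of the series defining alpha_0, for n >= 1, with the convention
  a/0 = +infinity for a > 0 (so exp(-infinity) = 0) and 0/0 = 0.\<close>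
definition alpha_term :: "(nat \<Rightarrow> real) \<Rightarrow> (real \<Rightarrow> real) \<Rightarrow> real \<Rightarrow> nat \<Rightarrow> real" where
  "alpha_term c H \<alpha> n =
     (if H (c n) = 0 then (if \<alpha> * c n = 0 then 1 / real n else 0)
      else (1 / real n) * exp (- (\<alpha>\<^sup>2 * (c n)\<^sup>2) / (2 * real n * H (c n))))"

definition alpha0 :: "(nat \<Rightarrow> real) \<Rightarrow> (real \<Rightarrow> real) \<Rightarrow> ereal" where
  "alpha0 c H = Sup (ereal ` {\<alpha>. \<alpha> \<ge> 0 \<and> \<not> summable (\<lambda>n. alpha_term c H \<alpha> (Suc n))})"

end

theory Submission
  imports Defs
begin

text \<open>Let \<open>n\<close> run through a geometric sequence and truncate the summands at \<open>\<rho> * c n\<close> with \<open>\<rho>\<close> tending to \<open>0\<close>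
  slowly. The tail condition makes \<open>n * P (norm X > \<delta> * c n)\<close> summable along the sequence for every
  \<open>\<delta> > 0\<close>, and likewise the probability of two jumps beyond \<open>\<rho> * c n\<close>. So almost surely at most one jump
  of size at most \<open>\<delta> * c n\<close> is lost, and only the truncated sums matter.

  For the upper bound, the norm of a sum of bounded centred variables satisfies
  \<open>P (max norm S \<ge> (1 + \<epsilon>) * E (norm S) + t) \<le> exp (- t\<^sup>2 / (2 * (1 + \<epsilon>) * n * v)) + exp (- \<eta> * t / b)\<close>
  with the weak variance \<open>v\<close>. This follows from the entropy method: tensorization of entropy, the
  second moment of a one-step increment of the norm, and Herbst's differential inequality. The second
  exponential is summable by the choice of \<open>\<rho>\<close>, the first is comparable with the series for \<open>\<alpha>0\<close>.

  For the lower bound by \<open>\<beta>0\<close>, the variance of the norm of the truncated sum is \<open>o ((c n)\<^sup>2)\<close>, so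
  \<open>norm S / c n - E (norm S) / c n\<close> tends to \<open>0\<close> in the mean. For the lower bound by \<open>\<alpha>0\<close>, a functional that
  almost attains \<open>H (c n)\<close> reduces the problem to real sums, exponential tilting gives the sharp lower
  tail, and the second Borel--Cantelli lemma applies to disjoint blocks.\<close>

subsection \<open>A norming functional\<close>

text \<open>The hypotheses meet in the random index \<open>J\<close>, which the tail condition makes
  integrable. For \<open>n > J\<close>, monotonicity of \<open>c n / sqrt n\<close> gives
  \<open>(norm X / c n)\<^sup>2 <= J / n\<close>; for large \<open>n < J\<close> the growth
  condition gives \<open>norm X / c n <= 2 * J / n\<close>. Normalized second moments, and the mean
  of what truncation at \<open>c n\<close> discards, are thereby dominated by \<open>J\<close> and
  tend to \<open>0\<close>, but without a rate. The fourth power gains one more factor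
  \<open>min 1 (J / n)\<close>, and \<open>n * (min 1 (J / n))\<^sup>2\<close> does sum along
  geometric sequences. Hence errors that must be summable are measured by the fourth-moment quantity
  \<open>G\<close>, and the truncation ratio is essentially a small power of it.

  The \<open>2\<close> in the series for \<open>\<alpha>0\<close> must survive, and \<open>H\<close>
  is only the weak variance, so a bound through the strong variance would be too large. This forces
  a norming functional into each one-step increment, a differential inequality for the Laplace
  transform of the norm, and losses that are all factors tending to \<open>1\<close>.\<close>

definition sublin :: "('b::real_normed_vector \<Rightarrow> real) \<Rightarrow> bool" where
  "sublin p \<longleftrightarrow> (\<forall>x y. p (x + y) \<le> p x + p y) \<and> (\<forall>t\<ge>0. \<forall>x. p (t *\<^sub>R x) \<le> t * p x)
     \<and> (\<forall>x. p x \<le> norm x)"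

lemma sublin_zero: "sublin p \<Longrightarrow> p 0 = 0"
proof -
  assume s: "sublin p"
  have "p (0 + 0) \<le> p 0 + p 0" using s unfolding sublin_def by blast
  moreover have "p 0 \<le> 0" using s norm_zero unfolding sublin_def by metis
  ultimately show ?thesis by simp
qed

lemma sublin_lower: assumes s: "sublin p" shows "- norm x \<le> p x"
proof -
  have "p (x + - x) \<le> p x + p (- x)" "p (- x) \<le> norm (- x)"
    using s unfolding sublin_def by blast+
  with sublin_zero[OF s] show ?thesis by simp
qed

text \<open>\<open>sublin\<close> asks only for an inequality, which is easier to preserve under
  infima; applying it with \<open>1 / t\<close> gives the reverse one.\<close>

lemma sublin_scale: assumes s: "sublin p" and t: "t \<ge> 0" shows "p (t *\<^sub>R x) = t * p x"
proof (cases "t = 0")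
  case True then show ?thesis using sublin_zero[OF s] by simp
next
  case False
  with t have t: "t > 0" by simp
  have "p ((1/t) *\<^sub>R (t *\<^sub>R x)) \<le> (1/t) * p (t *\<^sub>R x)"
    using s t unfolding sublin_def by (meson divide_nonneg_pos zero_le_one)
  then have "t * p x \<le> p (t *\<^sub>R x)" using t by (simp add: field_simps)
  moreover have "p (t *\<^sub>R x) \<le> t * p x" using s t unfolding sublin_def by simp
  ultimately show ?thesis by simp
qed

text \<open>The infimum is finite because subadditivity bounds every term below by
  \<open>- p (- x)\<close>. The values \<open>t = 0\<close> and \<open>t = 1\<close> give the two
  upper bounds. If \<open>p\<close> is minimal then \<open>q = p\<close>, and the last bound becomes
  the missing half of additivity.\<close>

lemma sublin_pullback:
  fixes y :: "'b::real_normed_vector"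
  assumes s: "sublin p"
  defines "q \<equiv> \<lambda>x. INF t\<in>{0..}. p (x + t *\<^sub>R y) - t * p y"
  shows "sublin q" "q x \<le> p x" "q x \<le> p (x + y) - p y"
proof -
  have sub: "p (x + y) \<le> p x + p y" for x y using s unfolding sublin_def by blast
  have bd: "bdd_below ((\<lambda>t. p (x + t *\<^sub>R y) - t * p y) ` {0..})" for x
  proof (rule bdd_belowI2[where m="- p (- x)"])
    fix t :: real assume t: "t \<in> {0..}"
    have "p (t *\<^sub>R y) \<le> p (- x) + p (x + t *\<^sub>R y)" using sub[of "-x" "x + t *\<^sub>R y"] by simp
    then show "- p (- x) \<le> p (x + t *\<^sub>R y) - t * p y"
      using sublin_scale[OF s, of t y] t by simp
  qed
  have le: "q x \<le> p (x + t *\<^sub>R y) - t * p y" if "t \<ge> 0" for x t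
    unfolding q_def by (rule cINF_lower[OF bd]) (use that in simp)
  have ge: "m \<le> q x" if "\<And>t. t \<ge> 0 \<Longrightarrow> m \<le> p (x + t *\<^sub>R y) - t * p y" for m x
    unfolding q_def by (rule cINF_greatest) (use that in auto)
  show qp: "q x \<le> p x" for x using le[of 0 x] by simp
  show "q x \<le> p (x + y) - p y" using le[of 1 x] by simp
  show "sublin q" unfolding sublin_def
  proof (intro conjI allI impI)
    fix x1 x2
    have *: "q (x1 + x2) \<le> (p (x1 + t *\<^sub>R y) - t * p y) + (p (x2 + u *\<^sub>R y) - u * p y)"
      if "t \<ge> 0" "u \<ge> 0" for t u
    proof -
      have "q (x1 + x2) \<le> p ((x1 + x2) + (t + u) *\<^sub>R y) - (t + u) * p y" by (rule le) (use that in simp)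
      moreover have "p ((x1 + x2) + (t + u) *\<^sub>R y) \<le> p (x1 + t *\<^sub>R y) + p (x2 + u *\<^sub>R y)"
        using sub[of "x1 + t *\<^sub>R y" "x2 + u *\<^sub>R y"] by (simp add: algebra_simps)
      ultimately show ?thesis by (simp add: algebra_simps)
    qed
    have "q (x1 + x2) - (p (x1 + t *\<^sub>R y) - t * p y) \<le> q x2" if "t \<ge> 0" for t
      by (rule ge) (use *[OF that] in \<open>simp add: algebra_simps\<close>)
    then have "q (x1 + x2) - q x2 \<le> q x1"
      by (intro ge) (smt (verit))
    then show "q (x1 + x2) \<le> q x1 + q x2" by simp
  next
    fix t :: real and x assume t: "0 \<le> t"
    show "q (t *\<^sub>R x) \<le> t * q x"
    proof (cases "t = 0")
      case True then show ?thesis using le[of 0 0] sublin_zero[OF s] by simp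
    next
      case False
      have "q (t *\<^sub>R x) / t \<le> q x"
      proof (rule ge)
        fix u :: real assume u: "u \<ge> 0"
        have "q (t *\<^sub>R x) \<le> p (t *\<^sub>R x + (t * u) *\<^sub>R y) - (t * u) * p y"
          by (rule le) (use t u in simp)
        also have "t *\<^sub>R x + (t * u) *\<^sub>R y = t *\<^sub>R (x + u *\<^sub>R y)" by (simp add: algebra_simps)
        also have "p \<dots> = t * p (x + u *\<^sub>R y)" by (rule sublin_scale[OF s t])
        finally show "q (t *\<^sub>R x) / t \<le> p (x + u *\<^sub>R y) - u * p y"
          using False t by (simp add: field_simps)
      qed
      then show ?thesis using False t by (simp add: field_simps)
    qed
  next
    fix x show "q x \<le> norm x" using qp[of x] s unfolding sublin_def by (meson order_trans)
  qed
qed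

text \<open>Lower bounds for Zorn's lemma. A pointwise infimum of sublinear functions need not be
  subadditive; along a chain it is, since the smaller of two members serves both arguments.\<close>

lemma sublin_chain_Inf:
  fixes C :: "('b::real_normed_vector \<Rightarrow> real) set"
  assumes ne: "C \<noteq> {}" and C: "\<And>p. p \<in> C \<Longrightarrow> sublin p"
    and ch: "\<And>p q. p \<in> C \<Longrightarrow> q \<in> C \<Longrightarrow> p \<le> q \<or> q \<le> p"
  defines "q \<equiv> \<lambda>x. INF p\<in>C. p x"
  shows "sublin q" "p \<in> C \<Longrightarrow> q \<le> p"
proof -
  have bd: "bdd_below ((\<lambda>p. p x) ` C)" for x
    by (rule bdd_belowI2[where m="- norm x"]) (use C sublin_lower in blast)
  have le: "q x \<le> p x" if "p \<in> C" for x p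
    unfolding q_def by (rule cINF_lower[OF bd that])
  have ge: "m \<le> q x" if "\<And>p. p \<in> C \<Longrightarrow> m \<le> p x" for m x
    unfolding q_def by (rule cINF_greatest[OF ne]) (use that in auto)
  show "p \<in> C \<Longrightarrow> q \<le> p" using le by (simp add: le_fun_def)
  show "sublin q" unfolding sublin_def
  proof (intro conjI allI impI)
    fix x y
    have *: "q (x + y) \<le> p1 x + p2 y" if P: "p1 \<in> C" "p2 \<in> C" for p1 p2
    proof -
      obtain p where p: "p \<in> C" "p \<le> p1" "p \<le> p2" using ch[OF P] P by auto
      have "q (x + y) \<le> p (x + y)" by (rule le[OF p(1)])
      also have "\<dots> \<le> p x + p y" using C[OF p(1)] unfolding sublin_def by blast
      also have "\<dots> \<le> p1 x + p2 y" using p by (intro add_mono) (auto simp: le_fun_def)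
      finally show ?thesis .
    qed
    have "q (x + y) - p1 x \<le> q y" if "p1 \<in> C" for p1
      by (rule ge) (use *[OF that] in \<open>simp add: algebra_simps\<close>)
    then have "q (x + y) - q y \<le> q x" by (intro ge) (smt (verit))
    then show "q (x + y) \<le> q x + q y" by simp
  next
    fix t :: real and x assume t: "0 \<le> t"
    obtain p0 where p0: "p0 \<in> C" using ne by auto
    show "q (t *\<^sub>R x) \<le> t * q x"
    proof (cases "t = 0")
      case True then show ?thesis using le[OF p0, of 0] sublin_zero[OF C[OF p0]] by simp
    next
      case False
      have "q (t *\<^sub>R x) / t \<le> q x"
      proof (rule ge)
        fix p assume p: "p \<in> C"
        have "q (t *\<^sub>R x) \<le> p (t *\<^sub>R x)" by (rule le[OF p])
        also have "\<dots> = t * p x" by (rule sublin_scale[OF C[OF p] t])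
        finally show "q (t *\<^sub>R x) / t \<le> p x" using False t by (simp add: field_simps)
      qed
      then show ?thesis using False t by (simp add: field_simps)
    qed
  next
    fix x
    obtain p where "p \<in> C" using ne by auto
    then show "q x \<le> norm x" using le C unfolding sublin_def by (meson order_trans)
  qed
qed

text \<open>A sublinear functional that is minimal is linear, by the previous pullback construction; Zorn's
  lemma supplies a minimal one below the functional that forces the norm to be attained at \<open>s\<close>.\<close>

lemma norming_functional:
  fixes s :: "'b::real_normed_vector"
  obtains f :: "'b \<Rightarrow>\<^sub>L real" where "norm f \<le> 1" "blinfun_apply f s = norm s"
proof -
  define p0 where "p0 x = (INF t\<in>{0..}. norm (x + t *\<^sub>R s) - t * norm s)" for x :: 'b
  have sn: "sublin (norm :: 'b \<Rightarrow> real)"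
    unfolding sublin_def by (auto simp: norm_triangle_ineq)
  note p0 = sublin_pullback[OF sn, where y=s, folded p0_def]
  \<comment> \<open>At \<open>x = - s\<close> the norm term vanishes. A linear functional
    \<open>p\<close> below \<open>p0\<close> then satisfies \<open>- p s <= - norm s\<close>, so it
    attains the norm at \<open>s\<close>.\<close>
  have p0s: "p0 (- s) \<le> - norm s" using p0(3)[of "-s"] by simp
  define A where "A = {p. sublin p \<and> p \<le> p0}"
  have "\<exists>m\<in>A. \<forall>a\<in>A. a \<le> m \<longrightarrow> a = m"
  proof (rule predicate_Zorn)
    show "partial_order_on A (relation_of (\<lambda>x y. y \<le> x) A)"
      unfolding partial_order_on_def preorder_on_def
      by (auto simp: relation_of_def refl_on_def intro!: transI antisymI)
    fix C assume "C \<in> Chains (relation_of (\<lambda>x y. y \<le> x) A)"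
    then have C: "C \<subseteq> A" "\<And>p q. p \<in> C \<Longrightarrow> q \<in> C \<Longrightarrow> p \<le> q \<or> q \<le> p"
      unfolding Chains_def relation_of_def by auto
    show "\<exists>u\<in>A. \<forall>a\<in>C. u \<le> a"
    proof (cases "C = {}")
      case True
      then show ?thesis using p0(1) unfolding A_def by auto
    next
      case False
      have CA: "sublin p" if "p \<in> C" for p using C that unfolding A_def by auto
      note i = sublin_chain_Inf[OF False CA C(2)]
      obtain p where "p \<in> C" using False by auto
      then have "(\<lambda>x. INF p\<in>C. p x) \<le> p0" using i(2) C(1) unfolding A_def by (blast intro: order_trans)
      then show ?thesis using i unfolding A_def by blast
    qed
  qed
  then obtain p where p: "sublin p" "p \<le> p0" and mn: "\<And>a. sublin a \<Longrightarrow> a \<le> p \<Longrightarrow> a = p"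
    unfolding A_def by (auto intro: order_trans)
  have add: "p (x + y) = p x + p y" for x y
  proof -
    have eq: "(\<lambda>x. INF t\<in>{0..}. p (x + t *\<^sub>R y) - t * p y) = p"
      by (rule mn) (use sublin_pullback[OF p(1)] in \<open>auto simp: le_fun_def\<close>)
    have "(INF t\<in>{0..}. p (x + t *\<^sub>R y) - t * p y) \<le> p (x + y) - p y"
      by (rule sublin_pullback(3)[OF p(1)])
    with fun_cong[OF eq, of x] have "p x \<le> p (x + y) - p y" by simp
    moreover have "p (x + y) \<le> p x + p y" using p(1) unfolding sublin_def by blast
    ultimately show ?thesis by simp
  qed
  have neg: "p (- x) = - p x" for x using add[of x "-x"] sublin_zero[OF p(1)] by simp
  have sc: "p (t *\<^sub>R x) = t * p x" for t x
  proof (cases "t \<ge> 0")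
    case True then show ?thesis by (rule sublin_scale[OF p(1)])
  next
    case False
    then show ?thesis using sublin_scale[OF p(1), of "-t" x] neg[of "t *\<^sub>R x"] by simp
  qed
  have bd: "norm (p x) \<le> norm x * 1" for x
    using p(1) neg[of x] unfolding sublin_def by (smt (verit) norm_minus_cancel real_norm_def)
  have bl: "bounded_linear p" by (rule bounded_linear_intro[OF add _ bd]) (simp add: sc)
  let ?f = "Blinfun p"
  have ap: "blinfun_apply ?f = p" by (rule bounded_linear_Blinfun_apply[OF bl])
  show thesis
  proof
    show "norm ?f \<le> 1" by (rule norm_blinfun_bound) (use bd in \<open>auto simp: ap\<close>)
    have "p (- s) \<le> - norm s" using p(2) p0s by (meson le_fun_def order_trans)
    then have "norm s \<le> p s" using neg[of s] by simp
    moreover have "p s \<le> norm s" using p(1) unfolding sublin_def by blast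
    ultimately show "blinfun_apply ?f s = norm s" by (simp add: ap)
  qed
qed

subsection \<open>Entropy and convolution\<close>

text \<open>The easy half of the Gibbs variational principle: \<open>ln z <= z - 1\<close> at
  \<open>z = exp h * m / f\<close>, with \<open>m\<close> the mean of \<open>f\<close>, multiplied
  by \<open>f\<close> and integrated. With \<open>f >= 1\<close> all logarithms and quotients are
  harmless.\<close>

lemma (in prob_space) entropy_duality:
  fixes f h :: "'a \<Rightarrow> real"
  assumes f1: "\<And>x. x \<in> space M \<Longrightarrow> f x \<ge> 1"
    and i1: "integrable M f" and i2: "integrable M (\<lambda>x. f x * ln (f x))"
    and i3: "integrable M (\<lambda>x. f x * h x)" and i4: "integrable M (\<lambda>x. exp (h x))"
    and h: "(\<integral>x. exp (h x) \<partial>M) = 1"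
  shows "(\<integral>x. f x * h x \<partial>M) \<le> (\<integral>x. f x * ln (f x) \<partial>M) - (\<integral>x. f x \<partial>M) * ln (\<integral>x. f x \<partial>M)"
proof -
  define m where "m = (\<integral>x. f x \<partial>M)"
  have "(\<integral>x. 1 \<partial>M) \<le> m" unfolding m_def by (rule integral_mono) (use f1 i1 in auto)
  then have m: "m \<ge> 1" by (simp add: prob_space)
  have "(\<integral>x. f x * h x - f x * ln (f x) + ln m * f x \<partial>M) \<le> (\<integral>x. m * exp (h x) - f x \<partial>M)"
  proof (rule integral_mono)
    fix x assume "x \<in> space M"
    then have f: "f x \<ge> 1" by (rule f1)
    have "ln (exp (h x) * m / f x) \<le> exp (h x) * m / f x - 1"
      using f m by (intro ln_le_minus_one) (auto intro!: divide_pos_pos mult_pos_pos)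
    moreover have "ln (exp (h x) * m / f x) = h x + ln m - ln (f x)"
      using f m by (simp add: ln_div ln_mult)
    ultimately have "f x * (h x + ln m - ln (f x)) \<le> f x * (exp (h x) * m / f x - 1)"
      using f by (intro mult_left_mono) auto
    also have "\<dots> = m * exp (h x) - f x" using f by (simp add: right_diff_distrib)
    finally show "f x * h x - f x * ln (f x) + ln m * f x \<le> m * exp (h x) - f x"
      by (simp add: algebra_simps)
  qed (use i1 i2 i3 i4 in auto)
  also have "\<dots> = m - m" using i1 i4 h unfolding m_def by simp
  finally have "(\<integral>x. f x * h x \<partial>M) - (\<integral>x. f x * ln (f x) \<partial>M) + ln m * m \<le> 0"
    using i1 i2 i3 by (simp add: m_def)
  then show ?thesis unfolding m_def by (simp add: mult.commute)
qed

text \<open>A class of integrands for laws of bounded support: it contains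
  \<open>exp (l * norm s)\<close>, although that is unbounded, and is stable under products, shifts,
  averaging and (for functions \<open>>= 1\<close>) logarithms, so integrability comes for
  free.\<close>

definition locally_bdd :: "('b::{real_normed_vector} \<Rightarrow> real) \<Rightarrow> bool" where
  "locally_bdd \<phi> \<longleftrightarrow> \<phi> \<in> borel_measurable borel \<and> (\<forall>R. \<exists>K. \<forall>s. norm s \<le> R \<longrightarrow> \<bar>\<phi> s\<bar> \<le> K)"

lemma locally_bdd_measurable: "locally_bdd \<phi> \<Longrightarrow> \<phi> \<in> borel_measurable borel"
  by (simp add: locally_bdd_def)

lemma locally_bddE:
  assumes "locally_bdd \<phi>" obtains K where "K \<ge> 0" "\<And>s. norm s \<le> R \<Longrightarrow> \<bar>\<phi> s\<bar> \<le> K"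
proof -
  from assms obtain K where K: "\<And>s. norm s \<le> R \<Longrightarrow> \<bar>\<phi> s\<bar> \<le> K" unfolding locally_bdd_def by blast
  show thesis by (rule that[of "max 0 K"]) (use K in \<open>auto simp: le_max_iff_disj\<close>)
qed

lemma locally_bddI:
  assumes "\<phi> \<in> borel_measurable borel" "\<And>R. \<exists>K. \<forall>s. norm s \<le> R \<longrightarrow> \<bar>\<phi> s\<bar> \<le> K"
  shows "locally_bdd \<phi>"
  using assms by (simp add: locally_bdd_def)

lemma locally_bdd_mult:
  assumes f: "locally_bdd f" and g: "locally_bdd g" shows "locally_bdd (\<lambda>s. f s * g s)"
proof (rule locally_bddI)
  show "(\<lambda>s. f s * g s) \<in> borel_measurable borel"
    using f g by (intro borel_measurable_times locally_bdd_measurable)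
  fix R
  obtain K where K: "K \<ge> 0" "\<And>s. norm s \<le> R \<Longrightarrow> \<bar>f s\<bar> \<le> K" using locally_bddE[OF f] by blast
  obtain L where L: "L \<ge> 0" "\<And>s. norm s \<le> R \<Longrightarrow> \<bar>g s\<bar> \<le> L" using locally_bddE[OF g] by blast
  show "\<exists>K. \<forall>s. norm s \<le> R \<longrightarrow> \<bar>f s * g s\<bar> \<le> K"
    by (rule exI[of _ "K * L"]) (use K L in \<open>auto simp: abs_mult intro!: mult_mono\<close>)
qed

lemma locally_bdd_diff:
  assumes f: "locally_bdd f" and g: "locally_bdd g" shows "locally_bdd (\<lambda>s. f s - g s)"
proof (rule locally_bddI)
  show "(\<lambda>s. f s - g s) \<in> borel_measurable borel"
    using f g by (intro borel_measurable_diff locally_bdd_measurable)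
  fix R
  obtain K where K: "K \<ge> 0" "\<And>s. norm s \<le> R \<Longrightarrow> \<bar>f s\<bar> \<le> K" using locally_bddE[OF f] by blast
  obtain L where L: "L \<ge> 0" "\<And>s. norm s \<le> R \<Longrightarrow> \<bar>g s\<bar> \<le> L" using locally_bddE[OF g] by blast
  show "\<exists>K. \<forall>s. norm s \<le> R \<longrightarrow> \<bar>f s - g s\<bar> \<le> K"
    by (rule exI[of _ "K + L"]) (use K(2) L(2) in \<open>force simp: abs_le_iff\<close>)
qed

lemma locally_bdd_cmult: "locally_bdd f \<Longrightarrow> locally_bdd (\<lambda>s. c * f s)"
  by (rule locally_bdd_mult[where f="\<lambda>_. c"]) (auto intro!: locally_bddI)

lemma locally_bdd_ln:
  assumes f: "locally_bdd f" and f1: "\<And>s. f s \<ge> 1" shows "locally_bdd (\<lambda>s. ln (f s))"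
proof (rule locally_bddI)
  show "(\<lambda>s. ln (f s)) \<in> borel_measurable borel"
    using f by (intro borel_measurable_ln locally_bdd_measurable)
  fix R
  obtain K where K: "K \<ge> 0" "\<And>s. norm s \<le> R \<Longrightarrow> \<bar>f s\<bar> \<le> K" using locally_bddE[OF f] by blast
  show "\<exists>K. \<forall>s. norm s \<le> R \<longrightarrow> \<bar>ln (f s)\<bar> \<le> K"
  proof (intro exI[of _ K] allI impI)
    fix s :: 'a assume s: "norm s \<le> R"
    have "ln (f s) \<ge> 0" using f1[of s] by simp
    moreover have "ln (f s) \<le> f s - 1" using f1[of s] by (intro ln_le_minus_one) auto
    ultimately show "\<bar>ln (f s)\<bar> \<le> K" using K(2)[OF s] by linarith
  qed
qed

lemma locally_bdd_shift:
  fixes f :: "'b::{real_normed_vector,second_countable_topology} \<Rightarrow> real"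
  assumes f: "locally_bdd f" shows "locally_bdd (\<lambda>y. f (s + y))"
proof (rule locally_bddI)
  note [measurable] = locally_bdd_measurable[OF f]
  show "(\<lambda>y. f (s + y)) \<in> borel_measurable borel" by measurable
  fix R
  obtain K where K: "K \<ge> 0" "\<And>z. norm z \<le> norm s + R \<Longrightarrow> \<bar>f z\<bar> \<le> K" using locally_bddE[OF f] by blast
  show "\<exists>K. \<forall>y. norm y \<le> R \<longrightarrow> \<bar>f (s + y)\<bar> \<le> K"
    by (rule exI[of _ K]) (use K(2) in \<open>auto intro!: K(2) order_trans[OF norm_triangle_ineq]\<close>)
qed

lemma locally_bdd_continuous_norm:
  fixes g :: "real \<Rightarrow> real"
  assumes g: "continuous_on UNIV g" shows "locally_bdd (\<lambda>s::'b::real_normed_vector. g (norm s))"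
proof (rule locally_bddI)
  show "(\<lambda>s::'b. g (norm s)) \<in> borel_measurable borel"
    using g by (intro borel_measurable_continuous_onI continuous_on_compose2[OF g]) (auto intro: continuous_intros)
  fix R :: real
  have "compact (g ` {0..R})" by (intro compact_continuous_image continuous_on_subset[OF g]) auto
  then obtain K where "\<And>x. x \<in> g ` {0..R} \<Longrightarrow> norm x \<le> K" using compact_imp_bounded bounded_iff by metis
  then show "\<exists>K. \<forall>s::'b. norm s \<le> R \<longrightarrow> \<bar>g (norm s)\<bar> \<le> K"
    by (intro exI[of _ K]) fastforce
qed

section \<open>The transition operator of a walk with bounded steps, and its entropy\<close>

locale bdd_law = prob_space N
  for N :: "'b::{banach,second_countable_topology} measure" and b :: real +
  assumes sets_N[measurable_cong]: "sets N = sets borel"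
    and b_nonneg: "b \<ge> 0" and AE_bound: "AE y in N. norm y \<le> b"
begin

text \<open>\<open>(T ^^ n) \<phi> s\<close> is the mean of \<open>\<phi>\<close> after
  \<open>n\<close> independent steps with law \<open>N\<close> from \<open>s\<close>;
  \<open>expectation_fun_sum\<close> makes this precise.\<close>

definition T :: "('b \<Rightarrow> real) \<Rightarrow> 'b \<Rightarrow> real" where
  "T \<phi> s = (\<integral>y. \<phi> (s + y) \<partial>N)"

lemma measurable_N[simp]: "f \<in> borel_measurable N \<longleftrightarrow> f \<in> borel_measurable borel"
  by (simp add: measurable_cong_sets[OF sets_N refl])

lemma integrable_locally_bdd:
  assumes f: "locally_bdd f" shows "integrable N f"
proof -
  obtain K where K: "K \<ge> 0" "\<And>z. norm z \<le> b \<Longrightarrow> \<bar>f z\<bar> \<le> K" using locally_bddE[OF f] by blast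
  have "AE y in N. norm (f y) \<le> K" using AE_bound by eventually_elim (use K(2) in auto)
  then show ?thesis
    using locally_bdd_measurable[OF f] by (intro integrable_const_bound) (auto simp: sets_N)
qed

lemma integrable_shift: "locally_bdd f \<Longrightarrow> integrable N (\<lambda>y. f (s + y))"
  by (intro integrable_locally_bdd locally_bdd_shift)

lemma T_bound:
  assumes f: "\<phi> \<in> borel_measurable borel" and K: "K \<ge> 0" "\<And>z. norm z \<le> norm s + b \<Longrightarrow> \<bar>\<phi> z\<bar> \<le> K"
  shows "\<bar>T \<phi> s\<bar> \<le> K"
proof -
  note [measurable] = f
  have ae: "AE y in N. norm (\<phi> (s + y)) \<le> K"
    using AE_bound by eventually_elim (auto intro!: K(2) order_trans[OF norm_triangle_ineq])
  have "norm (T \<phi> s) \<le> (\<integral>y. norm (\<phi> (s + y)) \<partial>N)" unfolding T_def by (rule integral_norm_bound)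
  also have "\<dots> \<le> (\<integral>y. K \<partial>N)"
  proof (rule integral_mono_AE)
    show "integrable N (\<lambda>y. norm (\<phi> (s + y)))"
      by (intro integrable_norm integrable_const_bound[OF ae]) simp
  qed (use ae in auto)
  also have "\<dots> = K" by (simp add: prob_space)
  finally show ?thesis by simp
qed

lemma locally_bdd_T:
  assumes f: "locally_bdd \<phi>" shows "locally_bdd (T \<phi>)"
proof (rule locally_bddI)
  note [measurable] = locally_bdd_measurable[OF f]
  have "(\<lambda>s. \<integral>y. \<phi> (s + y) \<partial>N) \<in> borel_measurable borel"
    by (rule borel_measurable_lebesgue_integral) measurable
  then show "T \<phi> \<in> borel_measurable borel" by (simp add: T_def[abs_def])
  fix R
  obtain K where K: "K \<ge> 0" "\<And>z. norm z \<le> R + b \<Longrightarrow> \<bar>\<phi> z\<bar> \<le> K" using locally_bddE[OF f] by blast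
  show "\<exists>K. \<forall>s. norm s \<le> R \<longrightarrow> \<bar>T \<phi> s\<bar> \<le> K"
    by (intro exI[of _ K] allI impI T_bound) (use K in auto)
qed

lemma locally_bdd_Tn: "locally_bdd \<phi> \<Longrightarrow> locally_bdd ((T ^^ n) \<phi>)"
  by (induction n) (auto intro: locally_bdd_T)

lemma T_diff: "locally_bdd f \<Longrightarrow> locally_bdd g \<Longrightarrow> T (\<lambda>s. f s - g s) = (\<lambda>s. T f s - T g s)"
  by (auto simp: T_def fun_eq_iff integrable_shift)

lemma T_cmult: "T (\<lambda>s. c * f s) = (\<lambda>s. c * T f s)"
  by (auto simp: T_def fun_eq_iff)

lemma T_mono: "locally_bdd f \<Longrightarrow> locally_bdd g \<Longrightarrow> (\<And>s. f s \<le> g s) \<Longrightarrow> T f s \<le> T g s"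
  unfolding T_def by (intro integral_mono integrable_shift) auto

lemma Tn_diff: "locally_bdd f \<Longrightarrow> locally_bdd g \<Longrightarrow> (T ^^ n) (\<lambda>s. f s - g s) = (\<lambda>s. (T ^^ n) f s - (T ^^ n) g s)"
proof (induction n)
  case (Suc n)
  then show ?case by (simp add: T_diff[OF locally_bdd_Tn locally_bdd_Tn])
qed simp

lemma Tn_cmult: "(T ^^ n) (\<lambda>s. c * f s) = (\<lambda>s. c * (T ^^ n) f s)"
  by (induction n) (auto simp: T_cmult)

lemma Tn_mono: "locally_bdd f \<Longrightarrow> locally_bdd g \<Longrightarrow> (\<And>s. f s \<le> g s) \<Longrightarrow> (T ^^ n) f s \<le> (T ^^ n) g s"
  by (induction n arbitrary: s) (auto intro!: T_mono locally_bdd_Tn)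

lemma T_const: "T (\<lambda>_. c) = (\<lambda>_. c)"
  by (simp add: T_def[abs_def] prob_space)

lemma Tn_const: "(T ^^ n) (\<lambda>_. c) = (\<lambda>_. c)"
  by (induction n) (auto simp: T_const)

lemma locally_bdd_const: "locally_bdd (\<lambda>_::'b. c)"
  by (intro locally_bddI) auto

lemma T_ge1: "locally_bdd f \<Longrightarrow> (\<And>s. f s \<ge> 1) \<Longrightarrow> T f s \<ge> 1"
  using T_mono[OF locally_bdd_const[of 1], of f s] by (simp add: T_const)

text \<open>The entropy of \<open>y \<mapsto> \<phi> (s + y)\<close> under \<open>N\<close>: one
  coordinate varies, while \<open>s\<close> stands for the sum of the others.\<close>

definition ent :: "('b \<Rightarrow> real) \<Rightarrow> 'b \<Rightarrow> real" where
  "ent \<phi> s = T (\<lambda>x. \<phi> x * ln (\<phi> x)) s - T \<phi> s * ln (T \<phi> s)"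

lemma locally_bdd_xlnx: "locally_bdd f \<Longrightarrow> (\<And>s. f s \<ge> 1) \<Longrightarrow> locally_bdd (\<lambda>s. f s * ln (f s))"
  by (intro locally_bdd_mult locally_bdd_ln)

lemma locally_bdd_ent: "locally_bdd f \<Longrightarrow> (\<And>s. f s \<ge> 1) \<Longrightarrow> locally_bdd (ent f)"
  unfolding ent_def[abs_def]
  by (intro locally_bdd_diff locally_bdd_T locally_bdd_xlnx T_ge1)

text \<open>Convexity of the entropy, from its variational formula.\<close>

lemma ent_T_le:
  assumes f: "locally_bdd \<phi>" and f1: "\<And>s. \<phi> s \<ge> 1"
  shows "ent (T \<phi>) s \<le> T (ent \<phi>) s"
proof -
  interpret P: pair_prob_space N N ..
  define \<Phi> where "\<Phi> = T \<phi>"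
  have F: "locally_bdd \<Phi>" and F1: "\<And>s. \<Phi> s \<ge> 1"
    unfolding \<Phi>_def using f f1 by (auto intro: locally_bdd_T T_ge1)
  define m where "m = T \<Phi> s"
  have m: "m \<ge> 1" unfolding m_def by (intro T_ge1 F F1)
  \<comment> \<open>The logarithm of the normalized density of \<open>\<Phi>\<close> shifted by
    \<open>s\<close>, which is the optimal test function for the entropy on the left. Using the same
    \<open>h\<close> for every shift \<open>z\<close> and averaging over \<open>z\<close> gives the
    claim by Fubini.\<close>
  define h where "h y = ln (\<Phi> (s + y)) - ln m" for y
  have lh: "locally_bdd h" unfolding h_def
    by (intro locally_bdd_diff locally_bdd_const locally_bdd_ln[OF locally_bdd_shift[OF F]] F1)
  have eh: "exp (h y) = (1 / m) * \<Phi> (s + y)" for y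
    using F1[of "s + y"] m by (simp add: h_def exp_diff)
  have i1: "integrable N (\<lambda>y. exp (h y))" unfolding eh by (intro integrable_mult_right integrable_shift F)
  have h1: "(\<integral>y. exp (h y) \<partial>N) = 1" unfolding eh
    using m by (simp add: T_def[symmetric] m_def[symmetric])
  have dual: "(\<integral>y. \<phi> (s + z + y) * h y \<partial>N) \<le> ent \<phi> (s + z)" for z
  proof -
    have "(\<integral>y. \<phi> (s + z + y) * h y \<partial>N) \<le> (\<integral>y. \<phi> (s + z + y) * ln (\<phi> (s + z + y)) \<partial>N)
       - (\<integral>y. \<phi> (s + z + y) \<partial>N) * ln (\<integral>y. \<phi> (s + z + y) \<partial>N)"
      by (intro entropy_duality f1 i1 h1 integrable_locally_bdd locally_bdd_mult lh locally_bdd_shift[OF f]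
          locally_bdd_ln)
    then show ?thesis by (simp add: ent_def T_def)
  qed
  note [measurable] = locally_bdd_measurable[OF f] locally_bdd_measurable[OF lh]
  have int2: "integrable (N \<Otimes>\<^sub>M N) (\<lambda>(z, y). \<phi> (s + z + y) * h y)"
  proof -
    obtain K where K: "K \<ge> 0" "\<And>z. norm z \<le> norm s + b + b \<Longrightarrow> \<bar>\<phi> z\<bar> \<le> K" using locally_bddE[OF f] by blast
    obtain L where L: "L \<ge> 0" "\<And>z. norm z \<le> b \<Longrightarrow> \<bar>h z\<bar> \<le> L" using locally_bddE[OF lh] by blast
    have "AE p in N \<Otimes>\<^sub>M N. norm (case p of (z, y) \<Rightarrow> \<phi> (s + z + y) * h y) \<le> K * L"
    proof (rule P.AE_pair_measure)
      show "{x \<in> space (N \<Otimes>\<^sub>M N). norm (case x of (z, y) \<Rightarrow> \<phi> (s + z + y) * h y) \<le> K * L} \<in> sets (N \<Otimes>\<^sub>M N)"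
        by measurable
      show "AE x in N. AE y in N. norm (case (x, y) of (z, y) \<Rightarrow> \<phi> (s + z + y) * h y) \<le> K * L"
        using AE_bound
      proof eventually_elim
        case (elim z)
        show ?case using AE_bound
        proof eventually_elim
          case (elim y)
          have "norm (s + z + y) \<le> norm s + b + b"
            using norm_triangle_ineq[of "s + z" y] norm_triangle_ineq[of s z] elim \<open>norm z \<le> b\<close> by linarith
          then show ?case using K L elim by (auto simp: abs_mult intro!: mult_mono)
        qed
      qed
    qed
    then show ?thesis by (intro P.integrable_const_bound[of _ "K * L"]) measurable
  qed
  have "T (\<lambda>x. \<Phi> x * ln (\<Phi> x)) s - m * ln m = (\<integral>y. \<Phi> (s + y) * h y \<partial>N)"
  proof -
    have "(\<integral>y. \<Phi> (s + y) * h y \<partial>N) = (\<integral>y. \<Phi> (s + y) * ln (\<Phi> (s + y)) - ln m * \<Phi> (s + y) \<partial>N)"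
      by (intro Bochner_Integration.integral_cong) (auto simp: h_def algebra_simps)
    also have "\<dots> = T (\<lambda>x. \<Phi> x * ln (\<Phi> x)) s - ln m * m"
      using integrable_shift[OF locally_bdd_xlnx[OF F F1], of s] integrable_shift[OF F, of s]
      by (simp add: T_def m_def)
    finally show ?thesis by (simp add: mult.commute)
  qed
  also have "(\<integral>y. \<Phi> (s + y) * h y \<partial>N) = (\<integral>y. \<integral>z. \<phi> (s + z + y) * h y \<partial>N \<partial>N)"
    by (intro Bochner_Integration.integral_cong) (auto simp: \<Phi>_def T_def add_ac)
  also have "\<dots> = (\<integral>z. \<integral>y. \<phi> (s + z + y) * h y \<partial>N \<partial>N)"
    by (rule P.Fubini_integral[OF int2])
  also have "\<dots> \<le> (\<integral>z. ent \<phi> (s + z) \<partial>N)"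
    by (rule integral_mono[OF P.integrable_fst[OF int2, simplified] _ dual])
       (intro integrable_shift locally_bdd_ent f f1)
  finally show ?thesis unfolding ent_def[of "T \<phi>"] m_def \<Phi>_def T_def[of "ent \<phi>"] .
qed

text \<open>Subadditivity of entropy for a sum of i.i.d. variables. Since the summands are exchangeable, all
  coordinate entropies have the same mean, and iterating the convolution operator avoids product
  measures.\<close>

lemma entropy_tensorization:
  assumes f: "locally_bdd \<phi>" and f1: "\<And>s. \<phi> s \<ge> 1"
  shows "(T ^^ Suc n) (\<lambda>x. \<phi> x * ln (\<phi> x)) s - (T ^^ Suc n) \<phi> s * ln ((T ^^ Suc n) \<phi> s)
    \<le> real (Suc n) * (T ^^ n) (ent \<phi>) s"
  using f f1
proof (induction n arbitrary: \<phi>)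
  case 0
  then show ?case by (simp add: ent_def)
next
  case (Suc n)
  note f = Suc.prems
  have F: "locally_bdd (T \<phi>)" and F1: "\<And>s. T \<phi> s \<ge> 1"
    using f by (auto intro: locally_bdd_T T_ge1)
  \<comment> \<open>Chain rule: the total entropy is the averaged entropy of the last step plus the
    entropy of \<open>T \<phi>\<close> over the remaining steps. Convexity then moves
    \<open>T\<close> out of \<open>ent (T \<phi>)\<close>, so every step contributes the same
    term.\<close>
  have "(T ^^ Suc n) (ent \<phi>) s = (T ^^ Suc n) (T (\<lambda>x. \<phi> x * ln (\<phi> x))) s - (T ^^ Suc n) (\<lambda>x. T \<phi> x * ln (T \<phi> x)) s"
    unfolding ent_def[abs_def]
    by (subst Tn_diff) (auto intro!: locally_bdd_T locally_bdd_xlnx f F F1)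
  moreover have "(T ^^ Suc n) (\<lambda>x. T \<phi> x * ln (T \<phi> x)) s - (T ^^ Suc n) (T \<phi>) s * ln ((T ^^ Suc n) (T \<phi>) s)
    \<le> real (Suc n) * (T ^^ n) (ent (T \<phi>)) s"
    by (rule Suc.IH[OF F F1])
  moreover have "(T ^^ n) (ent (T \<phi>)) s \<le> (T ^^ n) (T (ent \<phi>)) s"
    by (intro Tn_mono ent_T_le f locally_bdd_ent F F1 locally_bdd_T)
  moreover have sw: "(T ^^ Suc k) g = (T ^^ k) (T g)" for k g
    by (simp only: funpow_Suc_right comp_def)
  ultimately show ?case
    unfolding sw[of "Suc n" "\<lambda>x. \<phi> x * ln (\<phi> x)"] sw[of "Suc n" \<phi>] sw[of n "ent \<phi>"]
    by (simp add: algebra_simps)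
       (smt (verit, ccfv_SIG) mult_left_mono of_nat_0_le_iff)
qed

end

subsection \<open>Concentration of the norm of a bounded sum\<close>

lemma exp_taylor2:
  fixes u :: real
  shows "\<bar>exp u - 1 - u\<bar> \<le> u\<^sup>2 / 2 * exp \<bar>u\<bar>"
proof -
  obtain t where t: "\<bar>t\<bar> \<le> \<bar>u\<bar>" "exp u = (\<Sum>m<2. u ^ m / fact m) + exp t / fact 2 * u ^ 2"
    using Maclaurin_exp_le by blast
  have eq: "exp u - 1 - u = exp t * (u\<^sup>2 / 2)" using t(2) by (simp add: numeral_2_eq_2)
  have "\<bar>exp u - 1 - u\<bar> = exp t * (u\<^sup>2 / 2)" unfolding eq by (simp add: abs_mult)
  also have "\<dots> \<le> exp \<bar>u\<bar> * (u\<^sup>2 / 2)" using t(1) by (intro mult_right_mono) auto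
  finally show ?thesis by (simp add: mult.commute)
qed

text \<open>The left side equals \<open>exp u * (exp (- u) - 1 + u)\<close>. The leading
  \<open>u\<^sup>2 / 2\<close> is kept and the correction \<open>exp (2 * k)\<close> tends to
  \<open>1\<close> as \<open>k\<close> tends to \<open>0\<close>, so the constant in the exponent
  remains sharp.\<close>

lemma exp_entropy_bound:
  fixes u :: real assumes "\<bar>u\<bar> \<le> k"
  shows "u * exp u - exp u + 1 \<le> exp (2 * k) * (u\<^sup>2 / 2)"
proof -
  have "exp (- u) - 1 + u \<le> u\<^sup>2 / 2 * exp \<bar>u\<bar>"
    using exp_taylor2[of "-u"] unfolding abs_minus_cancel power2_minus by linarith
  then have "exp u * (exp (- u) - 1 + u) \<le> exp u * (u\<^sup>2 / 2 * exp \<bar>u\<bar>)" by (intro mult_left_mono) auto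
  also have "\<dots> = exp (u + \<bar>u\<bar>) * (u\<^sup>2 / 2)" by (simp add: exp_add)
  also have "\<dots> \<le> exp (2 * k) * (u\<^sup>2 / 2)" using assms by (intro mult_right_mono) auto
  finally have "exp u * (exp (- u) - 1 + u) \<le> exp (2 * k) * (u\<^sup>2 / 2)" .
  moreover have "exp u * (exp (- u) - 1 + u) = u * exp u - exp u + 1"
    using exp_minus_inverse[of u] by (simp add: ring_distribs)
  ultimately show ?thesis by simp
qed

text \<open>\<open>v\<close> is only an upper bound for the weak variance. A law truncated at a low
  level can thus be used with the larger value \<open>H (c n)\<close> that occurs in the
  series.\<close>

locale bdd_centered = bdd_law N b for N :: "'b::{banach,second_countable_topology} measure" and b +
  fixes v :: real
  assumes mean: "(\<integral>y. y \<partial>N) = 0"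
    and weak_var: "\<And>f :: 'b \<Rightarrow>\<^sub>L real. norm f \<le> 1 \<Longrightarrow> (\<integral>y. (blinfun_apply f y)\<^sup>2 \<partial>N) \<le> v"
begin

lemma v_nonneg: "v \<ge> 0" using weak_var[of 0] by simp

lemma integrable_id: "integrable N (\<lambda>y. y)"
  using AE_bound by (intro integrable_const_bound[of _ b]) auto

lemma integrable_bl: "integrable N (\<lambda>y. blinfun_apply f y)"
  by (rule integrable_bounded_linear[OF blinfun.bounded_linear_right integrable_id])

lemma mean_bl: "(\<integral>y. blinfun_apply f y \<partial>N) = 0"
  by (subst integral_bounded_linear[OF blinfun.bounded_linear_right integrable_id]) (simp add: mean)

lemma locally_bdd_norm_shift: "locally_bdd (\<lambda>y::'b. norm (s + y) - norm s)"
  using locally_bdd_shift[OF locally_bdd_continuous_norm[of "\<lambda>x. x"], of s]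
  by (intro locally_bdd_diff locally_bdd_const) auto

text \<open>Jensen's inequality for the norm, in linear form: a functional norming \<open>s\<close>
  lies below the increment and has mean zero. This is the submartingale property of the norm of the
  walk.\<close>

lemma increment_nonneg: "(\<integral>y. norm (s + y) - norm s \<partial>N) \<ge> 0"
proof -
  obtain f :: "'b \<Rightarrow>\<^sub>L real" where f: "norm f \<le> 1" "blinfun_apply f s = norm s" by (rule norming_functional)
  have "(\<integral>y. blinfun_apply f y \<partial>N) \<le> (\<integral>y. norm (s + y) - norm s \<partial>N)"
  proof (intro integral_mono integrable_bl integrable_locally_bdd locally_bdd_norm_shift)
    fix y
    have "blinfun_apply f (s + y) \<le> norm f * norm (s + y)" using norm_blinfun[of f "s + y"] by auto
    also have "\<dots> \<le> 1 * norm (s + y)" by (intro mult_right_mono f) auto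
    finally show "blinfun_apply f y \<le> norm (s + y) - norm s" by (simp add: blinfun.add_right f)
  qed
  then show ?thesis by (simp add: mean_bl)
qed

text \<open>With \<open>f\<close> norming \<open>s\<close>, the increment \<open>d\<close> of the norm satisfies \<open>f y \<le> d\<close> and both are at most \<open>b\<close>, so
  \<open>d\<^sup>2 - (f y)\<^sup>2 \<le> 2 * b * (d - f y)\<close>. This is why only the weak variance \<open>v\<close> enters.\<close>

lemma increment_sq:
  "(\<integral>y. (norm (s + y) - norm s)\<^sup>2 \<partial>N) \<le> v + 2 * b * (\<integral>y. norm (s + y) - norm s \<partial>N)"
proof -
  obtain f :: "'b \<Rightarrow>\<^sub>L real" where f: "norm f \<le> 1" "blinfun_apply f s = norm s" by (rule norming_functional)
  have i2: "integrable N (\<lambda>y. (norm (s + y) - norm s)\<^sup>2)"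
    unfolding power2_eq_square by (intro integrable_locally_bdd locally_bdd_mult locally_bdd_norm_shift)
  have i1: "integrable N (\<lambda>y. norm (s + y) - norm s)" by (intro integrable_locally_bdd locally_bdd_norm_shift)
  have fb: "\<bar>blinfun_apply f y\<bar> \<le> norm y" for y
    using norm_blinfun[of f y] mult_right_mono[OF f(1), of "norm y"] by simp
  have "AE y in N. norm ((blinfun_apply f y)\<^sup>2) \<le> b\<^sup>2"
    using AE_bound by eventually_elim (use fb in \<open>auto intro!: power2_le_iff_abs_le[THEN iffD2] intro: order_trans simp: b_nonneg\<close>)
  then have i3: "integrable N (\<lambda>y. (blinfun_apply f y)\<^sup>2)"
    by (intro integrable_const_bound[of _ "b\<^sup>2"]) (auto intro!: borel_measurable_power borel_measurable_integrable[OF integrable_bl, simplified])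
  have "(\<integral>y. (norm (s + y) - norm s)\<^sup>2 \<partial>N)
      \<le> (\<integral>y. (blinfun_apply f y)\<^sup>2 + 2 * b * ((norm (s + y) - norm s) - blinfun_apply f y) \<partial>N)"
  proof (rule integral_mono_AE[OF i2])
    show "integrable N (\<lambda>y. (blinfun_apply f y)\<^sup>2 + 2 * b * ((norm (s + y) - norm s) - blinfun_apply f y))"
      using i3 i1 integrable_bl[of f] by auto
    show "AE y in N. (norm (s + y) - norm s)\<^sup>2
       \<le> (blinfun_apply f y)\<^sup>2 + 2 * b * ((norm (s + y) - norm s) - blinfun_apply f y)"
      using AE_bound
    proof eventually_elim
      case (elim y)
      define d where "d = norm (s + y) - norm s"
      define e where "e = blinfun_apply f y"
      have "blinfun_apply f (s + y) \<le> norm f * norm (s + y)" using norm_blinfun[of f "s + y"] by auto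
      also have "\<dots> \<le> 1 * norm (s + y)" by (intro mult_right_mono f) auto
      finally have "e \<le> d" by (simp add: blinfun.add_right f d_def e_def)
      moreover have "d \<le> b" using elim norm_triangle_ineq[of s y] by (simp add: d_def)
      moreover have "e \<le> b" using elim fb[of y] by (simp add: e_def)
      ultimately have "(d - e) * (d + e) \<le> (d - e) * (2 * b)" by (intro mult_left_mono) auto
      then show ?case unfolding d_def[symmetric] e_def[symmetric]
        by (simp add: algebra_simps power2_eq_square)
    qed
  qed
  also have "\<dots> = (\<integral>y. (blinfun_apply f y)\<^sup>2 \<partial>N) + 2 * b * (\<integral>y. norm (s + y) - norm s \<partial>N)"
    using i1 i3 integrable_bl[of f] by (simp add: mean_bl)
  finally show ?thesis using weak_var[OF f(1)] by simp
qed

text \<open>The error term of \<open>increment_sq\<close>, weighted by the exponential that the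
  entropy carries. The weight sits at \<open>s + y\<close>, not at \<open>s\<close>, so that the sum
  over all coordinates can be compared with the derivative of the Laplace transform of the
  norm.\<close>

definition wincr :: "real \<Rightarrow> 'b \<Rightarrow> real" where
  "wincr l s = (\<integral>y. exp (l * norm (s + y)) * (norm (s + y) - norm s) \<partial>N)"

lemma locally_bdd_exp_norm: "locally_bdd (\<lambda>s::'b. exp (l * norm s))"
  by (rule locally_bdd_continuous_norm[where g="\<lambda>x. exp (l * x)"]) (intro continuous_intros)

lemma locally_bdd_norm: "locally_bdd (\<lambda>s::'b. norm s)"
  by (rule locally_bdd_continuous_norm[where g="\<lambda>x. x"]) (intro continuous_intros)

lemma wincr_eq: "wincr l s = T (\<lambda>s. norm s * exp (l * norm s)) s - norm s * T (\<lambda>s. exp (l * norm s)) s"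
proof -
  have "wincr l s = (\<integral>y. norm (s + y) * exp (l * norm (s + y)) - norm s * exp (l * norm (s + y)) \<partial>N)"
    unfolding wincr_def by (intro Bochner_Integration.integral_cong) (auto simp: algebra_simps)
  also have "\<dots> = T (\<lambda>s. norm s * exp (l * norm s)) s - norm s * T (\<lambda>s. exp (l * norm s)) s"
    using integrable_shift[OF locally_bdd_mult[OF locally_bdd_norm locally_bdd_exp_norm[of l]], of s]
      integrable_shift[OF locally_bdd_exp_norm[of l], of s]
    by (simp add: T_def)
  finally show ?thesis .
qed

lemma locally_bdd_wincr: "locally_bdd (wincr l)"
  unfolding wincr_eq[abs_def]
  by (intro locally_bdd_diff locally_bdd_mult locally_bdd_T locally_bdd_norm locally_bdd_exp_norm)

text \<open>For every constant \<open>k > 0\<close> the entropy of \<open>g\<close> is at most the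
  mean of \<open>g * ln (g / k) - g + k\<close>. With \<open>k = exp (l * norm s)\<close> the
  integrand becomes \<open>exp w * (u * exp u - exp u + 1)\<close>, \<open>u\<close> being
  \<open>l\<close> times the increment, and \<open>exp_entropy_bound\<close> and
  \<open>increment_sq\<close> apply.\<close>

lemma ent_exp_norm:
  assumes l: "l \<ge> 0"
  shows "ent (\<lambda>s. exp (l * norm s)) s
    \<le> exp (2 * l * b) * l\<^sup>2 / 2 * (v * T (\<lambda>s. exp (l * norm s)) s + 2 * b * wincr l s)"
proof -
  define w where "w = l * norm s"
  define d where "d y = norm (s + y) - norm s" for y
  have eq: "exp (l * norm (s + y)) = exp w * exp (l * d y)" for y
    unfolding exp_add[symmetric] by (simp add: w_def d_def algebra_simps)
  have iE: "integrable N (\<lambda>y. exp (l * norm (s + y)))"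
    by (intro integrable_shift locally_bdd_exp_norm)
  have id: "integrable N d" unfolding d_def by (intro integrable_locally_bdd locally_bdd_norm_shift)
  have id2: "integrable N (\<lambda>y. (d y)\<^sup>2)" unfolding d_def power2_eq_square
    by (intro integrable_locally_bdd locally_bdd_mult locally_bdd_norm_shift)
  have iEd: "integrable N (\<lambda>y. exp (l * norm (s + y)) * d y)" unfolding d_def
    by (intro integrable_locally_bdd locally_bdd_mult locally_bdd_norm_shift locally_bdd_shift locally_bdd_exp_norm)
  define m where "m = T (\<lambda>s. exp (l * norm s)) s"
  have m1: "m \<ge> 1" unfolding m_def by (intro T_ge1 locally_bdd_exp_norm) (use l in simp)
  have wm: "exp w \<le> m"
  proof -
    have "(\<integral>y. exp w * (1 + l * d y) \<partial>N) \<le> (\<integral>y. exp (l * norm (s + y)) \<partial>N)"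
      by (intro integral_mono iE) (use id in \<open>auto simp: eq\<close>)
    moreover have "(\<integral>y. exp w * (1 + l * d y) \<partial>N) = exp w * (1 + l * (\<integral>y. d y \<partial>N))"
      using id by (simp add: prob_space)
    moreover have "exp w * (1 + l * (\<integral>y. d y \<partial>N)) \<ge> exp w * 1"
      using increment_nonneg[of s] l by (intro mult_left_mono) (auto simp: d_def)
    ultimately show ?thesis unfolding m_def T_def by linarith
  qed
  have mln: "m * ln m \<ge> m * w + m - exp w"
  proof -
    have "ln (exp w / m) \<le> exp w / m - 1" using m1 by (intro ln_le_minus_one) auto
    then have "m * (w - ln m) \<le> m * (exp w / m - 1)" using m1 by (intro mult_left_mono) (auto simp: ln_div)
    then show ?thesis using m1 by (simp add: algebra_simps)
  qed
  have iel: "integrable N (\<lambda>y. exp (l * norm (s + y)) * (l * norm (s + y)))"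
    by (rule integrable_shift[OF locally_bdd_mult[OF locally_bdd_exp_norm locally_bdd_cmult[OF locally_bdd_norm]]])
  have "ent (\<lambda>s. exp (l * norm s)) s \<le> T (\<lambda>x. exp (l * norm x) * (l * norm x)) s - (m * w + m - exp w)"
    using mln by (simp add: ent_def m_def)
  also have "\<dots> = (\<integral>y. exp (l * norm (s + y)) * (l * norm (s + y)) - exp (l * norm (s + y)) * (w + 1) + exp w \<partial>N)"
    using iel iE by (simp add: T_def m_def algebra_simps prob_space)
  also have "\<dots> \<le> (\<integral>y. exp w * (exp (2 * (l * b)) * ((l * d y)\<^sup>2 / 2)) \<partial>N)"
  proof (rule integral_mono_AE)
    show "integrable N (\<lambda>y. exp (l * norm (s + y)) * (l * norm (s + y)) - exp (l * norm (s + y)) * (w + 1) + exp w)"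
      using iel iE by auto
    show "integrable N (\<lambda>y. exp w * (exp (2 * (l * b)) * ((l * d y)\<^sup>2 / 2)))"
      using id2 by (auto simp: power_mult_distrib)
    show "AE y in N. exp (l * norm (s + y)) * (l * norm (s + y)) - exp (l * norm (s + y)) * (w + 1) + exp w
        \<le> exp w * (exp (2 * (l * b)) * ((l * d y)\<^sup>2 / 2))"
      using AE_bound
    proof eventually_elim
      case (elim y)
      have "\<bar>d y\<bar> \<le> b" using elim norm_triangle_ineq[of s y] norm_triangle_ineq2[of s "-y"]
        by (simp add: d_def abs_le_iff)
      then have u: "\<bar>l * d y\<bar> \<le> l * b" using l by (simp add: abs_mult mult_left_mono)
      have "exp (l * norm (s + y)) * (l * norm (s + y)) - exp (l * norm (s + y)) * (w + 1) + exp w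
        = exp w * ((l * d y) * exp (l * d y) - exp (l * d y) + 1)"
        unfolding eq by (simp add: d_def w_def algebra_simps)
      also have "\<dots> \<le> exp w * (exp (2 * (l * b)) * ((l * d y)\<^sup>2 / 2))"
        by (intro mult_left_mono exp_entropy_bound u) auto
      finally show ?case .
    qed
  qed
  also have "\<dots> = exp (2 * l * b) * l\<^sup>2 / 2 * (exp w * (\<integral>y. (d y)\<^sup>2 \<partial>N))"
    by (simp add: power_mult_distrib mult_ac)
  also have "\<dots> \<le> exp (2 * l * b) * l\<^sup>2 / 2 * (exp w * (v + 2 * b * (\<integral>y. d y \<partial>N)))"
    using increment_sq[of s] by (intro mult_left_mono) (auto simp: d_def)
  also have "\<dots> = exp (2 * l * b) * l\<^sup>2 / 2 * (v * exp w + 2 * b * (\<integral>y. exp w * d y \<partial>N))"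
    using id by (simp add: algebra_simps)
  also have "\<dots> \<le> exp (2 * l * b) * l\<^sup>2 / 2 * (v * m + 2 * b * wincr l s)"
  proof (intro mult_left_mono add_mono wm v_nonneg)
    show "(\<integral>y. exp w * d y \<partial>N) \<le> wincr l s"
      unfolding wincr_def d_def[symmetric]
    proof (intro integral_mono iEd)
      fix y
      \<comment> \<open>Both factors have the same sign, so moving the weight from \<open>s\<close>
        to \<open>s + y\<close> only increases the integral.\<close>
      have "0 \<le> (exp (l * d y) - 1) * d y"
        using l by (cases "d y \<ge> 0") (auto intro!: mult_nonpos_nonpos simp: mult_nonneg_nonpos)
      then have "exp w * d y \<le> exp w * (exp (l * d y) * d y)" by (intro mult_left_mono) (auto simp: algebra_simps)
      then show "exp w * d y \<le> exp (l * norm (s + y)) * d y" unfolding eq by (simp add: mult_ac)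
    qed (use id in auto)
  qed (use b_nonneg in auto)
  finally show ?thesis by (simp add: m_def)
qed

end

text \<open>Divided by \<open>l\<^sup>2 * F l\<close>, the hypothesis says that
  \<open>ln (F l) / l - q / 2 * (L * l + 2 * b * ln (F l))\<close> does not increase. Its limit at
  \<open>0\<close> from the right is \<open>F' 0\<close>, the mean when \<open>F\<close> is a
  Laplace transform, and this bounds its value at \<open>l0\<close>.\<close>

lemma herbst:
  fixes F F' :: "real \<Rightarrow> real"
  assumes D: "\<And>l. (F has_real_derivative F' l) (at l)"
    and F0: "F 0 = 1" and Fpos: "\<And>l. F l > 0"
    and l0: "l0 > 0"
    and ineq: "\<And>l. 0 < l \<Longrightarrow> l \<le> l0 \<Longrightarrow> l * F' l - F l * ln (F l) \<le> q * l\<^sup>2 / 2 * (L * F l + 2 * b * F' l)"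
  shows "ln (F l0) * (1 - q * b * l0) \<le> l0 * F' 0 + q * l0\<^sup>2 * L / 2"
proof -
  define w where "w l = ln (F l) / l - q / 2 * (L * l + 2 * b * ln (F l))" for l
  have DL: "((\<lambda>l. ln (F l)) has_real_derivative F' l / F l) (at l)" for l
    using DERIV_chain2[OF DERIV_ln_divide[OF Fpos] D, of l] by simp
  have mono: "w l0 \<le> w l" if l: "0 < l" "l < l0" for l
  proof (rule DERIV_nonpos_imp_nonincreasing[where f=w])
    show "l \<le> l0" using l by simp
    fix x assume x: "l \<le> x" "x \<le> l0"
    then have x0: "x > 0" using l by simp
    have "(w has_real_derivative ((F' x / F x * x - ln (F x) * 1) / (x * x) - q / 2 * (L * 1 + 2 * b * (F' x / F x)))) (at x)"
      unfolding w_def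
      by (intro DERIV_diff DERIV_divide DL DERIV_ident DERIV_cmult DERIV_add) (use x0 in auto)
    moreover have "(F' x / F x * x - ln (F x) * 1) / (x * x) - q / 2 * (L * 1 + 2 * b * (F' x / F x)) \<le> 0"
    proof -
      have "(x * F' x - F x * ln (F x)) / (F x * x\<^sup>2) \<le> q * x\<^sup>2 / 2 * (L * F x + 2 * b * F' x) / (F x * x\<^sup>2)"
        using ineq[OF x0 x(2)] Fpos[of x] x0 by (intro divide_right_mono) auto
      moreover have "(x * F' x - F x * ln (F x)) / (F x * x\<^sup>2) = (F' x / F x * x - ln (F x) * 1) / (x * x)"
        using Fpos[of x] x0 by (simp add: field_simps power2_eq_square)
      moreover have "q * x\<^sup>2 / 2 * (L * F x + 2 * b * F' x) / (F x * x\<^sup>2) = q / 2 * (L * 1 + 2 * b * (F' x / F x))"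
        using Fpos[of x] x0 by (simp add: field_simps power2_eq_square)
      ultimately show ?thesis by linarith
    qed
    ultimately show "\<exists>y. (w has_real_derivative y) (at x) \<and> y \<le> 0" by blast
  qed
  have "((\<lambda>h. (ln (F (0 + h)) - ln (F 0)) / h) \<longlongrightarrow> F' 0 / F 0) (at 0)"
    using DL[of 0] unfolding DERIV_def .
  then have "((\<lambda>h. ln (F h) / h) \<longlongrightarrow> F' 0) (at_right 0)"
    by (auto simp: F0 intro: tendsto_within_subset)
  moreover have "((\<lambda>l. ln (F l)) \<longlongrightarrow> ln (F 0)) (at_right 0)"
    using DERIV_isCont[OF DL[of 0]] unfolding isCont_def by (rule tendsto_within_subset) simp
  ultimately have "(w \<longlongrightarrow> F' 0 - q / 2 * (L * 0 + 2 * b * ln (F 0))) (at_right 0)"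
    unfolding w_def by (intro tendsto_diff tendsto_mult tendsto_add tendsto_const tendsto_ident_at)
  then have lim: "(w \<longlongrightarrow> F' 0) (at_right 0)" by (simp add: F0)
  have ev: "\<forall>\<^sub>F l in at_right 0. w l0 \<le> w l"
    using mono l0 by (auto simp: eventually_at_right_field)
  have "w l0 \<le> F' 0" by (rule tendsto_lowerbound[OF lim ev]) simp
  then have "l0 * w l0 \<le> l0 * F' 0" using l0 by (intro mult_left_mono) auto
  moreover have "l0 * w l0 = ln (F l0) - q / 2 * (L * l0\<^sup>2 + 2 * b * l0 * ln (F l0))"
    using l0 by (simp add: w_def right_diff_distrib power2_eq_square algebra_simps)
  ultimately show ?thesis by (simp add: algebra_simps)
qed

text \<open>\<open>exp_taylor2\<close> bounds the error of the difference quotient by a constant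
  times \<open>\<bar>h\<bar>\<close>, so no limit has to be taken under the integral.\<close>

lemma (in prob_space) DERIV_mgf:
  fixes Z :: "'a \<Rightarrow> real"
  assumes [measurable]: "Z \<in> borel_measurable M" and Z: "AE x in M. \<bar>Z x\<bar> \<le> B"
  shows "((\<lambda>l. \<integral>x. exp (l * Z x) \<partial>M) has_real_derivative (\<integral>x. Z x * exp (l * Z x) \<partial>M)) (at l)"
proof -
  define F where "F l = (\<integral>x. exp (l * Z x) \<partial>M)" for l
  define D where "D = (\<integral>x. Z x * exp (l * Z x) \<partial>M)"
  have "AE x in M. B \<ge> 0" using Z by eventually_elim auto
  then have B: "B \<ge> 0" by simp
  have iE: "integrable M (\<lambda>x. exp (l * Z x))" for l
  proof (rule integrable_const_bound[of _ "exp (\<bar>l\<bar> * B)"])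
    show "AE x in M. norm (exp (l * Z x)) \<le> exp (\<bar>l\<bar> * B)" using Z
    proof eventually_elim
      case (elim x)
      have "l * Z x \<le> \<bar>l\<bar> * \<bar>Z x\<bar>" using abs_ge_self[of "l * Z x"] by (simp only: abs_mult)
      also have "\<dots> \<le> \<bar>l\<bar> * B" using elim by (intro mult_left_mono) auto
      finally show ?case by simp
    qed
  qed simp
  have iZE: "integrable M (\<lambda>x. Z x * exp (l * Z x))"
  proof (rule Bochner_Integration.integrable_bound[OF integrable_mult_right[OF iE[of l], of B]])
    show "AE x in M. norm (Z x * exp (l * Z x)) \<le> norm (B * exp (l * Z x))"
      using Z by eventually_elim (use B in \<open>auto simp: abs_mult\<close>)
  qed simp
  define C where "C = exp (\<bar>l\<bar> * B) * (B\<^sup>2 / 2 * exp B)"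
  have bound: "\<bar>(F (l + h) - F l) / h - D\<bar> \<le> C * \<bar>h\<bar>" if h: "h \<noteq> 0" "\<bar>h\<bar> \<le> 1" for h
  proof -
    have "F (l + h) - F l - h * D = (\<integral>x. exp ((l + h) * Z x) - exp (l * Z x) - h * (Z x * exp (l * Z x)) \<partial>M)"
      unfolding F_def D_def using iE iZE by simp
    then have "\<bar>F (l + h) - F l - h * D\<bar> = norm (\<integral>x. exp ((l + h) * Z x) - exp (l * Z x) - h * (Z x * exp (l * Z x)) \<partial>M)"
      by (simp only: real_norm_def)
    also have "\<dots> \<le> (\<integral>x. norm (exp ((l + h) * Z x) - exp (l * Z x) - h * (Z x * exp (l * Z x))) \<partial>M)"
      by (rule integral_norm_bound)
    also have "\<dots> \<le> (\<integral>x. C * h\<^sup>2 \<partial>M)"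
    proof (rule integral_mono_AE)
      show "AE x in M. norm (exp ((l + h) * Z x) - exp (l * Z x) - h * (Z x * exp (l * Z x))) \<le> C * h\<^sup>2"
        using Z
      proof eventually_elim
        case (elim x)
        have "exp ((l + h) * Z x) - exp (l * Z x) - h * (Z x * exp (l * Z x))
          = exp (l * Z x) * (exp (h * Z x) - 1 - h * Z x)" by (simp add: algebra_simps exp_add)
        also have "norm \<dots> = exp (l * Z x) * \<bar>exp (h * Z x) - 1 - h * Z x\<bar>" by (simp add: abs_mult)
        also have "\<dots> \<le> exp (\<bar>l\<bar> * B) * ((h * Z x)\<^sup>2 / 2 * exp \<bar>h * Z x\<bar>)"
        proof (intro mult_mono exp_taylor2)
          have "l * Z x \<le> \<bar>l\<bar> * \<bar>Z x\<bar>" using abs_ge_self[of "l * Z x"] by (simp only: abs_mult)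
          also have "\<dots> \<le> \<bar>l\<bar> * B" using elim by (intro mult_left_mono) auto
          finally show "exp (l * Z x) \<le> exp (\<bar>l\<bar> * B)" by simp
        qed auto
        also have "\<dots> \<le> exp (\<bar>l\<bar> * B) * ((h\<^sup>2 * B\<^sup>2) / 2 * exp B)"
        proof (intro mult_left_mono mult_mono divide_right_mono)
          show "(h * Z x)\<^sup>2 \<le> h\<^sup>2 * B\<^sup>2" unfolding power_mult_distrib
            using elim B by (intro mult_left_mono) (auto simp: abs_le_square_iff[symmetric])
          have "\<bar>h * Z x\<bar> \<le> 1 * B" unfolding abs_mult using elim h by (intro mult_mono) auto
          then show "exp \<bar>h * Z x\<bar> \<le> exp B" by simp
        qed auto
        finally show ?case by (simp add: C_def mult_ac)
      qed
    qed (use iE iZE in auto)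
    also have "\<dots> = C * h\<^sup>2" by (simp add: prob_space)
    finally have "\<bar>F (l + h) - F l - h * D\<bar> \<le> C * h\<^sup>2" .
    then have "\<bar>F (l + h) - F l - h * D\<bar> / \<bar>h\<bar> \<le> C * h\<^sup>2 / \<bar>h\<bar>" by (rule divide_right_mono) simp
    moreover have "C * h\<^sup>2 / \<bar>h\<bar> = C * \<bar>h\<bar>"
    proof -
      have "h\<^sup>2 = \<bar>h\<bar> * \<bar>h\<bar>" by (simp add: power2_eq_square)
      then have "C * h\<^sup>2 / \<bar>h\<bar> = C * \<bar>h\<bar> * (\<bar>h\<bar> / \<bar>h\<bar>)" by (simp only: mult_ac times_divide_eq_right)
      then show ?thesis using h by (simp only: abs_zero divide_self_if mult_1_right abs_eq_0 if_False)
    qed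
    moreover have "\<bar>F (l + h) - F l - h * D\<bar> / \<bar>h\<bar> = \<bar>(F (l + h) - F l) / h - D\<bar>"
      using h by (simp only: abs_divide[symmetric]) (simp add: diff_divide_distrib)
    ultimately show ?thesis by simp
  qed
  have "((\<lambda>h. (F (l + h) - F l) / h - D) \<longlongrightarrow> 0) (at 0)"
  proof (rule Lim_null_comparison)
    show "\<forall>\<^sub>F h in at 0. norm ((F (l + h) - F l) / h - D) \<le> C * \<bar>h\<bar>"
      unfolding eventually_at by (rule exI[of _ 1]) (use bound in \<open>auto simp: dist_real_def\<close>)
    have "((\<lambda>h. C * \<bar>h\<bar>) \<longlongrightarrow> C * \<bar>0\<bar>) (at 0)" by (intro tendsto_intros)
    then show "((\<lambda>h. C * \<bar>h\<bar>) \<longlongrightarrow> 0) (at 0)" by simp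
  qed
  then have "((\<lambda>h. (F (l + h) - F l) / h) \<longlongrightarrow> D) (at 0)" by (rule LIM_zero_cancel)
  then show ?thesis unfolding DERIV_def F_def D_def .
qed

section \<open>Sums of independent bounded summands\<close>

lemma (in prob_space) indep_var_integral:
  fixes g :: "_ \<Rightarrow> real"
  assumes ind: "indep_var S U R V" and g[measurable]: "g \<in> borel_measurable (S \<Otimes>\<^sub>M R)"
    and int: "integrable M (\<lambda>\<omega>. g (U \<omega>, V \<omega>))"
  shows "(\<integral>\<omega>. g (U \<omega>, V \<omega>) \<partial>M) = (\<integral>\<omega>. (\<integral>y. g (U \<omega>, y) \<partial>distr M R V) \<partial>M)"
    and "integrable M (\<lambda>\<omega>. \<integral>y. g (U \<omega>, y) \<partial>distr M R V)"
proof -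
  have [measurable]: "U \<in> measurable M S" "V \<in> measurable M R"
    and J: "distr M S U \<Otimes>\<^sub>M distr M R V = distr M (S \<Otimes>\<^sub>M R) (\<lambda>x. (U x, V x))"
    using ind unfolding indep_var_distribution_eq by auto
  interpret U: prob_space "distr M S U" by (rule prob_space_distr) simp
  interpret V: prob_space "distr M R V" by (rule prob_space_distr) simp
  interpret P: pair_prob_space "distr M S U" "distr M R V" ..
  have i: "integrable (distr M S U \<Otimes>\<^sub>M distr M R V) g"
    unfolding J using int by (subst integrable_distr_eq) auto
  have [measurable]: "(\<lambda>x. \<integral>y. g (x, y) \<partial>distr M R V) \<in> borel_measurable S"
    by (intro V.borel_measurable_lebesgue_integral) simp
  have "(\<integral>\<omega>. g (U \<omega>, V \<omega>) \<partial>M) = (\<integral>z. g z \<partial>distr M (S \<Otimes>\<^sub>M R) (\<lambda>x. (U x, V x)))"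
    by (subst integral_distr) auto
  also have "\<dots> = (\<integral>x. (\<integral>y. g (x, y) \<partial>distr M R V) \<partial>distr M S U)"
    unfolding J[symmetric] by (rule P.integral_fst'[OF i, symmetric])
  also have "\<dots> = (\<integral>\<omega>. (\<integral>y. g (U \<omega>, y) \<partial>distr M R V) \<partial>M)"
    by (subst integral_distr) auto
  finally show "(\<integral>\<omega>. g (U \<omega>, V \<omega>) \<partial>M) = (\<integral>\<omega>. (\<integral>y. g (U \<omega>, y) \<partial>distr M R V) \<partial>M)" .
  have "integrable (distr M S U) (\<lambda>x. \<integral>y. g (x, y) \<partial>distr M R V)"
    by (rule P.integrable_fst'[OF i])
  then show "integrable M (\<lambda>\<omega>. \<integral>y. g (U \<omega>, y) \<partial>distr M R V)"
    by (subst (asm) integrable_distr_eq) auto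
qed

lemma (in prob_space) indep_var_sum:
  fixes Y :: "'i \<Rightarrow> 'a \<Rightarrow> 'b::{real_normed_vector,second_countable_topology}"
  assumes I: "finite I" "i \<notin> I" and indep: "indep_vars (\<lambda>_. borel) Y (insert i I)"
  shows "indep_var borel (\<lambda>\<omega>. \<Sum>i\<in>I. Y i \<omega>) borel (Y i)"
proof -
  have "indep_var
    borel ((\<lambda>f. \<Sum>i\<in>I. f i) \<circ> (\<lambda>\<omega>. restrict (\<lambda>i. Y i \<omega>) I))
    borel ((\<lambda>f. f i) \<circ> (\<lambda>\<omega>. restrict (\<lambda>i. Y i \<omega>) {i}))"
    using I by (intro indep_var_compose[OF indep_var_restrict[OF indep]]) auto
  also have "((\<lambda>f. f i) \<circ> (\<lambda>\<omega>. restrict (\<lambda>i. Y i \<omega>) {i})) = Y i"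
    by auto
  also have "((\<lambda>f. \<Sum>i\<in>I. f i) \<circ> (\<lambda>\<omega>. restrict (\<lambda>i. Y i \<omega>) I)) = (\<lambda>\<omega>. \<Sum>i\<in>I. Y i \<omega>)"
    by (auto cong: rev_conj_cong)
  finally show ?thesis .
qed

text \<open>Submartingale property of the exponential of the norm: \<open>1 + u <= exp u\<close> at
  the scaled increment, whose mean is nonnegative.\<close>

lemma (in bdd_centered) exp_norm_le_T:
  assumes l: "l \<ge> 0"
  shows "exp (l * norm s) \<le> T (\<lambda>s. exp (l * norm s)) s"
proof -
  have id: "integrable N (\<lambda>y. norm (s + y) - norm s)" by (intro integrable_locally_bdd locally_bdd_norm_shift)
  have "(\<integral>y. exp (l * norm s) * (1 + l * (norm (s + y) - norm s)) \<partial>N) \<le> (\<integral>y. exp (l * norm (s + y)) \<partial>N)"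
  proof (rule integral_mono[OF _ integrable_shift[OF locally_bdd_exp_norm]])
    fix y
    have "exp (l * norm s) * (1 + l * (norm (s + y) - norm s)) \<le> exp (l * norm s) * exp (l * (norm (s + y) - norm s))"
      by (intro mult_left_mono exp_ge_add_one_self) auto
    then show "exp (l * norm s) * (1 + l * (norm (s + y) - norm s)) \<le> exp (l * norm (s + y))"
      unfolding exp_add[symmetric] by (simp add: algebra_simps)
  qed (use id in auto)
  moreover have "(\<integral>y. exp (l * norm s) * (1 + l * (norm (s + y) - norm s)) \<partial>N)
      = exp (l * norm s) * (1 + l * (\<integral>y. norm (s + y) - norm s \<partial>N))"
  proof -
    have "(\<integral>y. 1 + l * (norm (s + y) - norm s) \<partial>N) = 1 + (\<integral>y. l * (norm (s + y) - norm s) \<partial>N)"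
      by (subst Bochner_Integration.integral_add) (use id in \<open>auto simp: prob_space\<close>)
    then show ?thesis by (simp only: integral_mult_right_zero)
  qed
  moreover have "exp (l * norm s) * (1 + l * (\<integral>y. norm (s + y) - norm s \<partial>N)) \<ge> exp (l * norm s) * 1"
    using increment_nonneg[of s] l by (intro mult_left_mono) auto
  ultimately show ?thesis unfolding T_def by linarith
qed

locale iid_sum = prob_space M + N: bdd_centered N b v
  for M :: "'a measure" and N :: "'b::{banach,second_countable_topology} measure" and b v +
  fixes Y :: "'i \<Rightarrow> 'a \<Rightarrow> 'b" and I :: "'i set"
  assumes fin: "finite I" and indep: "indep_vars (\<lambda>_. borel) Y I"
    and law: "\<And>i. i \<in> I \<Longrightarrow> distr M borel (Y i) = N"
begin

lemma rv_Y: "i \<in> I \<Longrightarrow> Y i \<in> borel_measurable M"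
  using indep unfolding indep_vars_def by auto

lemma rv_sum: "J \<subseteq> I \<Longrightarrow> (\<lambda>\<omega>. \<Sum>i\<in>J. Y i \<omega>) \<in> borel_measurable M"
  using rv_Y by (intro borel_measurable_sum) auto

lemma AE_Y: assumes i: "i \<in> I" shows "AE \<omega> in M. norm (Y i \<omega>) \<le> b"
proof -
  have "AE y in distr M borel (Y i). norm y \<le> b" unfolding law[OF i] by (rule N.AE_bound)
  then show ?thesis using rv_Y[OF i] by (subst (asm) AE_distr_iff) auto
qed

lemma AE_sum:
  assumes J: "J \<subseteq> I" shows "AE \<omega> in M. norm (\<Sum>i\<in>J. Y i \<omega>) \<le> real (card J) * b"
proof -
  have "AE \<omega> in M. \<forall>i\<in>J. norm (Y i \<omega>) \<le> b"
    using AE_Y J by (intro AE_finite_allI finite_subset[OF J fin]) auto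
  then show ?thesis by eventually_elim (auto intro: sum_norm_le[THEN order_trans])
qed

lemma integrable_fun_sum:
  assumes J: "J \<subseteq> I" and f: "locally_bdd \<phi>"
  shows "integrable M (\<lambda>\<omega>. \<phi> (x + (\<Sum>i\<in>J. Y i \<omega>)))"
proof -
  note [measurable] = locally_bdd_measurable[OF f] rv_sum[OF J]
  obtain K where K: "K \<ge> 0" "\<And>z. norm z \<le> norm x + real (card J) * b \<Longrightarrow> \<bar>\<phi> z\<bar> \<le> K" using locally_bddE[OF f] by blast
  show ?thesis
  proof (rule integrable_const_bound[of _ K])
    show "AE \<omega> in M. norm (\<phi> (x + (\<Sum>i\<in>J. Y i \<omega>))) \<le> K"
      using AE_sum[OF J] by eventually_elim (auto intro!: K(2) order_trans[OF norm_triangle_ineq])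
  qed measurable
qed

lemma indep_sum:
  assumes "insert i J \<subseteq> I" "i \<notin> J"
  shows "indep_var borel (\<lambda>\<omega>. \<Sum>i\<in>J. Y i \<omega>) borel (Y i)"
  using assms finite_subset[OF _ fin] by (intro indep_var_sum indep_vars_subset[OF indep]) auto

text \<open>Each summand removed by independence costs one application of \<open>T\<close>. The
  entropy argument can thus be run for the operator alone, and only its final identities are
  transferred to the probability space.\<close>

lemma expectation_fun_sum:
  assumes J: "J \<subseteq> I" and f: "locally_bdd \<phi>"
  shows "(\<integral>\<omega>. \<phi> (x + (\<Sum>i\<in>J. Y i \<omega>)) \<partial>M) = (N.T ^^ card J) \<phi> x"
proof -
  have "finite J" using J fin by (rule finite_subset)
  then show ?thesis using J f
  proof (induction J arbitrary: \<phi>)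
    case empty
    then show ?case by (simp add: prob_space)
  next
    case (insert i J)
    note [measurable] = locally_bdd_measurable[OF insert.prems(2)]
    have eq: "x + (\<Sum>i\<in>insert i J. Y i \<omega>) = x + (\<Sum>i\<in>J. Y i \<omega>) + Y i \<omega>" for \<omega>
      using insert.hyps by (simp add: add_ac)
    have "(\<integral>\<omega>. (\<lambda>(s, y). \<phi> (x + s + y)) ((\<Sum>i\<in>J. Y i \<omega>), Y i \<omega>) \<partial>M)
      = (\<integral>\<omega>. (\<integral>y. (\<lambda>(s, y). \<phi> (x + s + y)) ((\<Sum>i\<in>J. Y i \<omega>), y) \<partial>distr M borel (Y i)) \<partial>M)"
    proof (rule indep_var_integral(1))
      show "indep_var borel (\<lambda>\<omega>. \<Sum>i\<in>J. Y i \<omega>) borel (Y i)"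
        using insert by (intro indep_sum) auto
      show "integrable M (\<lambda>\<omega>. (\<lambda>(s, y). \<phi> (x + s + y)) ((\<Sum>i\<in>J. Y i \<omega>), Y i \<omega>))"
        using integrable_fun_sum[OF insert.prems, of x] by (simp add: eq)
    qed measurable
    then have "(\<integral>\<omega>. \<phi> (x + (\<Sum>i\<in>insert i J. Y i \<omega>)) \<partial>M) = (\<integral>\<omega>. N.T \<phi> (x + (\<Sum>i\<in>J. Y i \<omega>)) \<partial>M)"
      using insert.prems by (simp add: eq law N.T_def)
    also have "\<dots> = (N.T ^^ card J) (N.T \<phi>) x"
      using insert.prems by (intro insert.IH N.locally_bdd_T) auto
    also have "\<dots> = (N.T ^^ card (insert i J)) \<phi> x"
      using insert.hyps by (simp add: funpow_swap1)
    finally show ?case .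
  qed
qed

text \<open>The sum without \<open>Y i\<close> is a walk of \<open>k\<close> steps independent of
  \<open>Y i\<close>, so integrating out \<open>Y i\<close> gives \<open>wincr\<close>. The right
  side does not depend on \<open>i\<close>.\<close>

lemma exchange:
  assumes i: "i \<in> I" and k: "card I = Suc k"
  shows "(\<integral>\<omega>. exp (l * norm (\<Sum>i\<in>I. Y i \<omega>)) * (norm (\<Sum>i\<in>I. Y i \<omega>) - norm ((\<Sum>i\<in>I. Y i \<omega>) - Y i \<omega>)) \<partial>M)
    = (N.T ^^ k) (N.wincr l) 0"
    and "integrable M (\<lambda>\<omega>. exp (l * norm (\<Sum>i\<in>I. Y i \<omega>)) * (norm (\<Sum>i\<in>I. Y i \<omega>) - norm ((\<Sum>i\<in>I. Y i \<omega>) - Y i \<omega>)))"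
proof -
  define J where "J = I - {i}"
  have J: "insert i J \<subseteq> I" "i \<notin> J" "insert i J = I" "card J = k" "finite J"
    using i k fin by (auto simp: J_def)
  have eq: "(\<Sum>i\<in>I. Y i \<omega>) = (\<Sum>i\<in>J. Y i \<omega>) + Y i \<omega>" for \<omega>
    using J(2,5) by (subst J(3)[symmetric]) (simp add: add_ac)
  define g where "g = (\<lambda>(s::'b, y::'b). exp (l * norm (s + y)) * (norm (s + y) - norm s))"
  have [measurable]: "g \<in> borel_measurable (borel \<Otimes>\<^sub>M borel)" unfolding g_def by measurable
  note [measurable] = rv_sum[of J] rv_Y[OF i]
  have JI: "J \<subseteq> I" using J by auto
  define C where "C = real (card J) * b + b"
  have int: "integrable M (\<lambda>\<omega>. g ((\<Sum>i\<in>J. Y i \<omega>), Y i \<omega>))"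
  proof (rule integrable_const_bound[of _ "exp (\<bar>l\<bar> * C) * b"])
    show "AE \<omega> in M. norm (g ((\<Sum>i\<in>J. Y i \<omega>), Y i \<omega>)) \<le> exp (\<bar>l\<bar> * C) * b"
      using AE_sum[OF JI] AE_Y[OF i]
    proof eventually_elim
      case (elim \<omega>)
      define s y where "s = (\<Sum>i\<in>J. Y i \<omega>)" and "y = Y i \<omega>"
      have 1: "\<bar>norm (s + y) - norm s\<bar> \<le> b"
        using elim norm_triangle_ineq[of s y] norm_triangle_ineq2[of s "-y"] by (simp add: abs_le_iff y_def)
      have "l * norm (s + y) \<le> \<bar>l\<bar> * norm (s + y)" by (intro mult_right_mono) auto
      also have "\<dots> \<le> \<bar>l\<bar> * C" using elim norm_triangle_ineq[of s y]
        by (intro mult_left_mono) (auto simp: C_def s_def y_def)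
      finally show ?case using 1 unfolding g_def s_def[symmetric] y_def[symmetric]
        by (auto simp: abs_mult intro!: mult_mono)
    qed
  qed (use JI in measurable)
  have geq: "g ((\<Sum>i\<in>J. Y i \<omega>), Y i \<omega>) = exp (l * norm (\<Sum>i\<in>I. Y i \<omega>)) * (norm (\<Sum>i\<in>I. Y i \<omega>) - norm ((\<Sum>i\<in>I. Y i \<omega>) - Y i \<omega>))" for \<omega>
    unfolding eq by (simp add: g_def)
  have "(\<integral>\<omega>. g ((\<Sum>i\<in>J. Y i \<omega>), Y i \<omega>) \<partial>M) = (\<integral>\<omega>. (\<integral>y. g ((\<Sum>i\<in>J. Y i \<omega>), y) \<partial>distr M borel (Y i)) \<partial>M)"
    by (rule indep_var_integral(1)[OF indep_sum[OF J(1,2)] _ int]) measurable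
  also have "\<dots> = (\<integral>\<omega>. N.wincr l (0 + (\<Sum>i\<in>J. Y i \<omega>)) \<partial>M)"
    using law[OF i] by (simp add: g_def N.wincr_def)
  also have "\<dots> = (N.T ^^ k) (N.wincr l) 0"
    using expectation_fun_sum[OF JI N.locally_bdd_wincr, of l 0] J by simp
  finally show "(\<integral>\<omega>. exp (l * norm (\<Sum>i\<in>I. Y i \<omega>)) * (norm (\<Sum>i\<in>I. Y i \<omega>) - norm ((\<Sum>i\<in>I. Y i \<omega>) - Y i \<omega>)) \<partial>M)
    = (N.T ^^ k) (N.wincr l) 0" by (simp add: geq)
  show "integrable M (\<lambda>\<omega>. exp (l * norm (\<Sum>i\<in>I. Y i \<omega>)) * (norm (\<Sum>i\<in>I. Y i \<omega>) - norm ((\<Sum>i\<in>I. Y i \<omega>) - Y i \<omega>)))"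
    using int by (simp add: geq)
qed

text \<open>Exchangeability reduces this to the pointwise inequality
  \<open>(\<Sum>i\<in>I. norm S - norm (S - Y i)) \<le> norm S\<close>.\<close>

lemma sum_wincr_le:
  assumes k: "card I = Suc k"
  shows "real (Suc k) * (N.T ^^ k) (N.wincr l) 0
    \<le> (\<integral>\<omega>. norm (\<Sum>i\<in>I. Y i \<omega>) * exp (l * norm (\<Sum>i\<in>I. Y i \<omega>)) \<partial>M)"
proof -
  define S where "S \<omega> = (\<Sum>i\<in>I. Y i \<omega>)" for \<omega>
  have "real (Suc k) * (N.T ^^ k) (N.wincr l) 0
     = (\<Sum>i\<in>I. (\<integral>\<omega>. exp (l * norm (S \<omega>)) * (norm (S \<omega>) - norm (S \<omega> - Y i \<omega>)) \<partial>M))"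
    unfolding S_def by (simp add: exchange(1)[OF _ k] k)
  also have "\<dots> = (\<integral>\<omega>. (\<Sum>i\<in>I. exp (l * norm (S \<omega>)) * (norm (S \<omega>) - norm (S \<omega> - Y i \<omega>))) \<partial>M)"
    unfolding S_def by (rule Bochner_Integration.integral_sum[symmetric]) (rule exchange(2)[OF _ k])
  also have "\<dots> \<le> (\<integral>\<omega>. norm (S \<omega>) * exp (l * norm (S \<omega>)) \<partial>M)"
  proof (rule integral_mono)
    show "integrable M (\<lambda>\<omega>. \<Sum>i\<in>I. exp (l * norm (S \<omega>)) * (norm (S \<omega>) - norm (S \<omega> - Y i \<omega>)))"
      unfolding S_def by (intro Bochner_Integration.integrable_sum exchange(2)[OF _ k])
    show "integrable M (\<lambda>\<omega>. norm (S \<omega>) * exp (l * norm (S \<omega>)))"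
      using integrable_fun_sum[OF subset_refl locally_bdd_mult[OF N.locally_bdd_norm N.locally_bdd_exp_norm[of l]], of 0]
      by (simp add: S_def)
    fix \<omega>
    \<comment> \<open>Each summand is missing from exactly one of the \<open>k + 1\<close> sums,
      hence the factor \<open>k\<close>; the triangle inequality then gives the pointwise
      estimate.\<close>
    have "(\<Sum>i\<in>I. S \<omega> - Y i \<omega>) = real k *\<^sub>R S \<omega>"
      unfolding sum_subtractf sum_constant_scaleR k by (simp add: S_def algebra_simps)
    then have "real k * norm (S \<omega>) = norm (\<Sum>i\<in>I. S \<omega> - Y i \<omega>)" by simp
    also have "\<dots> \<le> (\<Sum>i\<in>I. norm (S \<omega> - Y i \<omega>))" by (rule norm_sum)
    finally have "(\<Sum>i\<in>I. norm (S \<omega>) - norm (S \<omega> - Y i \<omega>)) \<le> norm (S \<omega>)"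
      by (simp add: sum_subtractf k algebra_simps)
    then have "exp (l * norm (S \<omega>)) * (\<Sum>i\<in>I. norm (S \<omega>) - norm (S \<omega> - Y i \<omega>)) \<le> exp (l * norm (S \<omega>)) * norm (S \<omega>)"
      by (intro mult_left_mono) auto
    then show "(\<Sum>i\<in>I. exp (l * norm (S \<omega>)) * (norm (S \<omega>) - norm (S \<omega> - Y i \<omega>))) \<le> norm (S \<omega>) * exp (l * norm (S \<omega>))"
      by (simp add: sum_distrib_left mult.commute)
  qed
  finally show ?thesis unfolding S_def .
qed

text \<open>Tensorization and \<open>ent_exp_norm\<close> bound the entropy of
  \<open>exp (x * Z)\<close> by multiples of \<open>F\<close> and of the summed weighted increments;
  \<open>sum_wincr_le\<close> replaces the latter by \<open>F'\<close>. This is the differential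
  inequality that \<open>herbst\<close> integrates.\<close>

lemma mgf_norm_sum:
  assumes I: "I \<noteq> {}" and l: "l > 0"
  defines "q \<equiv> exp (2 * l * b)"
  shows "ln (\<integral>\<omega>. exp (l * norm (\<Sum>i\<in>I. Y i \<omega>)) \<partial>M) * (1 - q * b * l)
    \<le> l * (\<integral>\<omega>. norm (\<Sum>i\<in>I. Y i \<omega>) \<partial>M) + q * l\<^sup>2 * (real (card I) * v) / 2"
proof -
  define Z where "Z \<omega> = norm (\<Sum>i\<in>I. Y i \<omega>)" for \<omega>
  define F where "F l = (\<integral>\<omega>. exp (l * Z \<omega>) \<partial>M)" for l
  define F' where "F' l = (\<integral>\<omega>. Z \<omega> * exp (l * Z \<omega>) \<partial>M)" for l
  obtain k where k: "card I = Suc k" using I fin by (metis card_eq_0_iff not0_implies_Suc)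
  have [measurable]: "Z \<in> borel_measurable M"
    using rv_sum[OF subset_refl] unfolding Z_def by measurable
  have D: "(F has_real_derivative F' l) (at l)" for l
    unfolding F_def F'_def
  proof (rule DERIV_mgf[of _ "real (card I) * b"])
    show "AE x in M. \<bar>Z x\<bar> \<le> real (card I) * b" using AE_sum[OF subset_refl] by (simp add: Z_def)
  qed measurable
  have FT: "F x = (N.T ^^ Suc k) (\<lambda>s. exp (x * norm s)) 0" for x
    using expectation_fun_sum[OF subset_refl N.locally_bdd_exp_norm, of x 0] k by (simp add: F_def Z_def)
  have iF: "integrable M (\<lambda>\<omega>. exp (x * Z \<omega>))" for x
    using integrable_fun_sum[OF subset_refl N.locally_bdd_exp_norm, of x 0] by (simp add: Z_def)
  have Fpos: "F x > 0" for x
  proof -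
    have "F x \<ge> (\<integral>\<omega>. exp (- (\<bar>x\<bar> * (real (card I) * b))) \<partial>M)" unfolding F_def
    proof (rule integral_mono_AE)
      show "AE \<omega> in M. exp (- (\<bar>x\<bar> * (real (card I) * b))) \<le> exp (x * Z \<omega>)"
        using AE_sum[OF subset_refl]
      proof eventually_elim
        case (elim \<omega>)
        have "- (x * Z \<omega>) \<le> \<bar>x\<bar> * Z \<omega>" unfolding mult_minus_left[symmetric] by (intro mult_right_mono) (auto simp: Z_def)
        also have "\<dots> \<le> \<bar>x\<bar> * (real (card I) * b)" using elim by (intro mult_left_mono) (auto simp: Z_def)
        finally show ?case by simp
      qed
    qed (use iF in auto)
    then have "exp (- (\<bar>x\<bar> * (real (card I) * b))) \<le> F x" by (simp add: prob_space)
    then show ?thesis by (rule less_le_trans[OF exp_gt_zero])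
  qed
  have F'T: "x * F' x = (N.T ^^ Suc k) (\<lambda>s. exp (x * norm s) * ln (exp (x * norm s))) 0" for x
    using expectation_fun_sum[OF subset_refl locally_bdd_mult[OF N.locally_bdd_exp_norm locally_bdd_cmult[OF N.locally_bdd_norm]], where x=0] k
    by (simp add: F'_def Z_def mult_ac flip: integral_mult_right_zero)
  have F'0: "F' x \<ge> 0" for x unfolding F'_def by (intro integral_nonneg_AE) (auto simp: Z_def)
  have ineq: "x * F' x - F x * ln (F x) \<le> q * x\<^sup>2 / 2 * (real (card I) * v * F x + 2 * b * F' x)"
    if x: "0 < x" "x \<le> l" for x
  proof -
    define \<phi> where "\<phi> = (\<lambda>s::'b. exp (x * norm s))"
    have f: "locally_bdd \<phi>" "\<And>s. \<phi> s \<ge> 1" using x N.locally_bdd_exp_norm by (auto simp: \<phi>_def)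
    \<comment> \<open>The factor at \<open>x\<close> is bounded by means of \<open>q\<close>, its
      value at the right end \<open>l\<close>, since \<open>herbst\<close> needs one constant on the
      whole interval.\<close>
    define K where "K = exp (2 * x * b) * x\<^sup>2 / 2"
    have K: "0 \<le> K" "K \<le> q * x\<^sup>2 / 2" using x N.b_nonneg
      by (auto simp: K_def q_def intro!: divide_right_mono mult_right_mono)
    have "x * F' x - F x * ln (F x) \<le> real (Suc k) * (N.T ^^ k) (N.ent \<phi>) 0"
      using N.entropy_tensorization[OF f, of k 0] unfolding F'T FT \<phi>_def .
    also have "\<dots> \<le> real (Suc k) * (N.T ^^ k) (\<lambda>s. (K * v) * N.T \<phi> s - (- (2 * K * b)) * N.wincr x s) 0"
    proof (intro mult_left_mono N.Tn_mono N.locally_bdd_ent f locally_bdd_diff locally_bdd_cmult N.locally_bdd_T N.locally_bdd_wincr)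
      fix s show "N.ent \<phi> s \<le> (K * v) * N.T \<phi> s - (- (2 * K * b)) * N.wincr x s"
        using N.ent_exp_norm[of x s] x by (simp add: \<phi>_def K_def algebra_simps)
    qed auto
    also have "\<dots> = real (Suc k) * (K * v * (N.T ^^ k) (N.T \<phi>) 0 + 2 * K * b * (N.T ^^ k) (N.wincr x) 0)"
      unfolding N.Tn_diff[OF locally_bdd_cmult[OF N.locally_bdd_T[OF f(1)]] locally_bdd_cmult[OF N.locally_bdd_wincr]] N.Tn_cmult
      by simp
    also have "(N.T ^^ k) (N.T \<phi>) 0 = F x" by (simp add: FT \<phi>_def funpow_swap1)
    also have "real (Suc k) * (K * v * F x + 2 * K * b * (N.T ^^ k) (N.wincr x) 0)
      = K * (real (card I) * v * F x + 2 * b * (real (Suc k) * (N.T ^^ k) (N.wincr x) 0))"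
      by (simp add: k algebra_simps)
    also have "\<dots> \<le> K * (real (card I) * v * F x + 2 * b * F' x)"
      using sum_wincr_le[OF k, of x] K N.b_nonneg
      by (intro mult_left_mono add_left_mono) (auto simp: F'_def Z_def)
    also have "\<dots> \<le> q * x\<^sup>2 / 2 * (real (card I) * v * F x + 2 * b * F' x)"
      using Fpos[of x] F'0[of x] N.b_nonneg N.v_nonneg
      by (intro mult_right_mono K add_nonneg_nonneg mult_nonneg_nonneg) auto
    finally show ?thesis .
  qed
  have "ln (F l) * (1 - q * b * l) \<le> l * F' 0 + q * l\<^sup>2 * (real (card I) * v) / 2"
    by (rule herbst[OF D _ Fpos l ineq]) (simp_all add: F_def prob_space)
  then show ?thesis by (simp add: F_def F'_def Z_def)
qed

end

section \<open>The maximal inequality and the tail bound for the norm\<close>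

locale iid_seq = iid_sum M N b v Y "{1..n}"
  for M :: "'a measure" and N :: "'b::{banach,second_countable_topology} measure" and b v
    and Y :: "nat \<Rightarrow> 'a \<Rightarrow> 'b" and n :: nat
begin

text \<open>The event \<open>U\<close> depends on the first \<open>k\<close> summands only; given
  these, one further step raises the mean of the exponential by
  \<open>exp_norm_le_T\<close>.\<close>

lemma doob_step:
  fixes x :: real
  assumes k: "k < n" and l: "l \<ge> 0"
  defines "S \<equiv> \<lambda>j \<omega>. \<Sum>i\<in>{1..j}. Y i \<omega>"
  defines "U \<equiv> {\<omega>\<in>space M. \<exists>j\<le>k. x \<le> norm (S j \<omega>)}"
  shows "(\<integral>\<omega>. exp (l * norm (S k \<omega>)) * indicator U \<omega> \<partial>M) \<le> (\<integral>\<omega>. exp (l * norm (S (Suc k) \<omega>)) * indicator U \<omega> \<partial>M)"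
proof -
  \<comment> \<open>The whole vector of the first \<open>k\<close> summands is kept, since
    \<open>U\<close> involves all earlier partial sums and not just \<open>S k\<close>.\<close>
  define R where "R \<omega> = (\<lambda>i\<in>{1..k}. Y i \<omega>)" for \<omega>
  define A where "A u = (\<exists>j\<in>{..k}. x \<le> norm (\<Sum>i\<in>{1..j}. u i))" for u :: "nat \<Rightarrow> 'b"
  define V where "V \<omega> = (\<lambda>i\<in>{Suc k}. Y i \<omega>)" for \<omega>
  define g where "g = (\<lambda>(u, w). exp (l * norm ((\<Sum>i\<in>{1..k}. u i) + w (Suc k) :: 'b)) * (if A u then 1 else 0))"
  have ind: "indep_var (PiM {1..k} (\<lambda>_. borel)) R (PiM {Suc k} (\<lambda>_. borel)) V"
    unfolding R_def V_def using k by (intro indep_var_restrict[OF indep]) auto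
  have Rs: "(\<Sum>i\<in>{1..j}. R \<omega> i) = S j \<omega>" if "j \<le> k" for j \<omega>
    using that by (auto simp: R_def S_def intro!: sum.cong)
  have RA: "A (R \<omega>) \<longleftrightarrow> \<omega> \<in> U" if "\<omega> \<in> space M" for \<omega>
    using that Rs by (auto simp: A_def U_def)
  have [measurable]: "(\<lambda>u. \<Sum>i\<in>{1..j}. u i) \<in> borel_measurable (PiM {1..k} (\<lambda>_. borel :: 'b measure))" if "j \<le> k" for j
    using that by (intro borel_measurable_sum) auto
  have [measurable]: "Measurable.pred (PiM {1..k} (\<lambda>_. borel :: 'b measure)) A"
    unfolding A_def by (intro pred_intros_finite) (auto intro!: borel_measurable_le borel_measurable_norm)
  have gm: "g \<in> borel_measurable (PiM {1..k} (\<lambda>_. borel) \<Otimes>\<^sub>M PiM {Suc k} (\<lambda>_. borel))"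
    unfolding g_def by measurable
  have Sm: "S j \<in> borel_measurable M" if "j \<le> n" for j unfolding S_def using that by (intro rv_sum) auto
  have Um: "U \<in> sets M" unfolding U_def
  proof -
    have "{\<omega>\<in>space M. \<exists>j\<in>{..k}. x \<le> norm (S j \<omega>)} \<in> sets M"
    proof (rule sets.sets_Collect_finite_Ex)
      fix j assume "j \<in> {..k}"
      then have [measurable]: "S j \<in> borel_measurable M" using k by (intro Sm) auto
      show "{\<omega> \<in> space M. x \<le> norm (S j \<omega>)} \<in> sets M" by measurable
    qed auto
    then show "{\<omega>\<in>space M. \<exists>j\<le>k. x \<le> norm (S j \<omega>)} \<in> sets M" by (simp only: Bex_def atMost_iff)
  qed
  have iS: "integrable M (\<lambda>\<omega>. exp (l * norm (S j \<omega>)))" if "j \<le> n" for j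
    using integrable_fun_sum[OF _ N.locally_bdd_exp_norm, of "{1..j}" l 0] that by (simp add: S_def)
  have iI: "integrable M (\<lambda>\<omega>. exp (l * norm (S j \<omega>)) * indicator U \<omega>)" if "j \<le> n" for j
    by (intro integrable_real_mult_indicator Um iS that)
  have geq: "g (R \<omega>, V \<omega>) = exp (l * norm (S (Suc k) \<omega>)) * indicator U \<omega>" if "\<omega> \<in> space M" for \<omega>
    using RA[OF that] Rs[of k \<omega>] by (auto simp: g_def S_def V_def)
  have ig: "integrable M (\<lambda>\<omega>. g (R \<omega>, V \<omega>))"
  proof (rule Bochner_Integration.integrable_cong[THEN iffD2, OF refl])
    show "integrable M (\<lambda>\<omega>. exp (l * norm (S (Suc k) \<omega>)) * indicator U \<omega>)" by (rule iI) (use k in simp)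
  qed (rule geq)
  have Vm: "V \<in> measurable M (PiM {Suc k} (\<lambda>_. borel))"
    unfolding V_def using k rv_Y by (intro measurable_restrict) auto
  have Ym: "Y (Suc k) \<in> borel_measurable M" using k by (intro rv_Y) auto
  have inner: "(\<integral>w. g (R \<omega>, w) \<partial>distr M (PiM {Suc k} (\<lambda>_. borel)) V) = N.T (\<lambda>s. exp (l * norm s)) (S k \<omega>) * indicator U \<omega>"
    if w: "\<omega> \<in> space M" for \<omega>
  proof -
    have "(\<lambda>w. g (R \<omega>, w)) = (\<lambda>w. exp (l * norm (S k \<omega> + w (Suc k))) * indicator U \<omega>)"
      using RA[OF w] Rs[of k \<omega>] by (auto simp: g_def)
    then have "(\<integral>w. g (R \<omega>, w) \<partial>distr M (PiM {Suc k} (\<lambda>_. borel)) V)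
        = (\<integral>w. exp (l * norm (S k \<omega> + w (Suc k))) * indicator U \<omega> \<partial>distr M (PiM {Suc k} (\<lambda>_. borel)) V)" by simp
    also have "\<dots> = (\<integral>x. exp (l * norm (S k \<omega> + Y (Suc k) x)) * indicator U \<omega> \<partial>M)"
      by (subst integral_distr[OF Vm]) (auto simp: V_def)
    also have "\<dots> = (\<integral>y. exp (l * norm (S k \<omega> + y)) * indicator U \<omega> \<partial>distr M borel (Y (Suc k)))"
      by (subst integral_distr[OF Ym]) auto
    finally show ?thesis using k law[of "Suc k"] by (simp add: N.T_def)
  qed
  have "(\<integral>\<omega>. exp (l * norm (S k \<omega>)) * indicator U \<omega> \<partial>M)
      \<le> (\<integral>\<omega>. (\<integral>y. g (R \<omega>, y) \<partial>distr M (PiM {Suc k} (\<lambda>_. borel)) V) \<partial>M)"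
  proof (rule integral_mono[OF iI indep_var_integral(2)[OF ind gm ig]])
    fix \<omega> assume w: "\<omega> \<in> space M"
    show "exp (l * norm (S k \<omega>)) * indicator U \<omega> \<le> (\<integral>y. g (R \<omega>, y) \<partial>distr M (PiM {Suc k} (\<lambda>_. borel)) V)"
      unfolding inner[OF w] by (intro mult_right_mono N.exp_norm_le_T l) auto
  qed (use k in simp)
  also have "\<dots> = (\<integral>\<omega>. g (R \<omega>, V \<omega>) \<partial>M)"
    by (rule indep_var_integral(1)[OF ind gm ig, symmetric])
  also have "\<dots> = (\<integral>\<omega>. exp (l * norm (S (Suc k) \<omega>)) * indicator U \<omega> \<partial>M)"
    by (rule Bochner_Integration.integral_cong[OF refl]) (rule geq)
  finally show ?thesis .
qed

text \<open>Induction on time: paths that have already reached \<open>x\<close> are handled by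
  \<open>doob_step\<close>; on those that reach it for the first time the exponential is at least
  \<open>exp (l * x)\<close>.\<close>

lemma doob:
  assumes l: "l \<ge> 0"
  shows "exp (l * x) * prob {\<omega>\<in>space M. \<exists>j\<le>n. x \<le> norm (\<Sum>i\<in>{1..j}. Y i \<omega>)}
    \<le> (\<integral>\<omega>. exp (l * norm (\<Sum>i\<in>{1..n}. Y i \<omega>)) \<partial>M)"
proof -
  define S where "S j \<omega> = (\<Sum>i\<in>{1..j}. Y i \<omega>)" for j \<omega>
  define U where "U k = {\<omega>\<in>space M. \<exists>j\<le>k. x \<le> norm (S j \<omega>)}" for k
  have Sm: "S j \<in> borel_measurable M" if "j \<le> n" for j unfolding S_def using that by (intro rv_sum) auto
  have Um: "U k \<in> sets M" if "k \<le> n" for k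
  proof -
    have "{\<omega>\<in>space M. \<exists>j\<in>{..k}. x \<le> norm (S j \<omega>)} \<in> sets M"
    proof (rule sets.sets_Collect_finite_Ex)
      fix j assume "j \<in> {..k}"
      then have [measurable]: "S j \<in> borel_measurable M" using that by (intro Sm) auto
      show "{\<omega> \<in> space M. x \<le> norm (S j \<omega>)} \<in> sets M" by measurable
    qed auto
    then show "U k \<in> sets M" by (simp only: Bex_def atMost_iff U_def)
  qed
  have iS: "integrable M (\<lambda>\<omega>. exp (l * norm (S j \<omega>)))" if "j \<le> n" for j
    using integrable_fun_sum[OF _ N.locally_bdd_exp_norm, of "{1..j}" l 0] that by (simp add: S_def)
  have iI: "integrable M (\<lambda>\<omega>. exp (l * norm (S j \<omega>)) * indicator A \<omega>)" if "j \<le> n" "A \<in> sets M" for j A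
    by (intro integrable_real_mult_indicator iS that)
  have "exp (l * x) * prob (U k) \<le> (\<integral>\<omega>. exp (l * norm (S k \<omega>)) * indicator (U k) \<omega> \<partial>M)" if "k \<le> n" for k
    using that
  proof (induction k)
    case 0
    show ?case
    \<comment> \<open>The index \<open>j\<close> starts at \<open>0\<close>: the empty sum makes the
      event certain for \<open>x <= 0\<close> and impossible otherwise.\<close>
    proof (cases "x \<le> 0")
      case True
      then have "U 0 = space M" by (auto simp: U_def S_def)
      then show ?thesis using l True by (simp add: S_def prob_space mult_nonneg_nonpos)
    next
      case False
      then have "U 0 = {}" by (auto simp: U_def S_def)
      then show ?thesis by simp
    qed
  next
    case (Suc k)
    define V where "V = U (Suc k) - U k"
    have sub: "U k \<subseteq> U (Suc k)" by (auto simp: U_def intro: le_SucI)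
    have Vm: "V \<in> sets M" unfolding V_def using Suc.prems by (intro sets.Diff Um) auto
    have ind: "indicator (U (Suc k)) \<omega> = (indicator (U k) \<omega> + indicator V \<omega> :: real)" for \<omega>
      using sub by (auto simp: V_def indicator_def)
    have pr: "prob (U (Suc k)) = prob (U k) + prob V"
      unfolding V_def using sub Suc.prems by (subst finite_measure_Diff) (auto intro!: Um)
    have "exp (l * x) * prob V = (\<integral>\<omega>. exp (l * x) * indicator V \<omega> \<partial>M)" using Vm by simp
    also have "\<dots> \<le> (\<integral>\<omega>. exp (l * norm (S (Suc k) \<omega>)) * indicator V \<omega> \<partial>M)"
    proof (intro integral_mono iI Suc.prems Vm)
      show "integrable M (\<lambda>\<omega>. exp (l * x) * indicator V \<omega>)"
        using integrable_real_mult_indicator[OF Vm integrable_const[of "exp (l * x)"]] by simp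
      fix \<omega>
      have "x \<le> norm (S (Suc k) \<omega>)" if "\<omega> \<in> V" using that by (auto simp: V_def U_def le_Suc_eq)
      then show "exp (l * x) * indicator V \<omega> \<le> exp (l * norm (S (Suc k) \<omega>)) * indicator V \<omega>"
        using l by (auto simp: indicator_def intro!: mult_left_mono)
    qed
    finally have 1: "exp (l * x) * prob V \<le> (\<integral>\<omega>. exp (l * norm (S (Suc k) \<omega>)) * indicator V \<omega> \<partial>M)" .
    have "exp (l * x) * prob (U k) \<le> (\<integral>\<omega>. exp (l * norm (S k \<omega>)) * indicator (U k) \<omega> \<partial>M)"
      by (rule Suc.IH) (use Suc.prems in simp)
    also have "\<dots> \<le> (\<integral>\<omega>. exp (l * norm (S (Suc k) \<omega>)) * indicator (U k) \<omega> \<partial>M)"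
      unfolding U_def S_def using Suc.prems by (intro doob_step l) auto
    finally have 2: "exp (l * x) * prob (U k) \<le> (\<integral>\<omega>. exp (l * norm (S (Suc k) \<omega>)) * indicator (U k) \<omega> \<partial>M)" .
    have "(\<integral>\<omega>. exp (l * norm (S (Suc k) \<omega>)) * indicator (U (Suc k)) \<omega> \<partial>M)
      = (\<integral>\<omega>. exp (l * norm (S (Suc k) \<omega>)) * indicator (U k) \<omega> \<partial>M) + (\<integral>\<omega>. exp (l * norm (S (Suc k) \<omega>)) * indicator V \<omega> \<partial>M)"
      unfolding ind distrib_left using Suc.prems by (intro Bochner_Integration.integral_add iI Um Vm) auto
    with 1 2 show ?case by (simp add: pr distrib_left)
  qed
  from this[of n] have "exp (l * x) * prob (U n) \<le> (\<integral>\<omega>. exp (l * norm (S n \<omega>)) * indicator (U n) \<omega> \<partial>M)" by simp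
  also have "\<dots> \<le> (\<integral>\<omega>. exp (l * norm (S n \<omega>)) \<partial>M)"
  proof (rule integral_mono[OF iI iS])
    show "exp (l * norm (S n \<omega>)) * indicator (U n) \<omega> \<le> exp (l * norm (S n \<omega>))" for \<omega>
      by (auto simp: indicator_def)
  qed (auto intro: Um)
  finally show ?thesis unfolding U_def S_def .
qed

end

text \<open>Both \<open>exp (2 * \<eta>)\<close> and \<open>1 - exp (2 * \<eta>) * \<eta>\<close>
  tend to \<open>1\<close> with \<open>\<eta>\<close>. In the tail bound \<open>\<eta>\<close> caps
  \<open>l * b\<close>, so that \<open>\<epsilon>\<close> absorbs the loss in
  \<open>mgf_norm_sum\<close>.\<close>

lemma small_exp_bound:
  fixes \<epsilon> :: real assumes "\<epsilon> > 0"
  obtains \<eta> where "\<eta> > 0" "exp (2 * \<eta>) * \<eta> < 1" "exp (2 * \<eta>) \<le> (1 + \<epsilon>) * (1 - exp (2 * \<eta>) * \<eta>)"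
proof -
  have "((\<lambda>x. exp (2 * x) - (1 + \<epsilon>) * (1 - exp (2 * x) * x)) \<longlongrightarrow> exp (2 * 0) - (1 + \<epsilon>) * (1 - exp (2 * 0) * 0)) (at_right (0::real))"
    by (intro tendsto_intros)
  then have "\<forall>\<^sub>F x in at_right (0::real). exp (2 * x) - (1 + \<epsilon>) * (1 - exp (2 * x) * x) < 0"
    by (rule order_tendstoD) (use assms in simp)
  moreover have "\<forall>\<^sub>F x in at_right (0::real). x > 0" by (rule eventually_at_right_less)
  ultimately have "\<forall>\<^sub>F x in at_right (0::real). exp (2 * x) - (1 + \<epsilon>) * (1 - exp (2 * x) * x) < 0 \<and> x > 0"
    by eventually_elim simp
  then obtain x :: real where x: "exp (2 * x) - (1 + \<epsilon>) * (1 - exp (2 * x) * x) < 0" "x > 0"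
    using eventually_happens trivial_limit_at_right_real by blast
  show thesis
  proof
    show "0 < x" by fact
    show "exp (2 * x) \<le> (1 + \<epsilon>) * (1 - exp (2 * x) * x)" using x by simp
    then have "0 < (1 + \<epsilon>) * (1 - exp (2 * x) * x)" using exp_gt_zero[of "2 * x"] by linarith
    then show "exp (2 * x) * x < 1" using assms by (simp add: zero_less_mult_iff)
  qed
qed

text \<open>Markov's inequality at the Gaussian optimum
  \<open>l = t / ((1 + \<epsilon>) * n * v)\<close> if this is at most \<open>\<eta> / b\<close>,
  and at \<open>l = \<eta> / b\<close> otherwise. \<open>\<eta>\<close> depends on
  \<open>\<epsilon>\<close> alone, as law, bound and length change from block to block. The case
  \<open>v = 0\<close> is separate because division by zero would turn the Gaussian term into
  \<open>1\<close>.\<close>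

lemma norm_sum_tail:
  fixes \<epsilon> :: real
  assumes e: "\<epsilon> > 0"
  obtains \<eta> where "\<eta> > 0"
    "\<And>(M :: 'a measure) (N :: 'b::{banach,second_countable_topology} measure) b v Y n t.
      iid_seq M N b v Y n \<Longrightarrow> n \<ge> 1 \<Longrightarrow> b > 0 \<Longrightarrow> t > 0 \<Longrightarrow>
      measure M {\<omega>\<in>space M. \<exists>j\<le>n. (1 + \<epsilon>) * (\<integral>\<omega>. norm (\<Sum>i\<in>{1..n}. Y i \<omega>) \<partial>M) + t \<le> norm (\<Sum>i\<in>{1..j}. Y i \<omega>)}
      \<le> (if v = 0 then 0 else exp (- (t\<^sup>2 / (2 * (1 + \<epsilon>) * (real n * v))))) + exp (- (\<eta> * t / b))"
proof -
  obtain \<eta> where h: "\<eta> > 0" "exp (2 * \<eta>) * \<eta> < 1" "exp (2 * \<eta>) \<le> (1 + \<epsilon>) * (1 - exp (2 * \<eta>) * \<eta>)"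
    using small_exp_bound[OF e] by blast
  show thesis
  proof (rule that[of "\<eta> / 2"])
    show "\<eta> / 2 > 0" using h by simp
    fix M :: "'a measure" and N :: "'b measure" and b v t :: real and Y n
    assume "iid_seq M N b v Y n" and n: "n \<ge> 1" and b: "b > 0" and t: "t > 0"
    then interpret iid_seq M N b v Y n by simp
    define E where "E = (\<integral>\<omega>. norm (\<Sum>i\<in>{1..n}. Y i \<omega>) \<partial>M)"
    define A where "A = {\<omega>\<in>space M. \<exists>j\<le>n. (1 + \<epsilon>) * E + t \<le> norm (\<Sum>i\<in>{1..j}. Y i \<omega>)}"
    define L where "L = real n * v"
    have E0: "E \<ge> 0" and L0: "L \<ge> 0" using N.v_nonneg by (auto simp: E_def L_def)
    have key: "prob A \<le> exp ((1 + \<epsilon>) * l\<^sup>2 * L / 2 - l * t)" if l: "0 < l" "l \<le> \<eta> / b" for l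
    proof -
      define F where "F = (\<integral>\<omega>. exp (l * norm (\<Sum>i\<in>{1..n}. Y i \<omega>)) \<partial>M)"
      define q where "q = exp (2 * l * b)"
      have lb: "l * b \<le> \<eta>" using l b by (simp add: field_simps)
      have qe: "q \<le> exp (2 * \<eta>)" using lb by (simp add: q_def)
      have qb: "q * b * l \<le> exp (2 * \<eta>) * \<eta>"
        using mult_mono[OF qe lb] l b by (simp add: mult_ac)
      have q1: "q \<le> (1 + \<epsilon>) * (1 - q * b * l)"
        using qe h(3) qb e by (smt (verit, best) mult_left_mono)
      have pos: "1 - q * b * l > 0" using qb h by simp
      have "q \<ge> 1" using l b by (simp add: q_def)
      have "ln F * (1 - q * b * l) \<le> l * E + q * l\<^sup>2 * L / 2"
        using mgf_norm_sum[of l] n l by (simp add: F_def q_def E_def L_def)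
      also have "\<dots> \<le> q * (l * E) + q * (l\<^sup>2 * L / 2)"

      proof -
        have "1 * (l * E) \<le> q * (l * E)" by (rule mult_right_mono) (use \<open>q \<ge> 1\<close> l E0 in auto)
        moreover have "q * l\<^sup>2 * L / 2 = q * (l\<^sup>2 * L / 2)" by simp
        ultimately show ?thesis by linarith
      qed
      also have "\<dots> = q * (l * E + l\<^sup>2 * L / 2)" by (simp add: algebra_simps)
      also have "\<dots> \<le> ((1 + \<epsilon>) * (1 - q * b * l)) * (l * E + l\<^sup>2 * L / 2)"
        using q1 l E0 L0 by (intro mult_right_mono) auto
      also have "\<dots> = ((1 + \<epsilon>) * (l * E + l\<^sup>2 * L / 2)) * (1 - q * b * l)" by (simp only: mult_ac)
      finally have lnF: "ln F \<le> (1 + \<epsilon>) * (l * E + l\<^sup>2 * L / 2)" using pos by (simp only: mult_le_cancel_right_pos)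
      \<comment> \<open>\<open>doob\<close> at level \<open>0\<close>, where the event is certain,
        gives \<open>F >= 1\<close>; so \<open>F\<close> is positive and equals
        \<open>exp (ln F)\<close>.\<close>
      have "exp (l * 0) * prob {\<omega>\<in>space M. \<exists>j\<le>n. 0 \<le> norm (\<Sum>i\<in>{1..j}. Y i \<omega>)} \<le> F"
        unfolding F_def by (rule doob) (use l in simp)
      moreover have "{\<omega>\<in>space M. \<exists>j\<le>n. 0 \<le> norm (\<Sum>i\<in>{1..j}. Y i \<omega>)} = space M" by auto
      ultimately have F1: "F \<ge> 1" by (simp add: prob_space)
      then have F: "F = exp (ln F)" by simp
      have "exp (l * ((1 + \<epsilon>) * E + t)) * prob A \<le> F"
        unfolding F_def A_def by (rule doob) (use l in simp)
      also have "F \<le> exp ((1 + \<epsilon>) * (l * E + l\<^sup>2 * L / 2))" by (subst F) (use lnF in simp)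
      finally have "prob A \<le> exp ((1 + \<epsilon>) * (l * E + l\<^sup>2 * L / 2)) / exp (l * ((1 + \<epsilon>) * E + t))"
        by (simp add: field_simps)
      also have "\<dots> = exp ((1 + \<epsilon>) * l\<^sup>2 * L / 2 - l * t)"
        unfolding exp_diff[symmetric] by (simp add: algebra_simps)
      finally show ?thesis .
    qed
    have "prob A \<le> (if v = 0 then 0 else exp (- (t\<^sup>2 / (2 * (1 + \<epsilon>) * L)))) + exp (- (\<eta> / 2 * t / b))"
    proof (cases "v \<noteq> 0 \<and> t / ((1 + \<epsilon>) * L) \<le> \<eta> / b")
      case True
      then have L: "L > 0" using n N.v_nonneg by (simp add: L_def less_le)
      define l where "l = t / ((1 + \<epsilon>) * L)"
      have l: "0 < l" "l \<le> \<eta> / b" using True t L e by (auto simp: l_def)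
      define D where "D = (1 + \<epsilon>) * L"
      have D: "D > 0" "t = l * D" using L e by (auto simp: D_def l_def)
      have "(1 + \<epsilon>) * l\<^sup>2 * L / 2 - l * t = l\<^sup>2 * D / 2 - l * t" by (simp add: D_def)
      also have "\<dots> = - (t\<^sup>2 / (2 * D))" using D(1) by (simp add: D(2) power2_eq_square)
      also have "2 * D = 2 * (1 + \<epsilon>) * L" by (simp add: D_def)
      finally have "(1 + \<epsilon>) * l\<^sup>2 * L / 2 - l * t = - (t\<^sup>2 / (2 * (1 + \<epsilon>) * L))" .
      then have "prob A \<le> exp (- (t\<^sup>2 / (2 * (1 + \<epsilon>) * L)))" using key[OF l] by simp
      then show ?thesis using True exp_gt_zero[of "- (\<eta> / 2 * t / b)"] by (simp add: add_increasing2)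
    next
      case False
      define l where "l = \<eta> / b"
      have l: "0 < l" "l \<le> \<eta> / b" using h b by (auto simp: l_def)
      \<comment> \<open>If \<open>v\<close> is nonzero, the unconstrained optimum lies beyond
        \<open>\<eta> / b\<close>. The quadratic term therefore uses at most half of
        \<open>l * t\<close>, hence the witness \<open>\<eta> / 2\<close>.\<close>
      have "(1 + \<epsilon>) * l * L \<le> t"
      proof (cases "L = 0")
        case True then show ?thesis using t by simp
      next
        case F: False
        then have "v \<noteq> 0" by (auto simp: L_def)
        with False have "l < t / ((1 + \<epsilon>) * L)" by (simp add: l_def)
        moreover have "(1 + \<epsilon>) * L > 0" using F L0 e by (intro mult_pos_pos) auto
        ultimately have "l * ((1 + \<epsilon>) * L) < t" by (simp add: pos_less_divide_eq)
        then show ?thesis by (simp add: mult_ac)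
      qed
      then have "((1 + \<epsilon>) * l * L) * (l / 2) \<le> t * (l / 2)" using l by (intro mult_right_mono) auto
      then have "(1 + \<epsilon>) * l\<^sup>2 * L / 2 - l * t \<le> - (l / 2 * t)"
        by (simp add: power2_eq_square algebra_simps)
      moreover have "l / 2 * t = \<eta> / 2 * t / b" by (simp add: l_def)
      ultimately have "(1 + \<epsilon>) * l\<^sup>2 * L / 2 - l * t \<le> - (\<eta> / 2 * t / b)" by simp
      then have "prob A \<le> exp (- (\<eta> / 2 * t / b))" using key[OF l] by (meson exp_le_cancel_iff order_trans)
      then show ?thesis by (simp add: add_increasing)
    qed
    then show "prob {\<omega>\<in>space M. \<exists>j\<le>n. (1 + \<epsilon>) * (\<integral>\<omega>. norm (\<Sum>i\<in>{1..n}. Y i \<omega>) \<partial>M) + t \<le> norm (\<Sum>i\<in>{1..j}. Y i \<omega>)}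
      \<le> (if v = 0 then 0 else exp (- (t\<^sup>2 / (2 * (1 + \<epsilon>) * (real n * v))))) + exp (- (\<eta> / 2 * t / b))"
      unfolding A_def E_def L_def .
  qed
qed

subsection \<open>Truncation and tail sums\<close>

text \<open>The function \<open>x / (1 + x)\<close> serves as a bounded potential along a geometric sequence.\<close>

lemma telescope_bound:
  fixes x y r :: real
  assumes r: "r > 1" and x: "x > 0" and y: "y \<ge> r * x"
  shows "x * (min 1 (1 / x))\<^sup>2 \<le> 2 * (1 + r) / (r - 1) * (y / (1 + y) - x / (1 + x))"
proof -
  have y0: "y > 0" using mult_pos_pos[of r x] r x y by linarith
  have "r * x / (1 + r * x) \<le> y / (1 + y)"
    using y y0 r x by (simp add: divide_simps add_pos_pos) (simp add: algebra_simps)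
  moreover have "r * x / (1 + r * x) - x / (1 + x) = (r - 1) * x / ((1 + x) * (1 + r * x))"
  proof -
    have "1 + r * x \<noteq> 0" "1 + x \<noteq> 0" using r x by (auto simp: add_pos_pos intro!: less_imp_neq[symmetric])
    then show ?thesis by (simp add: divide_simps) (simp add: algebra_simps)
  qed
  ultimately have d: "y / (1 + y) - x / (1 + x) \<ge> (r - 1) * x / ((1 + x) * (1 + r * x))" by linarith
  have pos: "(1 + x) * (1 + r * x) > 0" using r x by (intro mult_pos_pos add_pos_pos) auto
  have "x * (min 1 (1 / x))\<^sup>2 \<le> 2 * (1 + r) / (r - 1) * ((r - 1) * x / ((1 + x) * (1 + r * x)))"
  proof (cases "x \<le> 1")
    case True
    have "(1 + x) * (1 + r * x) \<le> 2 * (1 + r)" using True r x by (intro mult_mono) auto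
    then have "x * ((1 + x) * (1 + r * x)) \<le> x * (2 * (1 + r))" using x by (intro mult_left_mono) auto
    then have "x \<le> 2 * (1 + r) * x / ((1 + x) * (1 + r * x))" using pos by (simp add: pos_le_divide_eq mult_ac)
    moreover have "min 1 (1 / x) = 1" using True x by simp
    ultimately show ?thesis using r by simp
  next
    case False
    have "(1 + x) * (1 + r * x) \<le> (2 * x) * ((1 + r) * x)" using False r x by (intro mult_mono) (auto simp: algebra_simps)
    then have "(1 / x) * ((1 + x) * (1 + r * x)) \<le> (1 / x) * ((2 * x) * ((1 + r) * x))" using x by (intro mult_left_mono) auto
    also have "\<dots> = 2 * (1 + r) * x" using x by simp
    finally have "1 / x \<le> 2 * (1 + r) * x / ((1 + x) * (1 + r * x))" using pos by (simp add: pos_le_divide_eq)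
    moreover have "x * (min 1 (1 / x))\<^sup>2 = 1 / x" using False x by (simp add: power2_eq_square)
    ultimately show ?thesis using r by simp
  qed
  also have "\<dots> \<le> 2 * (1 + r) / (r - 1) * (y / (1 + y) - x / (1 + x))"
    using d r by (intro mult_left_mono) auto
  finally show ?thesis .
qed

text \<open>With \<open>x = m k / W\<close> the summand is \<open>W\<close> times the left side of
  \<open>telescope_bound\<close>, and the potential grows by at most \<open>1\<close> in total. The
  bound is uniform in \<open>K\<close>; later \<open>W\<close> is the random \<open>J\<close>, which
  can then be integrated.\<close>

lemma geometric_sum_bound:
  fixes m :: "nat \<Rightarrow> nat" and r W :: real
  assumes r: "r > 1" and m0: "m 0 \<ge> 1" and m: "\<And>k. r * m k \<le> m (Suc k)" and W: "W > 0"
  shows "(\<Sum>k<K. real (m k) * (min 1 (W / m k))\<^sup>2) \<le> 2 * (1 + r) / (r - 1) * W"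
proof -
  define C where "C = 2 * (1 + r) / (r - 1)"
  have C: "C > 0" using r by (simp add: C_def)
  have mpos: "real (m k) > 0" for k
  proof (induction k)
    case (Suc k)
    then have "0 < r * m k" using r by simp
    then show ?case using m[of k] by linarith
  qed (use m0 in simp)
  define \<psi> where "\<psi> k = (m k / W) / (1 + m k / W)" for k
  have "(\<Sum>k<K. real (m k) * (min 1 (W / m k))\<^sup>2) \<le> (\<Sum>k<K. C * W * (\<psi> (Suc k) - \<psi> k))"
  proof (rule sum_mono)
    fix k
    have "(m k / W) * (min 1 (1 / (m k / W)))\<^sup>2 \<le> C * (\<psi> (Suc k) - \<psi> k)"
      unfolding C_def \<psi>_def
      by (rule telescope_bound[OF r]) (use mpos[of k] W m[of k] in \<open>auto simp: divide_right_mono\<close>)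
    then have "W * ((m k / W) * (min 1 (1 / (m k / W)))\<^sup>2) \<le> W * (C * (\<psi> (Suc k) - \<psi> k))"
      using W by (intro mult_left_mono) auto
    then show "real (m k) * (min 1 (W / m k))\<^sup>2 \<le> C * W * (\<psi> (Suc k) - \<psi> k)"
      using W by (simp add: mult_ac)
  qed
  also have "\<dots> = C * W * (\<psi> K - \<psi> 0)"
    unfolding sum_distrib_left[symmetric] by (simp add: sum_lessThan_telescope)
  also have "\<dots> \<le> C * W * 1"
  proof (intro mult_left_mono)
    have q: "x / (1 + x) \<le> 1 \<and> x / (1 + x) \<ge> 0" if "x \<ge> 0" for x :: real using that by auto
    have nn: "real (m k) / W \<ge> 0" for k using W by simp
    have "\<psi> K \<le> 1 \<and> \<psi> 0 \<ge> 0" using q[OF nn[of K]] q[OF nn[of 0]] unfolding \<psi>_def by blast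
    then show "\<psi> K - \<psi> 0 \<le> 1" by linarith
  qed (use C W in auto)
  finally show ?thesis by (simp add: C_def)
qed

section \<open>Variance of Lipschitz functions of a bounded sum\<close>

context bdd_law
begin

lemma locally_bdd_lipschitz:
  fixes \<phi> :: "'b \<Rightarrow> real"
  assumes "\<And>s t. \<bar>\<phi> s - \<phi> t\<bar> \<le> norm (s - t)" shows "locally_bdd \<phi>"
proof (rule locally_bddI)
  have "1-lipschitz_on UNIV \<phi>" using assms by (intro lipschitz_onI) (auto simp: dist_norm)
  then show "\<phi> \<in> borel_measurable borel"
    by (intro borel_measurable_continuous_onI lipschitz_on_continuous_on)
  fix R
  show "\<exists>K. \<forall>s. norm s \<le> R \<longrightarrow> \<bar>\<phi> s\<bar> \<le> K"
  proof (intro exI allI impI)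
    fix s :: 'b assume "norm s \<le> R"
    then show "\<bar>\<phi> s\<bar> \<le> \<bar>\<phi> 0\<bar> + R" using assms[of s 0] by simp
  qed
qed

lemma integrable_norm_sq: "integrable N (\<lambda>y. (norm y)\<^sup>2)"
  by (intro integrable_locally_bdd locally_bdd_continuous_norm[of "\<lambda>x. x\<^sup>2"] continuous_intros)

text \<open>A martingale decomposition: \<open>T\<close> preserves the Lipschitz condition, so each
  step adds at most one second moment of the step. The strong second moment suffices here, since the
  result only has to be of smaller order than \<open>(c n)\<^sup>2\<close>.\<close>

lemma variance_lipschitz:
  assumes L: "\<And>s t. \<bar>\<phi> s - \<phi> t\<bar> \<le> norm (s - t)"
  shows "(T ^^ n) (\<lambda>s. (\<phi> s)\<^sup>2) s - ((T ^^ n) \<phi> s)\<^sup>2 \<le> real n * (\<integral>y. (norm y)\<^sup>2 \<partial>N)"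
  using L
proof (induction n arbitrary: \<phi>)
  case 0
  then show ?case by simp
next
  case (Suc n)
  define \<tau> where "\<tau> = (\<integral>y. (norm y)\<^sup>2 \<partial>N)"
  note f = locally_bdd_lipschitz[of \<phi>, OF Suc.prems]
  have f2: "locally_bdd (\<lambda>s. (\<phi> s)\<^sup>2)" using locally_bdd_mult[OF f f] by (simp add: power2_eq_square)
  have TL: "\<bar>T \<phi> s - T \<phi> t\<bar> \<le> norm (s - t)" for s t
  proof -
    have "T \<phi> s - T \<phi> t = (\<integral>y. \<phi> (s + y) - \<phi> (t + y) \<partial>N)"
      unfolding T_def using integrable_shift[OF f] by simp
    also have "norm \<dots> \<le> (\<integral>y. norm (\<phi> (s + y) - \<phi> (t + y)) \<partial>N)" by (rule integral_norm_bound)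
    also have "\<dots> \<le> (\<integral>y. norm (s - t) \<partial>N)"
    proof (rule integral_mono)
      show "integrable N (\<lambda>y. norm (\<phi> (s + y) - \<phi> (t + y)))" using integrable_shift[OF f] by auto
      fix y show "norm (\<phi> (s + y) - \<phi> (t + y)) \<le> norm (s - t)" using Suc.prems[of "s + y" "t + y"] by simp
    qed simp
    also have "\<dots> = norm (s - t)" by (simp add: prob_space)
    finally show ?thesis by simp
  qed
  note F = locally_bdd_lipschitz[of "T \<phi>", OF TL]
  have F2: "locally_bdd (\<lambda>s. (T \<phi> s)\<^sup>2)" using locally_bdd_mult[OF F F] by (simp add: power2_eq_square)
  have step: "T (\<lambda>s. (\<phi> s)\<^sup>2) s - (T \<phi> s)\<^sup>2 \<le> \<tau>" for s
  proof -
    have i: "integrable N (\<lambda>y. \<phi> (s + y))" "integrable N (\<lambda>y. (\<phi> (s + y))\<^sup>2)"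
      by (rule integrable_shift[OF f]) (rule integrable_shift[OF f2])
    define m where "m = T \<phi> s"
    \<comment> \<open>The variance is at most the mean square about any other point; the point
      \<open>\<phi> s\<close> makes the Lipschitz condition applicable.\<close>
    have "T (\<lambda>s. (\<phi> s)\<^sup>2) s - m\<^sup>2 \<le> T (\<lambda>s. (\<phi> s)\<^sup>2) s - m\<^sup>2 + (m - \<phi> s)\<^sup>2" by simp
    also have "\<dots> = T (\<lambda>s. (\<phi> s)\<^sup>2) s - 2 * \<phi> s * m + (\<phi> s)\<^sup>2" by (simp add: power2_eq_square algebra_simps)
    also have "\<dots> = (\<integral>y. (\<phi> (s + y))\<^sup>2 - 2 * \<phi> s * \<phi> (s + y) + (\<phi> s)\<^sup>2 \<partial>N)"
      using i by (simp add: T_def m_def prob_space)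
    also have "\<dots> \<le> \<tau>" unfolding \<tau>_def
    proof (rule integral_mono[OF _ integrable_norm_sq])
      show "integrable N (\<lambda>y. (\<phi> (s + y))\<^sup>2 - 2 * \<phi> s * \<phi> (s + y) + (\<phi> s)\<^sup>2)" using i by auto
      fix y
      have "(\<phi> (s + y) - \<phi> s)\<^sup>2 \<le> (norm y)\<^sup>2"
        using Suc.prems[of "s + y" s] by (simp add: abs_le_square_iff[symmetric])
      then show "(\<phi> (s + y))\<^sup>2 - 2 * \<phi> s * \<phi> (s + y) + (\<phi> s)\<^sup>2 \<le> (norm y)\<^sup>2"
        by (simp add: power2_eq_square algebra_simps)
    qed
    finally show ?thesis by (simp add: m_def)
  qed
  have sw: "(T ^^ Suc n) g = (T ^^ n) (T g)" for g by (simp only: funpow_Suc_right comp_def)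
  have "(T ^^ n) (T (\<lambda>s. (\<phi> s)\<^sup>2)) s - (T ^^ n) (\<lambda>s. (T \<phi> s)\<^sup>2) s
      = (T ^^ n) (\<lambda>s. T (\<lambda>s. (\<phi> s)\<^sup>2) s - (T \<phi> s)\<^sup>2) s"
    by (subst Tn_diff[OF locally_bdd_T[OF f2] F2]) simp
  also have "\<dots> \<le> (T ^^ n) (\<lambda>_. \<tau>) s"
    by (intro Tn_mono locally_bdd_diff locally_bdd_T f2 F2 locally_bdd_const step)
  also have "\<dots> = \<tau>" by (simp add: Tn_const)
  finally have "(T ^^ n) (T (\<lambda>s. (\<phi> s)\<^sup>2)) s - (T ^^ n) (\<lambda>s. (T \<phi> s)\<^sup>2) s \<le> \<tau>" .
  moreover have "(T ^^ n) (\<lambda>s. (T \<phi> s)\<^sup>2) s - ((T ^^ n) (T \<phi>) s)\<^sup>2 \<le> real n * \<tau>"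
    unfolding \<tau>_def by (rule Suc.IH[OF TL])
  ultimately show ?case unfolding sw \<tau>_def[symmetric] by (simp add: algebra_simps)
qed

end

section \<open>The setting: the norming sequence and moments of the normalized norm\<close>

locale lil_setup = prob_space M
  for M :: "'a measure" +
  fixes X :: "'a \<Rightarrow> 'b::{banach,second_countable_topology}"
    and Xs :: "nat \<Rightarrow> 'a \<Rightarrow> 'b" and c :: "nat \<Rightarrow> real"
  assumes X_meas[measurable]: "X \<in> borel_measurable M"
    and Xs_meas: "\<And>i. i \<ge> 1 \<Longrightarrow> Xs i \<in> borel_measurable M"
    and Xs_indep: "indep_vars (\<lambda>_. borel) Xs {1..}"
    and Xs_law: "\<And>i. i \<ge> 1 \<Longrightarrow> distr M borel (Xs i) = distr M borel X"
    and X_int: "integrable M X" and X_mean: "integral\<^sup>L M X = 0"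
    and c_pos: "\<And>n. n \<ge> 1 \<Longrightarrow> c n > 0"
    and c_step: "\<And>n. n \<ge> 1 \<Longrightarrow> c n / sqrt (real n) \<le> c (Suc n) / sqrt (real (Suc n))"
    and c_lim: "filterlim (\<lambda>n. c n / sqrt (real n)) at_top sequentially"
    and c_growth: "\<And>\<epsilon>. \<epsilon> > 0 \<Longrightarrow> \<exists>m\<epsilon>\<ge>1. \<forall>m n. m\<epsilon> \<le> m \<and> m < n \<longrightarrow>
            c n / c m \<le> (1 + \<epsilon>) * (real n / real m)"
    and X_tail: "summable (\<lambda>n. measure M {\<omega> \<in> space M. norm (X \<omega>) \<ge> c (Suc n)})"
begin

lemma c_ratio:
  assumes m: "1 \<le> m" "m \<le> n" shows "c m \<le> sqrt (real m / real n) * c n"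
proof -
  have "c m / sqrt (real m) \<le> c n / sqrt (real n)"
    using m(2,1)
  proof (induction n rule: dec_induct)
    case (step k)
    then show ?case using c_step[of k] by simp
  qed simp
  then show ?thesis using m by (simp add: real_sqrt_divide field_simps)
qed

lemma c_mono: assumes m: "1 \<le> m" "m \<le> n" shows "c m \<le> c n"
proof -
  have "c m \<le> sqrt (real m / real n) * c n" by (rule c_ratio[OF m])
  also have "\<dots> \<le> 1 * c n" using m c_pos[of n] by (intro mult_right_mono) auto
  finally show ?thesis by simp
qed

lemma c_tendsto: "filterlim c at_top sequentially"
proof (rule filterlim_at_top_mono[OF c_lim])
  show "\<forall>\<^sub>F n in sequentially. c n / sqrt (real n) \<le> c n"
    using eventually_ge_at_top[of 1]
  proof eventually_elim
    case (elim n)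
    have "c n / sqrt (real n) \<le> c n / 1" using elim c_pos[of n] by (intro divide_left_mono) auto
    then show ?case by simp
  qed
qed

lemma expectation_Xs:
  fixes h :: "'b \<Rightarrow> real"
  assumes i: "i \<ge> 1" and h: "h \<in> borel_measurable borel"
  shows "(\<integral>\<omega>. h (Xs i \<omega>) \<partial>M) = (\<integral>\<omega>. h (X \<omega>) \<partial>M)"
  using integral_distr[OF Xs_meas[OF i] h] integral_distr[OF X_meas h] Xs_law[OF i] by simp

lemma integrable_Xs:
  fixes h :: "'b \<Rightarrow> real"
  assumes i: "i \<ge> 1" and h: "h \<in> borel_measurable borel"
  shows "integrable M (\<lambda>\<omega>. h (Xs i \<omega>)) \<longleftrightarrow> integrable M (\<lambda>\<omega>. h (X \<omega>))"
  using integrable_distr_eq[OF Xs_meas[OF i] h] integrable_distr_eq[OF X_meas h] Xs_law[OF i] by simp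

lemma prob_Xs:
  assumes i: "i \<ge> 1" and A: "A \<in> sets borel"
  shows "prob {\<omega>\<in>space M. Xs i \<omega> \<in> A} = prob {\<omega>\<in>space M. X \<omega> \<in> A}"
proof -
  have "measure (distr M borel (Xs i)) A = measure (distr M borel X) A" by (simp add: Xs_law[OF i])
  then show ?thesis using Xs_meas[OF i] A
    by (simp add: measure_distr vimage_def Int_def conj_commute)
qed

text \<open>\<open>J - 1\<close> is the number of \<open>n \<ge> 1\<close> with \<open>c n \<le> norm X\<close>, so the summability of the tails says that
  \<open>J\<close> is integrable.\<close>

definition J :: "'a \<Rightarrow> nat" where "J \<omega> = (LEAST j. j \<ge> 1 \<and> norm (X \<omega>) < c j)"

lemma J_prop: "J \<omega> \<ge> 1 \<and> norm (X \<omega>) < c (J \<omega>)"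
proof -
  have "\<forall>\<^sub>F n in sequentially. norm (X \<omega>) < c n" using c_tendsto by (rule filterlim_at_top_dense[THEN iffD1, rule_format])
  moreover have "\<forall>\<^sub>F n in sequentially. (n::nat) \<ge> 1" by (rule eventually_ge_at_top)
  ultimately have "\<forall>\<^sub>F n in sequentially. n \<ge> 1 \<and> norm (X \<omega>) < c n" by eventually_elim simp
  then have "\<exists>n\<ge>1. norm (X \<omega>) < c n" using eventually_happens by fastforce
  then show ?thesis unfolding J_def by (auto intro: LeastI2_ex)
qed

lemma J_less: "n \<ge> 1 \<Longrightarrow> n < J \<omega> \<Longrightarrow> c n \<le> norm (X \<omega>)"
  unfolding J_def using not_less_Least by fastforce

lemma J_greater: "n \<ge> 1 \<Longrightarrow> c n \<le> norm (X \<omega>) \<Longrightarrow> n < J \<omega>"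
  using J_prop[of \<omega>] c_mono[of "J \<omega>" n] by (meson leI less_le_trans not_less order_trans)

lemma J_meas[measurable]: "J \<in> measurable M (count_space UNIV)"
  unfolding J_def[abs_def] by measurable

lemma J_integrable: "integrable M (\<lambda>\<omega>. real (J \<omega>))"
proof (rule integrableI_nonneg)
  define p where "p t = measure M {\<omega> \<in> space M. t < J \<omega>}" for t
  have "summable (\<lambda>n. p (Suc n))"
  proof (rule summable_comparison_test'[OF X_tail])
    fix n
    have "p (Suc n) \<le> measure M {\<omega> \<in> space M. norm (X \<omega>) \<ge> c (Suc n)}"
      unfolding p_def by (intro finite_measure_mono) (auto intro: J_less)
    then show "norm (p (Suc n)) \<le> measure M {\<omega> \<in> space M. norm (X \<omega>) \<ge> c (Suc n)}" by (simp add: p_def)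
  qed
  then have s: "summable p" by (rule summable_Suc_iff[THEN iffD1])
  have "(\<integral>\<^sup>+\<omega>. ennreal (real (J \<omega>)) \<partial>M) = (\<Sum>t. emeasure M {\<omega> \<in> space M. t < J \<omega>})"
    by (simp add: nn_integral_nat_function ennreal_of_nat_eq_real_of_nat[symmetric])
  also have "\<dots> = (\<Sum>t. ennreal (p t))" by (simp add: p_def emeasure_eq_measure)
  also have "\<dots> = ennreal (\<Sum>t. p t)" by (rule suminf_ennreal2) (auto simp: p_def s[unfolded p_def])
  also have "\<dots> < \<infinity>" by simp
  finally show "(\<integral>\<^sup>+\<omega>. ennreal (real (J \<omega>)) \<partial>M) < \<infinity>" .
qed auto

text \<open>The cap at \<open>1\<close> lets the moments of \<open>u n\<close> control the mass
  between \<open>\<rho> * c n\<close> and \<open>c n\<close> and the tail beyond \<open>c n\<close>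
  at once.\<close>

definition u :: "nat \<Rightarrow> 'a \<Rightarrow> real" where "u n \<omega> = min 1 (norm (X \<omega>) / c n)"

lemma u_meas[measurable]: "u n \<in> borel_measurable M"
  unfolding u_def by measurable

lemma u_range: "n \<ge> 1 \<Longrightarrow> 0 \<le> u n \<omega> \<and> u n \<omega> \<le> 1"
  using c_pos[of n] by (auto simp: u_def)

text \<open>For \<open>n > J\<close> the monotonicity of \<open>c n / sqrt n\<close> compares
  \<open>c J\<close> with \<open>c n\<close>, which trades the squared norm for
  \<open>J / n\<close>.\<close>

lemma u_sq_le: assumes n: "n \<ge> 1" shows "(u n \<omega>)\<^sup>2 \<le> min 1 (real (J \<omega>) / real n)"
proof (cases "J \<omega> \<ge> n")
  case True
  then have "min 1 (real (J \<omega>) / real n) = 1" using n by simp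
  then show ?thesis using u_range[OF n, of \<omega>] by (simp add: power_le_one)
next
  case False
  have "norm (X \<omega>) \<le> c (J \<omega>)" using J_prop[of \<omega>] by simp
  also have "\<dots> \<le> sqrt (real (J \<omega>) / real n) * c n" using False J_prop[of \<omega>] by (intro c_ratio) auto
  finally have "norm (X \<omega>) / c n \<le> sqrt (real (J \<omega>) / real n)" using c_pos[OF n] by (simp add: pos_divide_le_eq)
  then have "u n \<omega> \<le> sqrt (real (J \<omega>) / real n)" by (simp add: u_def)
  then have "(u n \<omega>)\<^sup>2 \<le> (sqrt (real (J \<omega>) / real n))\<^sup>2" using u_range[OF n, of \<omega>] by (intro power_mono) auto
  then show ?thesis using u_range[OF n, of \<omega>] by (simp add: power_le_one)
qed

lemma u_pow_integrable: "n \<ge> 1 \<Longrightarrow> integrable M (\<lambda>\<omega>. (u n \<omega>) ^ k)"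
  using u_range[of n] by (intro integrable_const_bound[of _ 1]) (auto simp: power_le_one)

text \<open>The fourth power is used because \<open>n\<close> times the second moment is only known
  to tend to \<open>0\<close>, whereas \<open>u ^ 4 <= (min 1 (J / n))\<^sup>2\<close> is good
  enough for summability along geometric sequences.\<close>

definition G :: "nat \<Rightarrow> real" where "G n = real n * (\<integral>\<omega>. (u n \<omega>) ^ 4 \<partial>M)"

lemma G_nonneg: "n \<ge> 1 \<Longrightarrow> G n \<ge> 0"
  using u_range unfolding G_def by (intro mult_nonneg_nonneg integral_nonneg_AE) auto

lemma geom_ge1:
  fixes m :: "nat \<Rightarrow> nat"
  assumes r: "r > 1" and m0: "m 0 \<ge> 1" and m: "\<And>k. r * real (m k) \<le> real (m (Suc k))"
  shows "m k \<ge> 1"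
proof (induction k)
  case (Suc k)
  then have "r * 1 \<le> r * m k" using r by (intro mult_left_mono) auto
  then have "1 < real (m (Suc k))" using m[of k] r by linarith
  then show ?case by simp
qed (use m0 in simp)

lemma G_summable:
  fixes m :: "nat \<Rightarrow> nat"
  assumes r: "r > 1" and m0: "m 0 \<ge> 1" and m: "\<And>k. r * real (m k) \<le> real (m (Suc k))"
  shows "summable (\<lambda>k. G (m k))"
proof (rule summableI_nonneg_bounded)
  define C where "C = 2 * (1 + r) / (r - 1)"
  note m1 = geom_ge1[OF r m0 m]
  show "0 \<le> G (m k)" for k using G_nonneg[OF m1] .
  show "(\<Sum>k<K. G (m k)) \<le> C * (\<integral>\<omega>. real (J \<omega>) \<partial>M)" for K
  proof -
    have i: "integrable M (\<lambda>\<omega>. real (m k) * (u (m k) \<omega>) ^ 4)" for k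
      by (intro integrable_mult_right u_pow_integrable m1)
    have "(\<Sum>k<K. G (m k)) = (\<integral>\<omega>. (\<Sum>k<K. real (m k) * (u (m k) \<omega>) ^ 4) \<partial>M)"
      by (subst Bochner_Integration.integral_sum) (use i in \<open>simp_all add: G_def\<close>)
    also have "\<dots> \<le> (\<integral>\<omega>. C * real (J \<omega>) \<partial>M)"
    proof (rule integral_mono)
      show "integrable M (\<lambda>\<omega>. \<Sum>k<K. real (m k) * (u (m k) \<omega>) ^ 4)" using i by auto
      show "integrable M (\<lambda>\<omega>. C * real (J \<omega>))" using J_integrable by auto
      fix \<omega>
      have "(\<Sum>k<K. real (m k) * (u (m k) \<omega>) ^ 4) \<le> (\<Sum>k<K. real (m k) * (min 1 (real (J \<omega>) / m k))\<^sup>2)"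
      proof (intro sum_mono mult_left_mono)
        fix k
        have "(u (m k) \<omega>) ^ 4 = ((u (m k) \<omega>)\<^sup>2)\<^sup>2" by (simp flip: power_mult)
        also have "\<dots> \<le> (min 1 (real (J \<omega>) / m k))\<^sup>2" by (intro power_mono u_sq_le m1) auto
        finally show "(u (m k) \<omega>) ^ 4 \<le> (min 1 (real (J \<omega>) / m k))\<^sup>2" .
      qed auto
      also have "\<dots> \<le> C * real (J \<omega>)" unfolding C_def
        by (rule geometric_sum_bound[OF r m0 m]) (use J_prop[of \<omega>] in simp)
      finally show "(\<Sum>k<K. real (m k) * (u (m k) \<omega>) ^ 4) \<le> C * real (J \<omega>)" .
    qed
    finally show ?thesis by simp
  qed
qed

text \<open>Dominated convergence with majorant \<open>J\<close>; the pointwise limit comes from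
  \<open>c n / sqrt n\<close> tending to infinity.\<close>

lemma second_moment_tendsto: "(\<lambda>n. real n * (\<integral>\<omega>. (u n \<omega>)\<^sup>2 \<partial>M)) \<longlonglongrightarrow> 0"
proof -
  have "(\<lambda>n. (\<integral>\<omega>. real (Suc n) * (u (Suc n) \<omega>)\<^sup>2 \<partial>M)) \<longlonglongrightarrow> (\<integral>\<omega>. 0 \<partial>M)"
  proof (rule integral_dominated_convergence[where w="\<lambda>\<omega>. real (J \<omega>)"])
    show "AE \<omega> in M. (\<lambda>n. real (Suc n) * (u (Suc n) \<omega>)\<^sup>2) \<longlonglongrightarrow> 0"
    proof (rule AE_I2)
      fix \<omega>
      have "(\<lambda>n. inverse (c n / sqrt (real n))) \<longlonglongrightarrow> 0"
        using c_lim by (rule tendsto_inverse_0_at_top)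
      then have "(\<lambda>n. inverse (c (Suc n) / sqrt (real (Suc n)))) \<longlonglongrightarrow> 0"
        by (rule LIMSEQ_Suc)
      then have "(\<lambda>n. (norm (X \<omega>) * inverse (c (Suc n) / sqrt (real (Suc n))))\<^sup>2) \<longlonglongrightarrow> (norm (X \<omega>) * 0)\<^sup>2"
        by (intro tendsto_intros)
      then have lim: "(\<lambda>n. (norm (X \<omega>) * inverse (c (Suc n) / sqrt (real (Suc n))))\<^sup>2) \<longlonglongrightarrow> 0" by simp
      show "(\<lambda>n. real (Suc n) * (u (Suc n) \<omega>)\<^sup>2) \<longlonglongrightarrow> 0"
      proof (rule tendsto_sandwich[OF _ _ tendsto_const lim])
        show "\<forall>\<^sub>F n in sequentially. 0 \<le> real (Suc n) * (u (Suc n) \<omega>)\<^sup>2" by simp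
        show "\<forall>\<^sub>F n in sequentially. real (Suc n) * (u (Suc n) \<omega>)\<^sup>2 \<le> (norm (X \<omega>) * inverse (c (Suc n) / sqrt (real (Suc n))))\<^sup>2"
        proof (rule always_eventually, rule allI)
          fix n
          have "(u (Suc n) \<omega>)\<^sup>2 \<le> (norm (X \<omega>) / c (Suc n))\<^sup>2"
            using u_range[of "Suc n" \<omega>] by (intro power_mono) (auto simp: u_def)
          then have "real (Suc n) * (u (Suc n) \<omega>)\<^sup>2 \<le> real (Suc n) * (norm (X \<omega>) / c (Suc n))\<^sup>2"
            by (intro mult_left_mono) auto
          also have "\<dots> = (norm (X \<omega>) * inverse (c (Suc n) / sqrt (real (Suc n))))\<^sup>2"
            by (simp add: power_mult_distrib power_divide del: of_nat_Suc)
          finally show "real (Suc n) * (u (Suc n) \<omega>)\<^sup>2 \<le> (norm (X \<omega>) * inverse (c (Suc n) / sqrt (real (Suc n))))\<^sup>2" .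
        qed
      qed
    qed
    show "AE \<omega> in M. norm (real (Suc n) * (u (Suc n) \<omega>)\<^sup>2) \<le> real (J \<omega>)" for n
    proof (rule AE_I2)
      fix \<omega>
      have "(u (Suc n) \<omega>)\<^sup>2 \<le> real (J \<omega>) / real (Suc n)" using u_sq_le[of "Suc n" \<omega>] by simp
      then have "real (Suc n) * (u (Suc n) \<omega>)\<^sup>2 \<le> real (J \<omega>)" by (simp add: pos_le_divide_eq mult.commute del: of_nat_Suc)
      then show "norm (real (Suc n) * (u (Suc n) \<omega>)\<^sup>2) \<le> real (J \<omega>)" by (simp del: of_nat_Suc)
    qed
  qed (use J_integrable in auto)
  then have "(\<lambda>n. real (Suc n) * (\<integral>\<omega>. (u (Suc n) \<omega>)\<^sup>2 \<partial>M)) \<longlonglongrightarrow> 0" by (simp del: of_nat_Suc)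
  then show ?thesis by (rule LIMSEQ_imp_Suc)
qed

text \<open>It measures the mean of what truncation discards and also, since \<open>X\<close> is
  centred, bounds the drift that truncation creates (\<open>norm_mu_R\<close>).\<close>

definition R :: "real \<Rightarrow> real" where "R a = (\<integral>\<omega>. (if norm (X \<omega>) \<le> a then 0 else norm (X \<omega>)) \<partial>M)"

lemma R_integrable: "integrable M (\<lambda>\<omega>. if norm (X \<omega>) \<le> a then 0 else norm (X \<omega>))"
  by (rule Bochner_Integration.integrable_bound[OF X_int]) (auto intro!: AE_I2)

lemma R_nonneg: "R a \<ge> 0" unfolding R_def by (intro integral_nonneg_AE) auto

text \<open>Dominated convergence again. The integrand lives on \<open>n < J\<close>, where an upper
  bound for \<open>c J / c n\<close> is needed; the growth condition with
  \<open>\<epsilon> = 1\<close> supplies the majorant \<open>2 * J\<close>.\<close>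

lemma R_tendsto: "(\<lambda>n. real n * R (c n) / c n) \<longlonglongrightarrow> 0"
proof -
  obtain m1 where m1: "m1 \<ge> 1" "\<And>m n. m1 \<le> m \<Longrightarrow> m < n \<Longrightarrow> c n / c m \<le> (1 + 1) * (real n / real m)"
    using c_growth[of 1] by auto
  define w where "w n \<omega> = real n / c n * (if norm (X \<omega>) \<le> c n then 0 else norm (X \<omega>))" for n \<omega>
  have "(\<lambda>n. (\<integral>\<omega>. w (n + m1) \<omega> \<partial>M)) \<longlonglongrightarrow> (\<integral>\<omega>. 0 \<partial>M)"
  proof (rule integral_dominated_convergence[where w="\<lambda>\<omega>. 2 * real (J \<omega>)"])
    show "AE \<omega> in M. (\<lambda>n. w (n + m1) \<omega>) \<longlonglongrightarrow> 0"
    proof (rule AE_I2)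
      fix \<omega>
      have "\<forall>\<^sub>F n in sequentially. norm (X \<omega>) < c n" using c_tendsto by (rule filterlim_at_top_dense[THEN iffD1, rule_format])
      then have "\<forall>\<^sub>F n in sequentially. w n \<omega> = 0" by eventually_elim (auto simp: w_def)
      then have "(\<lambda>n. w n \<omega>) \<longlonglongrightarrow> 0" by (rule tendsto_eventually)
      then show "(\<lambda>n. w (n + m1) \<omega>) \<longlonglongrightarrow> 0" by (rule LIMSEQ_ignore_initial_segment)
    qed
    show "AE \<omega> in M. norm (w (n + m1) \<omega>) \<le> 2 * real (J \<omega>)" for n
    proof (rule AE_I2)
      fix \<omega>
      define k where "k = n + m1"
      have k: "k \<ge> 1" "k \<ge> m1" using m1 by (auto simp: k_def)
      show "norm (w (n + m1) \<omega>) \<le> 2 * real (J \<omega>)"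
      proof (cases "norm (X \<omega>) \<le> c k")
        case True then show ?thesis by (simp add: w_def k_def)
      next
        case False
        then have kJ: "k < J \<omega>" using J_greater[OF k(1)] by simp
        have "norm (X \<omega>) / c k \<le> c (J \<omega>) / c k" using J_prop[of \<omega>] c_pos[OF k(1)] by (intro divide_right_mono) auto
        also have "\<dots> \<le> 2 * (real (J \<omega>) / real k)" using m1(2)[OF k(2) kJ] by simp
        finally have "real k * (norm (X \<omega>) / c k) \<le> real k * (2 * (real (J \<omega>) / real k))" by (intro mult_left_mono) auto
        then show ?thesis using False k c_pos[OF k(1)] by (simp add: w_def k_def[symmetric])
      qed
    qed
  qed (use J_integrable in \<open>auto simp: w_def\<close>)
  then have "(\<lambda>n. (\<integral>\<omega>. w n \<omega> \<partial>M)) \<longlonglongrightarrow> 0" by (simp add: LIMSEQ_offset)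
  moreover have "(\<integral>\<omega>. w n \<omega> \<partial>M) = real n * R (c n) / c n" for n by (simp add: w_def R_def)
  ultimately show ?thesis by simp
qed

lemma tail_le_G:
  assumes n: "n \<ge> 1" and \<rho>: "0 < \<rho>" "\<rho> \<le> 1"
  shows "real n * prob {\<omega>\<in>space M. norm (X \<omega>) > \<rho> * c n} \<le> G n / \<rho> ^ 4"
proof -
  have "\<rho> ^ 4 * prob {\<omega>\<in>space M. norm (X \<omega>) > \<rho> * c n} = (\<integral>\<omega>. \<rho> ^ 4 * indicator {\<omega>\<in>space M. norm (X \<omega>) > \<rho> * c n} \<omega> \<partial>M)"
    by simp
  also have "\<dots> \<le> (\<integral>\<omega>. (u n \<omega>) ^ 4 \<partial>M)"
  proof (rule integral_mono[OF _ u_pow_integrable[OF n]])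
    show "integrable M (\<lambda>\<omega>. \<rho> ^ 4 * indicator {\<omega>\<in>space M. norm (X \<omega>) > \<rho> * c n} \<omega>)"
      by (intro integrable_mult_right integrable_real_indicator) (auto simp: less_top[symmetric])
    fix \<omega>
    have "\<rho> \<le> u n \<omega>" if "norm (X \<omega>) > \<rho> * c n"
      using that \<rho> c_pos[OF n] by (simp add: u_def pos_le_divide_eq)
    then show "\<rho> ^ 4 * indicator {\<omega>\<in>space M. norm (X \<omega>) > \<rho> * c n} \<omega> \<le> (u n \<omega>) ^ 4"
      using u_range[OF n, of \<omega>] \<rho> by (auto simp: indicator_def intro!: power_mono)
  qed
  finally have "real n * (\<rho> ^ 4 * prob {\<omega>\<in>space M. norm (X \<omega>) > \<rho> * c n}) \<le> G n"
    unfolding G_def by (intro mult_left_mono) auto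
  then show ?thesis using \<rho> by (simp add: pos_le_divide_eq mult_ac)
qed

text \<open>Lowering the truncation level adds the band between \<open>\<rho> * c n\<close> and
  \<open>c n\<close>, where \<open>u >= \<rho>\<close> allows
  \<open>u <= u ^ 4 / \<rho> ^ 3\<close>.\<close>

lemma R_le_G:
  assumes n: "n \<ge> 1" and \<rho>: "0 < \<rho>" "\<rho> \<le> 1"
  shows "real n * R (\<rho> * c n) / c n \<le> real n * R (c n) / c n + G n / \<rho> ^ 3"
proof -
  note cn = c_pos[OF n]
  have "R (\<rho> * c n) \<le> (\<integral>\<omega>. (if norm (X \<omega>) \<le> c n then 0 else norm (X \<omega>)) + c n / \<rho> ^ 3 * (u n \<omega>) ^ 4 \<partial>M)"
    unfolding R_def
  proof (rule integral_mono[OF R_integrable])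
    show "integrable M (\<lambda>\<omega>. (if norm (X \<omega>) \<le> c n then 0 else norm (X \<omega>)) + c n / \<rho> ^ 3 * (u n \<omega>) ^ 4)"
      by (intro Bochner_Integration.integrable_add R_integrable integrable_mult_right u_pow_integrable n)
    fix \<omega>
    define x where "x = norm (X \<omega>)"
    have nn: "0 \<le> c n / \<rho> ^ 3 * (u n \<omega>) ^ 4" using u_range[OF n, of \<omega>] cn \<rho> by auto
    show "(if norm (X \<omega>) \<le> \<rho> * c n then 0 else norm (X \<omega>)) \<le> (if norm (X \<omega>) \<le> c n then 0 else norm (X \<omega>)) + c n / \<rho> ^ 3 * (u n \<omega>) ^ 4"
    proof (cases "\<rho> * c n < x \<and> x \<le> c n")
      case True
      then have u: "u n \<omega> = x / c n" using cn by (simp add: u_def x_def)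
      have "\<rho> \<le> u n \<omega>" using True cn by (simp add: u pos_le_divide_eq)
      then have "\<rho> ^ 3 \<le> (u n \<omega>) ^ 3" using \<rho> by (intro power_mono) auto
      then have "\<rho> ^ 3 * u n \<omega> \<le> (u n \<omega>) ^ 3 * u n \<omega>" using u_range[OF n, of \<omega>] by (intro mult_right_mono) auto
      then have "u n \<omega> \<le> (u n \<omega>) ^ 4 / \<rho> ^ 3" using \<rho> by (simp add: pos_le_divide_eq power_numeral_reduce mult_ac)
      then have "c n * u n \<omega> \<le> c n * ((u n \<omega>) ^ 4 / \<rho> ^ 3)" using cn by (intro mult_left_mono) auto
      moreover have "c n * u n \<omega> = x" using cn by (simp add: u)
      ultimately show ?thesis using True by (simp add: x_def)
    next
      case False
      then show ?thesis using nn by (auto simp: x_def)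
    qed
  qed
  also have "\<dots> = R (c n) + c n / \<rho> ^ 3 * (\<integral>\<omega>. (u n \<omega>) ^ 4 \<partial>M)"
    unfolding R_def using R_integrable u_pow_integrable[OF n] by simp
  finally have "real n * R (\<rho> * c n) / c n \<le> real n * (R (c n) + c n / \<rho> ^ 3 * (\<integral>\<omega>. (u n \<omega>) ^ 4 \<partial>M)) / c n"
    using cn by (intro divide_right_mono mult_left_mono) auto
  also have "\<dots> = real n * R (c n) / c n + G n / \<rho> ^ 3"
    unfolding G_def using cn by (simp add: distrib_left add_divide_distrib)
  finally show ?thesis .
qed

section \<open>Truncated summands and the weak variance\<close>

definition trunc :: "real \<Rightarrow> 'b \<Rightarrow> 'b" where "trunc a x = (if norm x \<le> a then x else 0)"

lemma trunc_meas[measurable]: "trunc a \<in> borel_measurable borel"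
  unfolding trunc_def[abs_def] by measurable

lemma norm_trunc: "a \<ge> 0 \<Longrightarrow> norm (trunc a x) \<le> a" by (simp add: trunc_def)

lemma trunc_int: "integrable M (\<lambda>\<omega>. trunc a (X \<omega>))"
  by (rule Bochner_Integration.integrable_bound[OF X_int]) (auto intro!: AE_I2 simp: trunc_def)

definition mu :: "real \<Rightarrow> 'b" where "mu a = (\<integral>\<omega>. trunc a (X \<omega>) \<partial>M)"

lemma norm_mu_le: assumes "a \<ge> 0" shows "norm (mu a) \<le> a"
proof -
  have "norm (mu a) \<le> (\<integral>\<omega>. norm (trunc a (X \<omega>)) \<partial>M)" unfolding mu_def by (rule integral_norm_bound)
  also have "\<dots> \<le> (\<integral>\<omega>. a \<partial>M)"
    by (rule integral_mono[OF integrable_norm[OF trunc_int]]) (use norm_trunc[OF assms] in auto)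
  finally show ?thesis by (simp add: prob_space)
qed

lemma norm_diff_trunc: "norm (x - trunc a x) = (if norm x \<le> a then 0 else norm x)"
  by (simp add: trunc_def)

lemma norm_mu_R: "norm (mu a) \<le> R a"
proof -
  have "mu a = - (\<integral>\<omega>. X \<omega> - trunc a (X \<omega>) \<partial>M)"
    unfolding mu_def using X_int trunc_int X_mean by simp
  then have "norm (mu a) = norm (\<integral>\<omega>. X \<omega> - trunc a (X \<omega>) \<partial>M)" by simp
  also have "\<dots> \<le> (\<integral>\<omega>. norm (X \<omega> - trunc a (X \<omega>)) \<partial>M)" by (rule integral_norm_bound)
  also have "\<dots> = R a" unfolding R_def norm_diff_trunc ..
  finally show ?thesis .
qed

definition H :: "real \<Rightarrow> real" where "H = trunc_var M X"

lemma abs_blinfun_le: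
  fixes f :: "'b \<Rightarrow>\<^sub>L real" assumes "norm f \<le> 1" shows "\<bar>blinfun_apply f x\<bar> \<le> norm x"
  using norm_blinfun[of f x] mult_right_mono[OF assms, of "norm x"] by simp

lemma blinfun_meas[measurable]: "blinfun_apply (f :: 'b \<Rightarrow>\<^sub>L real) \<in> borel_measurable borel"
  by (intro borel_measurable_continuous_onI linear_continuous_on blinfun.bounded_linear_right)

lemma fsq_eq: "(blinfun_apply (f :: 'b \<Rightarrow>\<^sub>L real) (trunc t x))\<^sup>2 = (if norm x \<le> t then (blinfun_apply f x)\<^sup>2 else 0)"
  by (simp add: trunc_def)

lemma fsq_le:
  fixes f :: "'b \<Rightarrow>\<^sub>L real" assumes f: "norm f \<le> 1" and t: "t \<ge> 0"
  shows "(blinfun_apply f (trunc t x))\<^sup>2 \<le> t\<^sup>2"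
proof -
  have "\<bar>blinfun_apply f (trunc t x)\<bar> \<le> t" using abs_blinfun_le[OF f] norm_trunc[OF t] by (rule order_trans)
  then show ?thesis using t by (simp add: abs_le_square_iff[symmetric])
qed

lemma fsq_int:
  fixes f :: "'b \<Rightarrow>\<^sub>L real" assumes f: "norm f \<le> 1" and t: "t \<ge> 0"
  shows "integrable M (\<lambda>\<omega>. (blinfun_apply f (trunc t (X \<omega>)))\<^sup>2)"
  using fsq_le[OF f t] by (intro integrable_const_bound[of _ "t\<^sup>2"]) auto

lemma H_alt: "H t = (SUP f \<in> {f :: 'b \<Rightarrow>\<^sub>L real. norm f \<le> 1}. \<integral>\<omega>. (blinfun_apply f (trunc t (X \<omega>)))\<^sup>2 \<partial>M)"
  unfolding H_def trunc_var_def fsq_eq ..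

lemma H_bdd:
  assumes t: "t \<ge> 0"
  shows "bdd_above ((\<lambda>f. \<integral>\<omega>. (blinfun_apply f (trunc t (X \<omega>)))\<^sup>2 \<partial>M) ` {f :: 'b \<Rightarrow>\<^sub>L real. norm f \<le> 1})"
proof (rule bdd_aboveI2)
  fix f :: "'b \<Rightarrow>\<^sub>L real" assume "f \<in> {f. norm f \<le> 1}"
  then have f: "norm f \<le> 1" by simp
  have "(\<integral>\<omega>. (blinfun_apply f (trunc t (X \<omega>)))\<^sup>2 \<partial>M) \<le> (\<integral>\<omega>. t\<^sup>2 \<partial>M)"
    by (rule integral_mono[OF fsq_int[OF f t]]) (use fsq_le[OF f t] in auto)
  then show "(\<integral>\<omega>. (blinfun_apply f (trunc t (X \<omega>)))\<^sup>2 \<partial>M) \<le> t\<^sup>2" by (simp add: prob_space)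
qed

lemma H_ge:
  fixes f :: "'b \<Rightarrow>\<^sub>L real" assumes f: "norm f \<le> 1" and t: "t \<ge> 0"
  shows "(\<integral>\<omega>. (blinfun_apply f (trunc t (X \<omega>)))\<^sup>2 \<partial>M) \<le> H t"
  unfolding H_alt by (rule cSUP_upper[OF _ H_bdd[OF t]]) (use f in simp)

lemma H_le:
  assumes "\<And>f :: 'b \<Rightarrow>\<^sub>L real. norm f \<le> 1 \<Longrightarrow> (\<integral>\<omega>. (blinfun_apply f (trunc t (X \<omega>)))\<^sup>2 \<partial>M) \<le> B"
  shows "H t \<le> B"
  unfolding H_alt
proof (rule cSUP_least)
  show "{f :: 'b \<Rightarrow>\<^sub>L real. norm f \<le> 1} \<noteq> {}" by (auto intro: exI[of _ 0])
qed (use assms in auto)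

lemma H_nonneg: "t \<ge> 0 \<Longrightarrow> H t \<ge> 0"
  using H_ge[of 0 t] by simp

lemma H_mono: assumes "0 \<le> s" "s \<le> t" shows "H s \<le> H t"
proof (rule H_le)
  fix f :: "'b \<Rightarrow>\<^sub>L real" assume f: "norm f \<le> 1"
  have "(\<integral>\<omega>. (blinfun_apply f (trunc s (X \<omega>)))\<^sup>2 \<partial>M) \<le> (\<integral>\<omega>. (blinfun_apply f (trunc t (X \<omega>)))\<^sup>2 \<partial>M)"
    by (rule integral_mono[OF fsq_int fsq_int]) (use f assms in \<open>auto simp: fsq_eq\<close>)
  also have "\<dots> \<le> H t" by (rule H_ge) (use f assms in auto)
  finally show "(\<integral>\<omega>. (blinfun_apply f (trunc s (X \<omega>)))\<^sup>2 \<partial>M) \<le> H t" .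
qed

lemma H_approx:
  assumes t: "t \<ge> 0" and B: "B < H t"
  obtains f :: "'b \<Rightarrow>\<^sub>L real" where "norm f \<le> 1" "B < (\<integral>\<omega>. (blinfun_apply f (trunc t (X \<omega>)))\<^sup>2 \<partial>M)"
  using H_le[of t B] B by (meson not_less)

lemma norm_trunc_sq_le: assumes n: "n \<ge> 1" shows "(\<integral>\<omega>. (norm (trunc (c n) (X \<omega>)))\<^sup>2 \<partial>M) \<le> (c n)\<^sup>2 * (\<integral>\<omega>. (u n \<omega>)\<^sup>2 \<partial>M)"
proof -
  have c0: "c n > 0" by (rule c_pos[OF n])
  have "(\<integral>\<omega>. (norm (trunc (c n) (X \<omega>)))\<^sup>2 \<partial>M) \<le> (\<integral>\<omega>. (c n)\<^sup>2 * (u n \<omega>)\<^sup>2 \<partial>M)"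
  proof (rule integral_mono)
    show "integrable M (\<lambda>\<omega>. (norm (trunc (c n) (X \<omega>)))\<^sup>2)"
      using norm_trunc[of "c n"] c0 by (intro integrable_const_bound[of _ "(c n)\<^sup>2"]) (auto intro!: AE_I2 power_mono)
    fix \<omega>
    show "(norm (trunc (c n) (X \<omega>)))\<^sup>2 \<le> (c n)\<^sup>2 * (u n \<omega>)\<^sup>2"
      using c0 by (auto simp: trunc_def u_def power_divide min_def)
  qed (use u_pow_integrable[OF n] in auto)
  then show ?thesis by simp
qed

lemma H_moment: assumes n: "n \<ge> 1" shows "H (c n) \<le> (c n)\<^sup>2 * (\<integral>\<omega>. (u n \<omega>)\<^sup>2 \<partial>M)"
proof (rule H_le)
  fix f :: "'b \<Rightarrow>\<^sub>L real" assume f: "norm f \<le> 1"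
  have c0: "c n > 0" by (rule c_pos[OF n])
  have "(\<integral>\<omega>. (blinfun_apply f (trunc (c n) (X \<omega>)))\<^sup>2 \<partial>M) \<le> (\<integral>\<omega>. (norm (trunc (c n) (X \<omega>)))\<^sup>2 \<partial>M)"
  proof (rule integral_mono[OF fsq_int[OF f]])
    show "integrable M (\<lambda>\<omega>. (norm (trunc (c n) (X \<omega>)))\<^sup>2)"
      using norm_trunc[of "c n"] c0 by (intro integrable_const_bound[of _ "(c n)\<^sup>2"]) (auto intro!: AE_I2 power_mono)
    fix \<omega>
    show "(blinfun_apply f (trunc (c n) (X \<omega>)))\<^sup>2 \<le> (norm (trunc (c n) (X \<omega>)))\<^sup>2"
      using abs_blinfun_le[OF f] by (simp add: abs_le_square_iff[symmetric])
  qed (use c0 in simp)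
  also note norm_trunc_sq_le[OF n]
  finally show "(\<integral>\<omega>. (blinfun_apply f (trunc (c n) (X \<omega>)))\<^sup>2 \<partial>M) \<le> (c n)\<^sup>2 * (\<integral>\<omega>. (u n \<omega>)\<^sup>2 \<partial>M)" .
qed

text \<open>The weak variance is dominated by the strong one. In the lower bound this sends the
  exponents to infinity, so that constant factors can be absorbed.\<close>

lemma H_tendsto: "(\<lambda>n. real n * H (c n) / (c n)\<^sup>2) \<longlonglongrightarrow> 0"
proof (rule tendsto_sandwich[OF _ _ tendsto_const second_moment_tendsto])
  show "\<forall>\<^sub>F n in sequentially. 0 \<le> real n * H (c n) / (c n)\<^sup>2"
    using eventually_ge_at_top[of 1] by eventually_elim (use H_nonneg c_pos in \<open>auto simp: less_imp_le\<close>)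
  show "\<forall>\<^sub>F n in sequentially. real n * H (c n) / (c n)\<^sup>2 \<le> real n * (\<integral>\<omega>. (u n \<omega>)\<^sup>2 \<partial>M)"
    using eventually_ge_at_top[of 1]
  proof eventually_elim
    case (elim n)
    have "real n * H (c n) / (c n)\<^sup>2 \<le> real n * ((c n)\<^sup>2 * (\<integral>\<omega>. (u n \<omega>)\<^sup>2 \<partial>M)) / (c n)\<^sup>2"
      by (intro divide_right_mono mult_left_mono H_moment elim) auto
    then show ?case using c_pos[OF elim] by simp
  qed
qed

definition ctrunc :: "real \<Rightarrow> nat \<Rightarrow> 'a \<Rightarrow> 'b" where "ctrunc a i \<omega> = trunc a (Xs i \<omega>) - mu a"
definition NN :: "real \<Rightarrow> 'b measure" where "NN a = distr M borel (\<lambda>\<omega>. trunc a (X \<omega>) - mu a)"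

lemma NN_centered:
  assumes a: "a \<ge> 0" shows "bdd_centered (NN a) (2 * a) (H a)"
proof -
  have [measurable]: "(\<lambda>\<omega>. trunc a (X \<omega>) - mu a) \<in> borel_measurable M" by measurable
  interpret P: prob_space "NN a" unfolding NN_def by (rule prob_space_distr) simp
  show ?thesis
  proof
    show "sets (NN a) = sets borel" by (simp add: NN_def)
    show "0 \<le> 2 * a" using a by simp
    have "norm (trunc a x - mu a) \<le> 2 * a" for x
      using norm_triangle_ineq4[of "trunc a x" "mu a"] norm_trunc[OF a, of x] norm_mu_le[OF a] by linarith
    then show "AE y in NN a. norm y \<le> 2 * a" unfolding NN_def by (subst AE_distr_iff) auto
    show "(\<integral>y. y \<partial>NN a) = 0"
      unfolding NN_def using trunc_int by (subst integral_distr) (auto simp: mu_def prob_space)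
    fix f :: "'b \<Rightarrow>\<^sub>L real" assume f: "norm f \<le> 1"
    have i1: "integrable M (\<lambda>\<omega>. blinfun_apply f (trunc a (X \<omega>)))"
      by (rule integrable_bounded_linear[OF blinfun.bounded_linear_right trunc_int])
    have e1: "(\<integral>\<omega>. blinfun_apply f (trunc a (X \<omega>)) \<partial>M) = blinfun_apply f (mu a)"
      unfolding mu_def by (rule integral_bounded_linear[OF blinfun.bounded_linear_right trunc_int])
    define m where "m = blinfun_apply f (mu a)"
    have "(\<integral>y. (blinfun_apply f y)\<^sup>2 \<partial>NN a) = (\<integral>\<omega>. (blinfun_apply f (trunc a (X \<omega>) - mu a))\<^sup>2 \<partial>M)"
      unfolding NN_def by (subst integral_distr) auto
    also have "\<dots> = (\<integral>\<omega>. (blinfun_apply f (trunc a (X \<omega>)))\<^sup>2 - 2 * m * blinfun_apply f (trunc a (X \<omega>)) + m\<^sup>2 \<partial>M)"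
      by (intro Bochner_Integration.integral_cong) (auto simp: blinfun.diff_right m_def power2_eq_square algebra_simps)
    also have "\<dots> = (\<integral>\<omega>. (blinfun_apply f (trunc a (X \<omega>)))\<^sup>2 \<partial>M) - 2 * m * m + m\<^sup>2"
      using fsq_int[OF f a] i1 by (simp add: e1 m_def prob_space)
    also have "\<dots> \<le> (\<integral>\<omega>. (blinfun_apply f (trunc a (X \<omega>)))\<^sup>2 \<partial>M)" by (simp add: power2_eq_square)
    also have "\<dots> \<le> H a" by (rule H_ge[OF f a])
    finally show "(\<integral>y. (blinfun_apply f y)\<^sup>2 \<partial>NN a) \<le> H a" .
  qed
qed

lemma ctrunc_iid:
  assumes a: "a \<ge> 0" and v: "H a \<le> v" and I: "finite I" "I \<subseteq> {1..}"
  shows "iid_sum M (NN a) (2 * a) v (ctrunc a) I"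
proof -
  interpret N: bdd_centered "NN a" "2 * a" "H a" by (rule NN_centered[OF a])
  show ?thesis
  proof (intro iid_sum.intro iid_sum_axioms.intro bdd_centered.intro bdd_centered_axioms.intro)
    show "prob_space M" by (rule prob_space_axioms)
    show "bdd_law (NN a) (2 * a)" ..
    show "(\<integral>y. y \<partial>NN a) = 0" by (rule N.mean)
    show "(\<integral>y. (blinfun_apply f y)\<^sup>2 \<partial>NN a) \<le> v" if "norm f \<le> 1" for f :: "'b \<Rightarrow>\<^sub>L real"
      using N.weak_var[OF that] v by simp
    show "finite I" by fact
    have "indep_vars (\<lambda>_. borel) (\<lambda>i \<omega>. (\<lambda>x. trunc a x - mu a) (Xs i \<omega>)) I"
      by (rule indep_vars_compose2[OF indep_vars_subset[OF Xs_indep I(2)]]) simp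
    then show "indep_vars (\<lambda>_. borel) (ctrunc a) I" by (simp add: ctrunc_def[abs_def])
    fix i assume "i \<in> I"
    then have i: "i \<ge> 1" using I by auto
    note [measurable] = Xs_meas[OF i]
    have "distr M borel (ctrunc a i) = distr (distr M borel (Xs i)) borel (\<lambda>x. trunc a x - mu a)"
      by (subst distr_distr) (auto simp: comp_def ctrunc_def[abs_def])
    also have "\<dots> = NN a" unfolding Xs_law[OF i] NN_def by (subst distr_distr) (auto simp: comp_def)
    finally show "distr M borel (ctrunc a i) = NN a" .
  qed
qed

section \<open>Partial sums: concentration of the norm in the mean\<close>

definition S :: "nat \<Rightarrow> 'a \<Rightarrow> 'b" where "S n \<omega> = (\<Sum>i\<in>{1..n}. Xs i \<omega>)"

lemma S_meas[measurable]: "S n \<in> borel_measurable M"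
  unfolding S_def using Xs_meas by (intro borel_measurable_sum) auto

lemma Xs_int: "i \<ge> 1 \<Longrightarrow> integrable M (Xs i)"
  using integrable_Xs[of i norm] X_int Xs_meas[of i]
  by (simp add: integrable_norm_iff)

lemma S_int: "integrable M (S n)"
  unfolding S_def using Xs_int by (intro Bochner_Integration.integrable_sum) auto

text \<open>Each summand costs \<open>R a\<close> twice: once for the discarded part and once for
  the centering \<open>mu a\<close>.\<close>

lemma S_ctrunc_diff:
  assumes a: "a \<ge> 0"
  shows "(\<integral>\<omega>. norm (S n \<omega> - (\<Sum>i\<in>{1..n}. ctrunc a i \<omega>)) \<partial>M) \<le> 2 * (real n * R a)"
    and "integrable M (\<lambda>\<omega>. norm (S n \<omega> - (\<Sum>i\<in>{1..n}. ctrunc a i \<omega>)))"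
    and "integrable M (\<lambda>\<omega>. norm (\<Sum>i\<in>{1..n}. ctrunc a i \<omega>))"
proof -
  have Yi: "integrable M (ctrunc a i)" if i: "i \<ge> 1" for i
  proof -
    note [measurable] = Xs_meas[OF i]
    have "integrable M (\<lambda>\<omega>. trunc a (Xs i \<omega>))"
      using norm_trunc[OF a] by (intro integrable_const_bound[of _ a]) auto
    then show ?thesis unfolding ctrunc_def[abs_def] by simp
  qed
  have Si: "integrable M (\<lambda>\<omega>. \<Sum>i\<in>{1..n}. ctrunc a i \<omega>)"
    using Yi by (intro Bochner_Integration.integrable_sum) auto
  show "integrable M (\<lambda>\<omega>. norm (\<Sum>i\<in>{1..n}. ctrunc a i \<omega>))" using Si by (rule integrable_norm)
  show i2: "integrable M (\<lambda>\<omega>. norm (S n \<omega> - (\<Sum>i\<in>{1..n}. ctrunc a i \<omega>)))"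
    using Si S_int by (intro integrable_norm Bochner_Integration.integrable_diff)
  have hm: "(\<lambda>x::'b. if norm x \<le> a then 0 else norm x) \<in> borel_measurable borel" by measurable
  have hi: "integrable M (\<lambda>\<omega>. if norm (Xs i \<omega>) \<le> a then 0 else norm (Xs i \<omega>))"
    and he: "(\<integral>\<omega>. (if norm (Xs i \<omega>) \<le> a then 0 else norm (Xs i \<omega>)) \<partial>M) = R a" if "i \<ge> 1" for i
    using integrable_Xs[OF that hm] expectation_Xs[OF that hm] R_integrable by (simp_all add: R_def)
  have "(\<integral>\<omega>. norm (S n \<omega> - (\<Sum>i\<in>{1..n}. ctrunc a i \<omega>)) \<partial>M)
     \<le> (\<integral>\<omega>. (\<Sum>i\<in>{1..n}. (if norm (Xs i \<omega>) \<le> a then 0 else norm (Xs i \<omega>)) + R a) \<partial>M)"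
  proof (rule integral_mono[OF i2])
    show "integrable M (\<lambda>\<omega>. \<Sum>i\<in>{1..n}. (if norm (Xs i \<omega>) \<le> a then 0 else norm (Xs i \<omega>)) + R a)"
      using hi by (intro Bochner_Integration.integrable_sum Bochner_Integration.integrable_add) auto
    fix \<omega>
    have "S n \<omega> - (\<Sum>i\<in>{1..n}. ctrunc a i \<omega>) = (\<Sum>i\<in>{1..n}. (Xs i \<omega> - trunc a (Xs i \<omega>)) + mu a)"
      by (simp add: S_def ctrunc_def sum_subtractf sum.distrib algebra_simps)
    also have "norm \<dots> \<le> (\<Sum>i\<in>{1..n}. norm ((Xs i \<omega> - trunc a (Xs i \<omega>)) + mu a))" by (rule norm_sum)
    also have "\<dots> \<le> (\<Sum>i\<in>{1..n}. (if norm (Xs i \<omega>) \<le> a then 0 else norm (Xs i \<omega>)) + R a)"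
    proof (rule sum_mono)
      fix i
      show "norm ((Xs i \<omega> - trunc a (Xs i \<omega>)) + mu a) \<le> (if norm (Xs i \<omega>) \<le> a then 0 else norm (Xs i \<omega>)) + R a"
        unfolding norm_diff_trunc[symmetric] using norm_mu_R[of a] norm_triangle_ineq by (meson add_left_mono order_trans)
    qed
    finally show "norm (S n \<omega> - (\<Sum>i\<in>{1..n}. ctrunc a i \<omega>)) \<le> (\<Sum>i\<in>{1..n}. (if norm (Xs i \<omega>) \<le> a then 0 else norm (Xs i \<omega>)) + R a)" .
  qed
  also have "\<dots> = (\<Sum>i\<in>{1..n}. R a + R a)"
    using hi he by (subst Bochner_Integration.integral_sum) (auto simp: prob_space)
  finally show "(\<integral>\<omega>. norm (S n \<omega> - (\<Sum>i\<in>{1..n}. ctrunc a i \<omega>)) \<partial>M) \<le> 2 * (real n * R a)" by simp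
qed

lemma E_ctrunc_le:
  assumes a: "a \<ge> 0"
  shows "(\<integral>\<omega>. norm (\<Sum>i\<in>{1..n}. ctrunc a i \<omega>) \<partial>M) \<le> (\<integral>\<omega>. norm (S n \<omega>) \<partial>M) + 2 * (real n * R a)"
proof -
  have "(\<integral>\<omega>. norm (\<Sum>i\<in>{1..n}. ctrunc a i \<omega>) \<partial>M) \<le> (\<integral>\<omega>. norm (S n \<omega>) + norm (S n \<omega> - (\<Sum>i\<in>{1..n}. ctrunc a i \<omega>)) \<partial>M)"
  proof (rule integral_mono[OF S_ctrunc_diff(3)[OF a]])
    show "integrable M (\<lambda>\<omega>. norm (S n \<omega>) + norm (S n \<omega> - (\<Sum>i\<in>{1..n}. ctrunc a i \<omega>)))"
      by (intro Bochner_Integration.integrable_add integrable_norm[OF S_int] S_ctrunc_diff(2)[OF a])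
    fix \<omega>
    show "norm (\<Sum>i\<in>{1..n}. ctrunc a i \<omega>) \<le> norm (S n \<omega>) + norm (S n \<omega> - (\<Sum>i\<in>{1..n}. ctrunc a i \<omega>))"
      using norm_triangle_sub[of "\<Sum>i\<in>{1..n}. ctrunc a i \<omega>" "S n \<omega>"] by (simp add: norm_minus_commute)
  qed
  also have "\<dots> = (\<integral>\<omega>. norm (S n \<omega>) \<partial>M) + (\<integral>\<omega>. norm (S n \<omega> - (\<Sum>i\<in>{1..n}. ctrunc a i \<omega>)) \<partial>M)"
    by (intro Bochner_Integration.integral_add integrable_norm[OF S_int] S_ctrunc_diff(2)[OF a])
  also have "\<dots> \<le> (\<integral>\<omega>. norm (S n \<omega>) \<partial>M) + 2 * (real n * R a)" using S_ctrunc_diff(1)[OF a] by simp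
  finally show ?thesis .
qed

text \<open>The mean deviation is at most the standard deviation, which
  \<open>variance_lipschitz\<close> bounds for the norm. The factor \<open>4\<close> is the price of
  centering: \<open>(x + y)\<^sup>2 <= 2 * x\<^sup>2 + 2 * y\<^sup>2\<close> together with Jensen's
  inequality for \<open>mu\<close>.\<close>

lemma norm_sum_variance:
  assumes n: "n \<ge> 1"
  shows "(\<integral>\<omega>. \<bar>norm (\<Sum>i\<in>{1..n}. ctrunc (c n) i \<omega>) - (\<integral>\<omega>. norm (\<Sum>i\<in>{1..n}. ctrunc (c n) i \<omega>) \<partial>M)\<bar> \<partial>M)
    \<le> sqrt (real n * (4 * ((c n)\<^sup>2 * (\<integral>\<omega>. (u n \<omega>)\<^sup>2 \<partial>M))))"
proof -
  define a where "a = c n"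
  have a: "a \<ge> 0" using c_pos[OF n] by (simp add: a_def)
  interpret I: iid_sum M "NN a" "2 * a" "H a" "ctrunc a" "{1..n}"
    by (rule ctrunc_iid[OF a]) auto
  define Z where "Z \<omega> = norm (\<Sum>i\<in>{1..n}. ctrunc a i \<omega>)" for \<omega>
  define e where "e = (\<integral>\<omega>. Z \<omega> \<partial>M)"
  have Zi: "integrable M Z" unfolding Z_def by (rule S_ctrunc_diff(3)[OF a])
  have l2: "locally_bdd (\<lambda>s::'b. (norm s)\<^sup>2)"
    by (intro locally_bdd_continuous_norm[of "\<lambda>x. x\<^sup>2"] continuous_intros)
  have Z2i: "integrable M (\<lambda>\<omega>. (Z \<omega>)\<^sup>2)"
    using I.integrable_fun_sum[OF subset_refl l2, of 0] by (simp add: Z_def)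
  have Z2: "(\<integral>\<omega>. (Z \<omega>)\<^sup>2 \<partial>M) = (I.N.T ^^ n) (\<lambda>s. (norm s)\<^sup>2) 0"
    using I.expectation_fun_sum[OF subset_refl l2, of 0] by (simp add: Z_def)
  have Z1: "e = (I.N.T ^^ n) norm 0"
    using I.expectation_fun_sum[OF subset_refl I.N.locally_bdd_norm, of 0] by (simp add: Z_def e_def)
  have var: "(\<integral>\<omega>. (Z \<omega>)\<^sup>2 \<partial>M) - e\<^sup>2 \<le> real n * (\<integral>y. (norm y)\<^sup>2 \<partial>NN a)"
    unfolding Z1 Z2 by (rule I.N.variance_lipschitz) (rule norm_triangle_ineq3)
  have sqi: "integrable M (\<lambda>\<omega>. (norm (trunc a (X \<omega>)))\<^sup>2)"
    using norm_trunc[of a] a by (intro integrable_const_bound[of _ "a\<^sup>2"]) (auto intro!: AE_I2 power_mono)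
  define q where "q = (\<integral>\<omega>. (norm (trunc a (X \<omega>)))\<^sup>2 \<partial>M)"
  have jen: "(norm (mu a))\<^sup>2 \<le> q"
  proof -
    define m where "m = norm (mu a)"
    have i: "integrable M (\<lambda>\<omega>. norm (trunc a (X \<omega>)))" by (rule integrable_norm[OF trunc_int])
    have "m \<le> (\<integral>\<omega>. norm (trunc a (X \<omega>)) \<partial>M)" unfolding m_def mu_def by (rule integral_norm_bound)
    then have "2 * m * m \<le> 2 * m * (\<integral>\<omega>. norm (trunc a (X \<omega>)) \<partial>M)" by (intro mult_left_mono) (auto simp: m_def)
    also have "\<dots> = (\<integral>\<omega>. 2 * m * norm (trunc a (X \<omega>)) \<partial>M)" by simp
    also have "\<dots> \<le> (\<integral>\<omega>. (norm (trunc a (X \<omega>)))\<^sup>2 + m\<^sup>2 \<partial>M)"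
    proof (rule integral_mono)
      fix \<omega>
      have "0 \<le> (norm (trunc a (X \<omega>)) - m)\<^sup>2" by simp
      then show "2 * m * norm (trunc a (X \<omega>)) \<le> (norm (trunc a (X \<omega>)))\<^sup>2 + m\<^sup>2"
        by (simp add: power2_eq_square algebra_simps)
    qed (use i sqi in auto)
    also have "\<dots> = q + m\<^sup>2" using sqi by (simp add: q_def prob_space)
    finally show ?thesis by (simp add: m_def power2_eq_square)
  qed
  have "(\<integral>y. (norm y)\<^sup>2 \<partial>NN a) = (\<integral>\<omega>. (norm (trunc a (X \<omega>) - mu a))\<^sup>2 \<partial>M)"
    unfolding NN_def by (subst integral_distr) auto
  also have "\<dots> \<le> (\<integral>\<omega>. 2 * (norm (trunc a (X \<omega>)))\<^sup>2 + 2 * (norm (mu a))\<^sup>2 \<partial>M)"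
  proof (rule integral_mono)
    have "norm (trunc a x - mu a) \<le> 2 * a" for x
      using norm_triangle_ineq4[of "trunc a x" "mu a"] norm_trunc[OF a, of x] norm_mu_le[OF a] by linarith
    then have "(norm (trunc a x - mu a))\<^sup>2 \<le> (2 * a)\<^sup>2" for x by (intro power_mono) auto
    then show "integrable M (\<lambda>\<omega>. (norm (trunc a (X \<omega>) - mu a))\<^sup>2)"
      by (intro integrable_const_bound[of _ "(2 * a)\<^sup>2"]) auto
    fix \<omega>
    define x y where "x = norm (trunc a (X \<omega>))" and "y = norm (mu a)"
    have "(norm (trunc a (X \<omega>) - mu a))\<^sup>2 \<le> (x + y)\<^sup>2"
      unfolding x_def y_def by (intro power_mono norm_triangle_ineq4) auto
    also have "\<dots> \<le> 2 * x\<^sup>2 + 2 * y\<^sup>2"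
      using zero_le_power2[of "x - y"] by (simp add: power2_eq_square algebra_simps)
    finally show "(norm (trunc a (X \<omega>) - mu a))\<^sup>2 \<le> 2 * (norm (trunc a (X \<omega>)))\<^sup>2 + 2 * (norm (mu a))\<^sup>2"
      by (simp add: x_def y_def)
  qed (use sqi in auto)
  also have "\<dots> = 2 * q + 2 * (norm (mu a))\<^sup>2" using sqi by (simp add: q_def prob_space)
  also have "\<dots> \<le> 4 * q" using jen by simp
  also have "\<dots> \<le> 4 * ((c n)\<^sup>2 * (\<integral>\<omega>. (u n \<omega>)\<^sup>2 \<partial>M))" using norm_trunc_sq_le[OF n] by (simp add: q_def a_def)
  finally have tau: "(\<integral>y. (norm y)\<^sup>2 \<partial>NN a) \<le> 4 * ((c n)\<^sup>2 * (\<integral>\<omega>. (u n \<omega>)\<^sup>2 \<partial>M))" .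
  define d where "d = (\<integral>\<omega>. \<bar>Z \<omega> - e\<bar> \<partial>M)"
  have di: "integrable M (\<lambda>\<omega>. (Z \<omega> - e)\<^sup>2)"
    using Zi Z2i by (simp add: power2_diff)
  \<comment> \<open>Integrating
    \<open>2 * d * \<bar>Z - e\<bar> <= (Z - e)\<^sup>2 + d\<^sup>2\<close> bounds
    \<open>d\<^sup>2\<close> by the variance of \<open>Z\<close>, in place of Cauchy--Schwarz;
    Jensen's inequality above is obtained in the same way.\<close>
  have "2 * d * d = (\<integral>\<omega>. 2 * d * \<bar>Z \<omega> - e\<bar> \<partial>M)" by (simp add: d_def)
  also have "\<dots> \<le> (\<integral>\<omega>. (Z \<omega> - e)\<^sup>2 + d\<^sup>2 \<partial>M)"
  proof (rule integral_mono)
    fix \<omega>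
    have "0 \<le> (\<bar>Z \<omega> - e\<bar> - d)\<^sup>2" by simp
    also have "\<dots> = (Z \<omega> - e)\<^sup>2 - 2 * d * \<bar>Z \<omega> - e\<bar> + d\<^sup>2" by (simp only: power2_diff power2_abs) simp
    finally show "2 * d * \<bar>Z \<omega> - e\<bar> \<le> (Z \<omega> - e)\<^sup>2 + d\<^sup>2" by simp
  qed (use Zi di in auto)
  also have "\<dots> = (\<integral>\<omega>. (Z \<omega> - e)\<^sup>2 \<partial>M) + d\<^sup>2" using di by (simp add: prob_space)
  also have "(\<integral>\<omega>. (Z \<omega> - e)\<^sup>2 \<partial>M) = (\<integral>\<omega>. (Z \<omega>)\<^sup>2 \<partial>M) - e\<^sup>2"
    unfolding power2_diff using Zi Z2i by (simp add: e_def[symmetric] prob_space power2_eq_square)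
  finally have "d\<^sup>2 \<le> real n * (\<integral>y. (norm y)\<^sup>2 \<partial>NN a)" using var by (simp add: power2_eq_square)
  also have "\<dots> \<le> real n * (4 * ((c n)\<^sup>2 * (\<integral>\<omega>. (u n \<omega>)\<^sup>2 \<partial>M)))" by (intro mult_left_mono tau) auto
  finally have "d \<le> sqrt (real n * (4 * ((c n)\<^sup>2 * (\<integral>\<omega>. (u n \<omega>)\<^sup>2 \<partial>M))))" by (rule real_le_rsqrt)
  then show ?thesis by (simp add: d_def e_def Z_def a_def)
qed

lemma norm_S_concentration:
  "(\<lambda>n. (\<integral>\<omega>. \<bar>norm (S n \<omega>) / c n - (\<integral>\<omega>. norm (S n \<omega>) \<partial>M) / c n\<bar> \<partial>M)) \<longlonglongrightarrow> 0"
proof -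
  \<comment> \<open>Truncation is paid for twice, pathwise and in the mean, each time with
    \<open>2 * n * R (c n)\<close>; the square root is the deviation of the truncated sum.\<close>
  define B where "B n = 4 * (real n * R (c n) / c n) + sqrt (4 * (real n * (\<integral>\<omega>. (u n \<omega>)\<^sup>2 \<partial>M)))" for n
  have "(\<lambda>n. B n) \<longlonglongrightarrow> 4 * 0 + sqrt (4 * 0)"
    unfolding B_def by (intro tendsto_intros R_tendsto second_moment_tendsto)
  then have B0: "B \<longlonglongrightarrow> 0" by simp
  show ?thesis
  proof (rule tendsto_sandwich[OF _ _ tendsto_const B0])
    show "\<forall>\<^sub>F n in sequentially. 0 \<le> (\<integral>\<omega>. \<bar>norm (S n \<omega>) / c n - (\<integral>\<omega>. norm (S n \<omega>) \<partial>M) / c n\<bar> \<partial>M)" by simp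
    show "\<forall>\<^sub>F n in sequentially. (\<integral>\<omega>. \<bar>norm (S n \<omega>) / c n - (\<integral>\<omega>. norm (S n \<omega>) \<partial>M) / c n\<bar> \<partial>M) \<le> B n"
      using eventually_ge_at_top[of 1]
    proof eventually_elim
      case (elim n)
      have cn: "c n > 0" by (rule c_pos[OF elim])
      then have a: "c n \<ge> 0" by simp
      define Z where "Z \<omega> = norm (\<Sum>i\<in>{1..n}. ctrunc (c n) i \<omega>)" for \<omega>
      define D where "D \<omega> = norm (S n \<omega> - (\<Sum>i\<in>{1..n}. ctrunc (c n) i \<omega>))" for \<omega>
      define eS eZ where "eS = (\<integral>\<omega>. norm (S n \<omega>) \<partial>M)" and "eZ = (\<integral>\<omega>. Z \<omega> \<partial>M)"
      have iZ: "integrable M Z" and iD: "integrable M D"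
        unfolding Z_def D_def using S_ctrunc_diff[OF a] by auto
      have iS: "integrable M (\<lambda>\<omega>. norm (S n \<omega>))" by (rule integrable_norm[OF S_int])
      have ED: "(\<integral>\<omega>. D \<omega> \<partial>M) \<le> 2 * (real n * R (c n))" unfolding D_def by (rule S_ctrunc_diff(1)[OF a])
      have pt: "\<bar>norm (S n \<omega>) - Z \<omega>\<bar> \<le> D \<omega>" for \<omega>
        unfolding Z_def D_def by (rule norm_triangle_ineq3)
      have "\<bar>eS - eZ\<bar> = \<bar>\<integral>\<omega>. norm (S n \<omega>) - Z \<omega> \<partial>M\<bar>" unfolding eS_def eZ_def using iZ iS by simp
      also have "\<dots> \<le> (\<integral>\<omega>. \<bar>norm (S n \<omega>) - Z \<omega>\<bar> \<partial>M)" by (rule integral_abs_bound)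
      also have "\<dots> \<le> (\<integral>\<omega>. D \<omega> \<partial>M)" by (rule integral_mono) (use iZ iS iD pt in auto)
      finally have ee: "\<bar>eS - eZ\<bar> \<le> 2 * (real n * R (c n))" using ED by simp
      have "(\<integral>\<omega>. \<bar>norm (S n \<omega>) - eS\<bar> \<partial>M) \<le> (\<integral>\<omega>. D \<omega> + \<bar>Z \<omega> - eZ\<bar> + \<bar>eS - eZ\<bar> \<partial>M)"
      proof (rule integral_mono)
        fix \<omega>
        show "\<bar>norm (S n \<omega>) - eS\<bar> \<le> D \<omega> + \<bar>Z \<omega> - eZ\<bar> + \<bar>eS - eZ\<bar>" using pt[of \<omega>] by linarith
      qed (use iZ iS iD in auto)
      also have "\<dots> = (\<integral>\<omega>. D \<omega> \<partial>M) + (\<integral>\<omega>. \<bar>Z \<omega> - eZ\<bar> \<partial>M) + \<bar>eS - eZ\<bar>"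
        using iZ iD by (simp add: prob_space)
      also have "\<dots> \<le> 2 * (real n * R (c n)) + sqrt (real n * (4 * ((c n)\<^sup>2 * (\<integral>\<omega>. (u n \<omega>)\<^sup>2 \<partial>M)))) + 2 * (real n * R (c n))"
        using ED ee norm_sum_variance[OF elim] unfolding eZ_def Z_def by linarith
      also have "\<dots> = 4 * (real n * R (c n)) + c n * sqrt (4 * (real n * (\<integral>\<omega>. (u n \<omega>)\<^sup>2 \<partial>M)))"
      proof -
        have "real n * (4 * ((c n)\<^sup>2 * (\<integral>\<omega>. (u n \<omega>)\<^sup>2 \<partial>M))) = (c n)\<^sup>2 * (4 * (real n * (\<integral>\<omega>. (u n \<omega>)\<^sup>2 \<partial>M)))" by simp
        then show ?thesis using cn by (simp only: real_sqrt_mult[of "(c n)\<^sup>2"]) simp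
      qed
      finally have main: "(\<integral>\<omega>. \<bar>norm (S n \<omega>) - eS\<bar> \<partial>M) \<le> 4 * (real n * R (c n)) + c n * sqrt (4 * (real n * (\<integral>\<omega>. (u n \<omega>)\<^sup>2 \<partial>M)))" .
      have "(\<integral>\<omega>. \<bar>norm (S n \<omega>) / c n - eS / c n\<bar> \<partial>M) = (\<integral>\<omega>. \<bar>norm (S n \<omega>) - eS\<bar> / c n \<partial>M)"
        using cn by (intro Bochner_Integration.integral_cong) (auto simp: diff_divide_distrib[symmetric])
      also have "\<dots> = (\<integral>\<omega>. \<bar>norm (S n \<omega>) - eS\<bar> \<partial>M) / c n" by simp
      also have "\<dots> \<le> (4 * (real n * R (c n)) + c n * sqrt (4 * (real n * (\<integral>\<omega>. (u n \<omega>)\<^sup>2 \<partial>M)))) / c n"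
        using main cn by (intro divide_right_mono) auto
      also have "\<dots> = B n" using cn by (simp add: B_def add_divide_distrib)
      finally show ?case by (simp add: eS_def)
    qed
  qed
qed

lemma beta_lower:
  "AE \<omega> in M. limsup (\<lambda>n. ereal ((\<integral>\<omega>. norm (S n \<omega>) \<partial>M) / c n)) \<le> limsup (\<lambda>n. ereal (norm (S n \<omega>) / c n))"
proof -
  define e where "e n = (\<integral>\<omega>. norm (S n \<omega>) \<partial>M) / c n" for n
  define W where "W n \<omega> = norm (S n \<omega>) / c n - e n" for n \<omega>
  obtain r where r: "strict_mono r" "((\<lambda>n. ereal (e n)) \<circ> r) \<longlonglongrightarrow> limsup (\<lambda>n. ereal (e n))"
    using limsup_subseq_lim[of "\<lambda>n. ereal (e n)"] by auto
  have "(\<lambda>n. (\<integral>\<omega>. norm (W n \<omega>) \<partial>M)) \<longlonglongrightarrow> 0"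
    using norm_S_concentration by (simp add: W_def e_def)
  then have L: "(\<lambda>n. (\<integral>\<omega>. norm (W (r n) \<omega>) \<partial>M)) \<longlonglongrightarrow> 0"
    using LIMSEQ_subseq_LIMSEQ[OF _ r(1)] by (auto simp: comp_def)
  have Wi: "integrable M (W n)" for n
    unfolding W_def using integrable_norm[OF S_int] by auto
  obtain s where s: "strict_mono s" "AE \<omega> in M. (\<lambda>n. W (r (s n)) \<omega>) \<longlonglongrightarrow> 0"
    using tendsto_L1_AE_subseq[of M "\<lambda>n. W (r n)", OF Wi L] by auto
  show ?thesis using s(2)
  proof eventually_elim
    case (elim \<omega>)
    have rs: "strict_mono (r \<circ> s)" using r(1) s(1) by (rule strict_mono_o)
    have A: "((\<lambda>n. ereal (e n)) \<circ> r \<circ> s) \<longlonglongrightarrow> limsup (\<lambda>n. ereal (e n))"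
      by (rule LIMSEQ_subseq_LIMSEQ[OF r(2) s(1)])
    have B: "(\<lambda>n. ereal (W (r (s n)) \<omega>)) \<longlonglongrightarrow> ereal 0" using elim by simp
    have "(\<lambda>n. ereal (W (r (s n)) \<omega>) + ((\<lambda>n. ereal (e n)) \<circ> r \<circ> s) n) \<longlonglongrightarrow> ereal 0 + limsup (\<lambda>n. ereal (e n))"
      by (rule tendsto_add_ereal_general2[OF _ B A]) simp
    then have "((\<lambda>n. ereal (norm (S n \<omega>) / c n)) \<circ> (r \<circ> s)) \<longlonglongrightarrow> limsup (\<lambda>n. ereal (e n))"
      by (simp add: W_def comp_def zero_ereal_def[symmetric])
    then have "limsup ((\<lambda>n. ereal (norm (S n \<omega>) / c n)) \<circ> (r \<circ> s)) = limsup (\<lambda>n. ereal (e n))"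
      by (rule lim_imp_Limsup[OF sequentially_bot])
    with limsup_subseq_mono[OF rs, of "\<lambda>n. ereal (norm (S n \<omega>) / c n)"]
    show ?case by (simp add: e_def)
  qed
qed

end

subsection \<open>The upper bound\<close>

text \<open>Only a lower bound on the ratios is built in. The upper bound takes \<open>r\<close>
  near \<open>1\<close> and adds an upper bound on the ratios; the lower bound takes
  \<open>r\<close> large, with irregular gaps.\<close>

locale lil_geom = lil_setup M X Xs c
  for M :: "'a measure" and X :: "'a \<Rightarrow> 'b::{banach,second_countable_topology}" and Xs c +
  fixes m :: "nat \<Rightarrow> nat" and r :: real
  assumes r: "r > 1" and m0: "m 0 \<ge> 1" and m_step: "\<And>k. r * real (m k) \<le> real (m (Suc k))"
begin

lemmas m_ge1 = geom_ge1[OF r m0 m_step]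

lemma m_strict: "strict_mono m"
proof (rule strict_monoI_Suc)
  fix k
  have "1 * real (m k) < r * real (m k)" using r m_ge1[of k] by (intro mult_strict_right_mono) auto
  then show "m k < m (Suc k)" using m_step[of k] by linarith
qed

lemma m_tendsto: "filterlim m at_top sequentially"
  by (rule filterlim_subseq[OF m_strict])

lemma cm_pos: "c (m k) > 0" by (rule c_pos[OF m_ge1])

text \<open>Truncating at \<open>\<rho> k * c (m k)\<close> balances two requirements: the contribution of the truncation level to
  the tail bound, \<open>exp (- h / \<rho> k)\<close>, must be summable, and two jumps beyond that level among the
  first \<open>m k\<close> summands must have summable probability (at most \<open>\<gamma> k\<close>, given \<open>\<rho> k ^ 8 = \<gamma> k\<close>). The summand
  \<open>(1 / 2) ^ k\<close> only makes \<open>\<gamma> k\<close> positive.\<close>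

definition \<gamma> :: "nat \<Rightarrow> real" where "\<gamma> k = G (m k) + (1 / 2) ^ k"
definition \<rho> :: "nat \<Rightarrow> real" where "\<rho> k = min 1 (\<gamma> k powr (1 / 8))"
definition a :: "nat \<Rightarrow> real" where "a k = \<rho> k * c (m k)"

lemma \<gamma>_pos: "\<gamma> k > 0"
  unfolding \<gamma>_def using G_nonneg[OF m_ge1, of k] by (intro add_nonneg_pos) auto

lemma \<gamma>_summable: "summable \<gamma>"
  unfolding \<gamma>_def[abs_def] by (intro summable_add G_summable[OF r m0 m_step] summable_geometric) auto

lemma \<gamma>_tendsto: "\<gamma> \<longlonglongrightarrow> 0" by (rule summable_LIMSEQ_zero[OF \<gamma>_summable])

lemma \<rho>_pos: "\<rho> k > 0" using \<gamma>_pos[of k] by (auto simp: \<rho>_def)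
lemma \<rho>_le1: "\<rho> k \<le> 1" by (simp add: \<rho>_def)

lemma a_pos: "a k > 0" unfolding a_def by (intro mult_pos_pos \<rho>_pos cm_pos)
lemma a_le: "a k \<le> c (m k)" unfolding a_def using mult_right_mono[OF \<rho>_le1[of k] less_imp_le[OF cm_pos[of k]]] by simp

lemma powr_eighth_pow8: "x > 0 \<Longrightarrow> (x powr (1 / 8)) ^ 8 = (x::real)"
  by (simp add: powr_power)

lemma \<rho>_pow8: "\<rho> k ^ 8 \<le> \<gamma> k"
proof -
  have "\<rho> k ^ 8 \<le> (\<gamma> k powr (1 / 8)) ^ 8" using \<rho>_pos[of k] by (intro power_mono) (auto simp: \<rho>_def)
  then show ?thesis by (simp add: powr_eighth_pow8[OF \<gamma>_pos])
qed

lemma \<rho>_eventually: "\<forall>\<^sub>F k in sequentially. \<rho> k ^ 8 = \<gamma> k"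
proof -
  have "\<forall>\<^sub>F k in sequentially. \<gamma> k < 1" using \<gamma>_tendsto by (rule order_tendstoD) simp
  then show ?thesis
  proof eventually_elim
    case (elim k)
    have "\<gamma> k powr (1 / 8) \<le> 1 powr (1 / 8)" using elim \<gamma>_pos[of k] by (intro powr_mono2) auto
    then show ?case by (simp add: \<rho>_def powr_eighth_pow8[OF \<gamma>_pos])
  qed
qed

lemma \<rho>_tendsto: "\<rho> \<longlonglongrightarrow> 0"
proof (rule tendsto_sandwich[OF _ _ tendsto_const])
  have "(\<lambda>k. \<gamma> k powr (1 / 8)) \<longlonglongrightarrow> 0 powr (1 / 8)"
    by (rule tendsto_powr2[OF \<gamma>_tendsto tendsto_const]) (auto simp: less_imp_le[OF \<gamma>_pos])
  then show "(\<lambda>k. \<gamma> k powr (1 / 8)) \<longlonglongrightarrow> 0" by simp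
qed (auto simp: \<rho>_def less_imp_le[OF \<rho>_pos, unfolded \<rho>_def])

lemma G_le_\<gamma>: "G (m k) \<le> \<gamma> k" by (simp add: \<gamma>_def)

text \<open>\<open>G\<close> is eventually at most \<open>\<rho> ^ 8\<close>, so it may be divided
  by the powers of \<open>\<rho>\<close> that truncation costs, with a positive power to spare in
  each use.\<close>

lemma G_div: assumes "j \<le> 8"
  shows "\<forall>\<^sub>F k in sequentially. G (m k) / \<rho> k ^ j \<le> \<rho> k ^ (8 - j)"
  using \<rho>_eventually
proof eventually_elim
  case (elim k)
  have "G (m k) \<le> \<rho> k ^ (8 - j) * \<rho> k ^ j"
    using G_le_\<gamma>[of k] elim assms by (simp flip: power_add)
  then show ?case using \<rho>_pos[of k] by (simp add: pos_divide_le_eq)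
qed

lemma drift_tendsto: "(\<lambda>k. real (m k) * R (a k) / c (m k)) \<longlonglongrightarrow> 0"
proof (rule tendsto_sandwich[OF _ _ tendsto_const])
  have g3: "\<forall>\<^sub>F k in sequentially. G (m k) / \<rho> k ^ 3 \<le> \<rho> k ^ 5" using G_div[of 3] by simp
  show "\<forall>\<^sub>F k in sequentially. 0 \<le> real (m k) * R (a k) / c (m k)"
    using R_nonneg cm_pos by (intro always_eventually allI divide_nonneg_pos mult_nonneg_nonneg) auto
  have "(\<lambda>k. real (m k) * R (c (m k)) / c (m k)) \<longlonglongrightarrow> 0"
    using LIMSEQ_subseq_LIMSEQ[OF R_tendsto m_strict] by (simp add: comp_def)
  from tendsto_add[OF this tendsto_power[OF \<rho>_tendsto, of 5]]
  show "(\<lambda>k. real (m k) * R (c (m k)) / c (m k) + \<rho> k ^ 5) \<longlonglongrightarrow> 0" by simp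
  show "\<forall>\<^sub>F k in sequentially. real (m k) * R (a k) / c (m k) \<le> real (m k) * R (c (m k)) / c (m k) + \<rho> k ^ 5"
    using g3
  proof eventually_elim
    case (elim k)
    then show ?case using R_le_G[OF m_ge1 \<rho>_pos \<rho>_le1, of k k] by (simp add: a_def)
  qed
qed

definition bad :: "real \<Rightarrow> nat \<Rightarrow> 'a set" where
  "bad \<delta> k = (\<Union>i\<in>{1..m k}. {\<omega>\<in>space M. norm (Xs i \<omega>) > \<delta> * c (m k)})
     \<union> (\<Union>p\<in>{p\<in>{1..m k}\<times>{1..m k}. fst p \<noteq> snd p}. {\<omega>\<in>space M. norm (Xs (fst p) \<omega>) > a k \<and> norm (Xs (snd p) \<omega>) > a k})"

lemma Xs_gt_meas: "i \<ge> 1 \<Longrightarrow> {\<omega>\<in>space M. norm (Xs i \<omega>) > t} \<in> sets M"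
  using Xs_meas[of i] by measurable

lemma Xs_gt2_meas: "i \<ge> 1 \<Longrightarrow> j \<ge> 1 \<Longrightarrow> {\<omega>\<in>space M. norm (Xs i \<omega>) > t \<and> norm (Xs j \<omega>) > t} \<in> sets M"
  using Xs_meas[of i] Xs_meas[of j] by measurable

lemma prob_Xs_gt: "i \<ge> 1 \<Longrightarrow> prob {\<omega>\<in>space M. norm (Xs i \<omega>) > t} = prob {\<omega>\<in>space M. norm (X \<omega>) > t}"
  using prob_Xs[of i "{x. norm x > t}"] by simp

lemma prob_Xs_gt2:
  assumes i: "i \<ge> 1" "j \<ge> 1" "i \<noteq> j"
  shows "prob {\<omega>\<in>space M. norm (Xs i \<omega>) > t \<and> norm (Xs j \<omega>) > t} = (prob {\<omega>\<in>space M. norm (X \<omega>) > t})\<^sup>2"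
proof -
  have "prob (\<Inter>l\<in>{i, j}. Xs l -` {x. norm x > t} \<inter> space M) = (\<Prod>l\<in>{i, j}. prob (Xs l -` {x. norm x > t} \<inter> space M))"
    using i by (intro indep_varsD[OF Xs_indep]) auto
  moreover have "Xs l -` {x. norm x > t} \<inter> space M = {\<omega>\<in>space M. norm (Xs l \<omega>) > t}" for l by auto
  moreover have "(\<Inter>l\<in>{i, j}. {\<omega>\<in>space M. norm (Xs l \<omega>) > t}) = {\<omega>\<in>space M. norm (Xs i \<omega>) > t \<and> norm (Xs j \<omega>) > t}" by auto
  ultimately show ?thesis using i by (simp add: prob_Xs_gt power2_eq_square)
qed

lemma bad_meas: "bad \<delta> k \<in> sets M"
  unfolding bad_def by (intro sets.Un sets.finite_UN Xs_gt_meas Xs_gt2_meas) auto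

lemma bad_prob:
  assumes \<delta>: "0 < \<delta>" "\<delta> \<le> 1"
  shows "\<forall>\<^sub>F k in sequentially. prob (bad \<delta> k) \<le> G (m k) / \<delta> ^ 4 + \<gamma> k"
  using G_div[of 4, simplified] \<rho>_eventually
proof eventually_elim
  case (elim k)
  define n where "n = m k"
  define p where "p = prob {\<omega>\<in>space M. norm (X \<omega>) > a k}"
  have n: "n \<ge> 1" using m_ge1 by (simp add: n_def)
  have "prob (\<Union>i\<in>{1..n}. {\<omega>\<in>space M. norm (Xs i \<omega>) > \<delta> * c n})
      \<le> (\<Sum>i\<in>{1..n}. prob {\<omega>\<in>space M. norm (Xs i \<omega>) > \<delta> * c n})"
    by (rule finite_measure_subadditive_finite) (auto intro: Xs_gt_meas)
  also have "\<dots> = real n * prob {\<omega>\<in>space M. norm (X \<omega>) > \<delta> * c n}"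
    by (simp add: prob_Xs_gt)
  also have "\<dots> \<le> G n / \<delta> ^ 4" by (rule tail_le_G[OF n \<delta>])
  finally have 1: "prob (\<Union>i\<in>{1..n}. {\<omega>\<in>space M. norm (Xs i \<omega>) > \<delta> * c n}) \<le> G n / \<delta> ^ 4" .
  define I where "I = {p\<in>{1..n}\<times>{1..n}. fst p \<noteq> snd p}"
  have fI: "finite I" by (auto simp: I_def)
  have cI: "card I \<le> n * n"
    using card_mono[of "{1..n}\<times>{1..n}" I] by (auto simp: I_def card_cartesian_product)
  have "prob (\<Union>q\<in>I. {\<omega>\<in>space M. norm (Xs (fst q) \<omega>) > a k \<and> norm (Xs (snd q) \<omega>) > a k})
      \<le> (\<Sum>q\<in>I. prob {\<omega>\<in>space M. norm (Xs (fst q) \<omega>) > a k \<and> norm (Xs (snd q) \<omega>) > a k})"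
    by (rule finite_measure_subadditive_finite[OF fI]) (auto simp: I_def intro!: Xs_gt2_meas)
  also have "\<dots> = (\<Sum>q\<in>I. p\<^sup>2)"
    by (intro sum.cong refl) (auto simp: I_def p_def intro!: prob_Xs_gt2)
  also have "\<dots> \<le> real (n * n) * p\<^sup>2"
    using cI by (auto intro!: mult_right_mono simp flip: of_nat_mult)
  also have "\<dots> = (real n * p)\<^sup>2" by (simp add: power_mult_distrib power2_eq_square)
  \<comment> \<open>The expected number of jumps beyond the level is at most
    \<open>G / \<rho> ^ 4 <= \<rho> ^ 4\<close>; squared, for two jumps, this is
    \<open>\<rho> ^ 8\<close>, whence the exponent \<open>1 / 8\<close>.\<close>
  also have "\<dots> \<le> (\<rho> k ^ 4)\<^sup>2"
  proof (intro power_mono)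
    have "real n * p \<le> G n / \<rho> k ^ 4"
      unfolding p_def a_def n_def by (rule tail_le_G[OF m_ge1 \<rho>_pos \<rho>_le1])
    then show "real n * p \<le> \<rho> k ^ 4" using elim by (simp add: n_def)
    show "0 \<le> real n * p" by (simp add: p_def)
  qed
  also have "\<dots> = \<gamma> k" using elim by (simp flip: power_mult)
  finally have 2: "prob (\<Union>q\<in>I. {\<omega>\<in>space M. norm (Xs (fst q) \<omega>) > a k \<and> norm (Xs (snd q) \<omega>) > a k}) \<le> \<gamma> k" .
  have "prob (bad \<delta> k) \<le> prob (\<Union>i\<in>{1..n}. {\<omega>\<in>space M. norm (Xs i \<omega>) > \<delta> * c n})
     + prob (\<Union>q\<in>I. {\<omega>\<in>space M. norm (Xs (fst q) \<omega>) > a k \<and> norm (Xs (snd q) \<omega>) > a k})"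
    unfolding bad_def n_def[symmetric] I_def[symmetric]
    by (intro measure_Un_le sets.finite_UN fI Xs_gt_meas Xs_gt2_meas) (auto simp: I_def)
  with 1 2 show ?case by (simp add: n_def)
qed

text \<open>Both bounds use the uniformity in \<open>j\<close>: the upper one needs a maximum of
  partial sums, the lower one both ends of a block at the same truncation level.\<close>

lemma truncation_approx:
  assumes \<delta>: "0 < \<delta>" "\<delta> \<le> 1"
  shows "AE \<omega> in M. \<forall>\<^sub>F k in sequentially. \<forall>j\<le>m k. norm (S j \<omega> - (\<Sum>i\<in>{1..j}. trunc (a k) (Xs i \<omega>))) \<le> \<delta> * c (m k)"
proof -
  have "summable (\<lambda>k. G (m k) / \<delta> ^ 4 + \<gamma> k)"
    by (intro summable_add summable_divide G_summable[OF r m0 m_step] \<gamma>_summable)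
  then have "summable (\<lambda>k. prob (bad \<delta> k))"
    by (rule summable_comparison_test_ev[rotated]) (use bad_prob[OF \<delta>] in simp)
  then have "AE \<omega> in M. \<forall>\<^sub>F k in sequentially. \<omega> \<in> space M - bad \<delta> k"
    by (intro borel_cantelli_AE1 bad_meas) (auto simp: less_top[symmetric])
  then show ?thesis
  proof eventually_elim
    case (elim \<omega>)
    then show ?case
    proof eventually_elim
      case (elim k)
      show ?case
      proof (intro allI impI)
        fix j assume j: "j \<le> m k"
        define B where "B = {i\<in>{1..j}. norm (Xs i \<omega>) > a k}"
        have one: "i = i'" if "i \<in> B" "i' \<in> B" for i i'
        proof (rule ccontr)
          assume "i \<noteq> i'"
          then have "(i, i') \<in> {p\<in>{1..m k}\<times>{1..m k}. fst p \<noteq> snd p}" using that j by (auto simp: B_def)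
          then have "\<omega> \<in> bad \<delta> k" using that elim unfolding bad_def B_def by force
          then show False using elim by simp
        qed
        have small: "norm (Xs i \<omega>) \<le> \<delta> * c (m k)" if "i \<in> B" for i
          using elim that j unfolding bad_def B_def by (auto simp: not_less)
        have "S j \<omega> - (\<Sum>i\<in>{1..j}. trunc (a k) (Xs i \<omega>)) = (\<Sum>i\<in>{1..j}. if i \<in> B then Xs i \<omega> else 0)"
          unfolding S_def sum_subtractf[symmetric] by (intro sum.cong) (auto simp: trunc_def B_def)
        also have "\<dots> = (\<Sum>i\<in>B. Xs i \<omega>)"
          by (subst sum.inter_restrict[symmetric]) (auto simp: B_def intro!: sum.cong)
        finally have eq: "S j \<omega> - (\<Sum>i\<in>{1..j}. trunc (a k) (Xs i \<omega>)) = (\<Sum>i\<in>B. Xs i \<omega>)" .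
        show "norm (S j \<omega> - (\<Sum>i\<in>{1..j}. trunc (a k) (Xs i \<omega>))) \<le> \<delta> * c (m k)"
        proof (cases "B = {}")
          case True
          then show ?thesis using eq \<delta> cm_pos[of k] by simp
        next
          case False
          then obtain i where "i \<in> B" by auto
          with one have "B = {i}" by auto
          then show ?thesis using eq small[of i] by simp
        qed
      qed
    qed
  qed
qed

lemma block_index:
  assumes n: "m K \<le> n"
  obtains k where "K \<le> k" "m k \<le> n" "n < m (Suc k)"
proof -
  have ex: "\<exists>k. n < m k"
    using seq_suble[OF m_strict, of "Suc n"] by (intro exI[of _ "Suc n"]) simp
  define k where "k = (LEAST k. n < m k)"
  have k: "n < m k" unfolding k_def by (rule LeastI_ex[OF ex])
  have "K < k" using k n m_strict by (metis le_less_trans strict_mono_less)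
  then obtain k' where k': "k = Suc k'" "K \<le> k'" by (cases k) auto
  have "m k' \<le> n" using not_less_Least[of k' "\<lambda>k. n < m k"] k' by (simp add: k_def[symmetric])
  with k k' show thesis by (intro that) auto
qed

lemma sum_blocks:
  fixes f :: "nat \<Rightarrow> real"
  shows "(\<Sum>k<K. \<Sum>n\<in>{m k..<m (Suc k)}. f n) = (\<Sum>n\<in>{m 0..<m K}. f n)"
proof (induction K)
  case (Suc K)
  have "m 0 \<le> m K" "m K \<le> m (Suc K)" using m_strict by (auto simp: strict_mono_less_eq)
  then show ?case using Suc by (simp add: sum.atLeastLessThan_concat)
qed simp

text \<open>\<open>exp (- y) <= (8 / y) ^ 8\<close>, from \<open>y / 8 <= exp (y / 8)\<close>; at
  \<open>y = h / \<rho> k\<close> this is a multiple of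
  \<open>\<rho> k ^ 8 <= \<gamma> k\<close>.\<close>

lemma exp_rho_summable:
  assumes h: "h > 0" shows "summable (\<lambda>k. exp (- (h / \<rho> k)))"
proof (rule summable_comparison_test'[where g="\<lambda>k. (8 / h) ^ 8 * \<gamma> k" and N=0])
  show "summable (\<lambda>k. (8 / h) ^ 8 * \<gamma> k)" by (intro summable_mult \<gamma>_summable)
  fix k
  define y where "y = h / \<rho> k"
  have y: "y > 0" using h \<rho>_pos[of k] by (simp add: y_def)
  have "y / 8 \<le> exp (y / 8)" using exp_ge_add_one_self[of "y / 8"] by linarith
  then have "(y / 8) ^ 8 \<le> exp (y / 8) ^ 8" using y by (intro power_mono) auto
  also have "\<dots> = exp y" by (simp flip: exp_of_nat_mult)
  finally have "exp (- y) \<le> 1 / (y / 8) ^ 8" using y by (simp add: exp_minus divide_simps)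
  also have "\<dots> = (8 / h) ^ 8 * \<rho> k ^ 8" using h \<rho>_pos[of k] by (simp add: y_def power_divide field_simps)
  also have "\<dots> \<le> (8 / h) ^ 8 * \<gamma> k" using h by (intro mult_left_mono \<rho>_pow8) auto
  finally show "norm (exp (- (h / \<rho> k))) \<le> (8 / h) ^ 8 * \<gamma> k" by (simp add: y_def)
qed

lemma upper_blocks:
  assumes \<epsilon>: "0 < \<epsilon>" "\<epsilon> < 1"
    and r2: "r\<^sup>2 = 1 + \<epsilon>" and m_step2: "\<And>k. real (m (Suc k)) \<le> r\<^sup>2 * real (m k)"
    and growth: "\<And>i j. m 0 \<le> i \<Longrightarrow> i < j \<Longrightarrow> c j / c i \<le> (1 + \<epsilon>) * (real j / real i)"
    and \<alpha>: "\<alpha> > 0" "summable (\<lambda>n. alpha_term c H \<alpha> (Suc n))"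
    and \<beta>: "\<forall>\<^sub>F n in sequentially. (\<integral>\<omega>. norm (S n \<omega>) \<partial>M) / c n \<le> \<beta>"
  shows "AE \<omega> in M. limsup (\<lambda>n. ereal (norm (S n \<omega>) / c n))
    \<le> ereal ((1 + \<epsilon>)\<^sup>2 * ((1 + \<epsilon>) * (\<beta> + \<epsilon>) + (1 + \<epsilon>)\<^sup>2 * \<alpha> + 2 * \<epsilon>))"
proof -
  define \<kappa> where "\<kappa> = 1 + \<epsilon>"
  have k1: "\<kappa> > 1" using \<epsilon> by (simp add: \<kappa>_def)
  \<comment> \<open>Within a block \<open>(c n)\<^sup>2 / n\<close> may exceed its value at the left
    end by the factor \<open>\<kappa> ^ 3\<close>, and the tail bound loses one more
    \<open>\<kappa> = 1 + \<epsilon>\<close>; the factor \<open>\<kappa>\<^sup>2\<close>, squared in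
    the exponent, pays for exactly these four.\<close>
  define \<alpha>' where "\<alpha>' = \<kappa>\<^sup>2 * \<alpha>"
  have a': "\<alpha>' > 0" using k1 \<alpha> by (simp add: \<alpha>'_def)
  define e where "e k = (if H (c (m k)) = 0 then 0 else exp (- ((\<alpha>' * c (m k))\<^sup>2 / (2 * (1 + \<epsilon>) * (real (m k) * H (c (m k)))))))" for k
  have e0: "e k \<ge> 0" for k by (simp add: e_def)
  have at0: "alpha_term c H \<alpha> n \<ge> 0" for n by (simp add: alpha_term_def)
  \<comment> \<open>\<open>H (c n)\<close> is smallest at the left end of the block, so monotonicity
    of \<open>H\<close> acts in the right direction and the Gaussian term there is dominated
    throughout the block.\<close>
  have ek: "e k \<le> real n * alpha_term c H \<alpha> n" if n: "m k \<le> n" "n \<le> m (Suc k)" for k n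
  proof (cases "H (c (m k)) = 0")
    case True then show ?thesis using at0 by (simp add: e_def)
  next
    case False
    define N where "N = m k"
    have N: "N \<ge> 1" "real N > 0" "c N > 0" using m_ge1[of k] cm_pos[of k] by (auto simp: N_def)
    have nN: "N \<le> n" "n \<ge> 1" "real n > 0" using n N by (auto simp: N_def)
    have cn: "c n > 0" by (rule c_pos[OF nN(2)])
    have HN: "H (c N) > 0" using False H_nonneg[of "c N"] N by (simp add: N_def less_le)
    have Hle: "H (c N) \<le> H (c n)" using N nN by (intro H_mono c_mono) auto
    have Hn: "H (c n) > 0" using HN Hle by linarith
    have rat: "c n \<le> \<kappa> * (real n / real N) * c N"
    proof (cases "n = N")
      case True then show ?thesis using k1 N by simp
    next
      case F: False
      have "m 0 \<le> N" using m_strict by (simp add: N_def strict_mono_less_eq)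
      then have "c n / c N \<le> (1 + \<epsilon>) * (real n / real N)" using F nN by (intro growth) auto
      then show ?thesis using N by (simp add: pos_divide_le_eq \<kappa>_def)
    qed
    have nr: "real n / real N \<le> \<kappa>"
      using n(2) m_step2[of k] N(2) unfolding N_def r2 \<kappa>_def by (simp add: pos_divide_le_eq)
    have "(c n)\<^sup>2 \<le> (\<kappa> * (real n / real N) * c N)\<^sup>2" using rat cn by (intro power_mono) auto
    also have "\<dots> = \<kappa>\<^sup>2 * (real n / real N) * (real n / real N) * (c N)\<^sup>2" by (simp add: power_mult_distrib power2_eq_square mult_ac)
    also have "\<dots> \<le> \<kappa>\<^sup>2 * \<kappa> * (real n / real N) * (c N)\<^sup>2"
      using nr k1 by (intro mult_right_mono mult_left_mono) auto
    finally have "(c n)\<^sup>2 / real n \<le> (\<kappa>\<^sup>2 * \<kappa> * (real n / real N) * (c N)\<^sup>2) / real n" by (intro divide_right_mono) auto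
    also have "\<dots> = \<kappa>\<^sup>2 * \<kappa> * ((c N)\<^sup>2 / real N)" using nN by simp
    finally have cc: "(c n)\<^sup>2 / real n \<le> \<kappa>\<^sup>2 * \<kappa> * ((c N)\<^sup>2 / real N)" .
    have "\<alpha>\<^sup>2 * (c n)\<^sup>2 / (2 * real n * H (c n)) = \<alpha>\<^sup>2 / 2 * ((c n)\<^sup>2 / real n) / H (c n)" by simp
    also have "\<dots> \<le> \<alpha>\<^sup>2 / 2 * (\<kappa>\<^sup>2 * \<kappa> * ((c N)\<^sup>2 / real N)) / H (c N)"
      using cc Hle HN k1 by (intro frac_le mult_left_mono) (auto intro!: mult_nonneg_nonneg)
    also have "\<dots> = (\<alpha>' * c N)\<^sup>2 / (2 * (1 + \<epsilon>) * (real N * H (c N)))"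
      using k1 N HN by (simp add: \<alpha>'_def \<kappa>_def[symmetric] power_mult_distrib power2_eq_square mult_ac)
    finally have "exp (- ((\<alpha>' * c N)\<^sup>2 / (2 * (1 + \<epsilon>) * (real N * H (c N))))) \<le> exp (- (\<alpha>\<^sup>2 * (c n)\<^sup>2 / (2 * real n * H (c n))))"
      by simp
    then show ?thesis using False Hn nN by (simp add: e_def N_def alpha_term_def)
  qed
  have es: "summable e"
  proof (rule summableI_nonneg_bounded[OF e0])
    fix K
    \<comment> \<open>A lower bound for the length of a block relative to its right end, so that the
      part of the series within the block is at least \<open>q * e k\<close>.\<close>
    define q where "q = 1 - 1 / r"
    have q: "q > 0" using r by (simp add: q_def)
    have blk: "q * e k \<le> (\<Sum>n\<in>{m k..<m (Suc k)}. alpha_term c H \<alpha> (Suc n))" for k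
    proof -
      have mp: "real (m (Suc k)) > 0" using m_ge1[of "Suc k"] by simp
      have lt: "m k \<le> m (Suc k)" using m_strict by (simp add: strict_mono_less_eq)
      have "real (m k) / real (m (Suc k)) \<le> 1 / r" using m_step[of k] r mp by (simp add: field_simps)
      then have "q \<le> real (m (Suc k) - m k) / real (m (Suc k))"
        using lt mp by (simp add: q_def of_nat_diff diff_divide_distrib)
      then have "q * e k \<le> real (m (Suc k) - m k) / real (m (Suc k)) * e k" using e0 by (intro mult_right_mono)
      also have "\<dots> = (\<Sum>n\<in>{m k..<m (Suc k)}. e k / real (m (Suc k)))" by simp
      also have "\<dots> \<le> (\<Sum>n\<in>{m k..<m (Suc k)}. alpha_term c H \<alpha> (Suc n))"
      proof (rule sum_mono)
        fix n assume n: "n \<in> {m k..<m (Suc k)}"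
        have "e k / real (m (Suc k)) \<le> e k / real (Suc n)"
          using n e0[of k] by (intro divide_left_mono) auto
        also have "\<dots> \<le> alpha_term c H \<alpha> (Suc n)"
          using ek[of k "Suc n"] n by (simp add: pos_divide_le_eq mult.commute del: of_nat_Suc)
        finally show "e k / real (m (Suc k)) \<le> alpha_term c H \<alpha> (Suc n)" .
      qed
      finally show ?thesis .
    qed
    have "q * (\<Sum>k<K. e k) \<le> (\<Sum>k<K. \<Sum>n\<in>{m k..<m (Suc k)}. alpha_term c H \<alpha> (Suc n))"
      unfolding sum_distrib_left by (intro sum_mono blk)
    also have "\<dots> = (\<Sum>n\<in>{m 0..<m K}. alpha_term c H \<alpha> (Suc n))" by (rule sum_blocks)
    also have "\<dots> \<le> (\<Sum>n. alpha_term c H \<alpha> (Suc n))"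
      by (rule sum_le_suminf[OF \<alpha>(2)]) (auto simp: at0)
    finally show "(\<Sum>k<K. e k) \<le> (\<Sum>n. alpha_term c H \<alpha> (Suc n)) / q" using q by (simp add: pos_le_divide_eq mult.commute)
  qed
  obtain \<eta> where \<eta>: "\<eta> > 0"
    "\<And>(M :: 'a measure) (N :: 'b measure) b v Y n t.
      iid_seq M N b v Y n \<Longrightarrow> n \<ge> 1 \<Longrightarrow> b > 0 \<Longrightarrow> t > 0 \<Longrightarrow>
      measure M {\<omega>\<in>space M. \<exists>j\<le>n. (1 + \<epsilon>) * (\<integral>\<omega>. norm (\<Sum>i\<in>{1..n}. Y i \<omega>) \<partial>M) + t \<le> norm (\<Sum>i\<in>{1..j}. Y i \<omega>)}
      \<le> (if v = 0 then 0 else exp (- (t\<^sup>2 / (2 * (1 + \<epsilon>) * (real n * v))))) + exp (- (\<eta> * t / b))"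
    using norm_sum_tail[OF \<epsilon>(1), where 'a='a and 'b='b] by blast
  define E where "E k = (\<integral>\<omega>. norm (\<Sum>i\<in>{1..m k}. ctrunc (a k) i \<omega>) \<partial>M)" for k
  define A where "A k = {\<omega>\<in>space M. \<exists>j\<le>m k. (1 + \<epsilon>) * E k + \<alpha>' * c (m k) \<le> norm (\<Sum>i\<in>{1..j}. ctrunc (a k) i \<omega>)}" for k
  have Yseq: "iid_seq M (NN (a k)) (2 * a k) (H (c (m k))) (ctrunc (a k)) (m k)" for k
  proof -
    have "H (a k) \<le> H (c (m k))" by (rule H_mono[OF less_imp_le[OF a_pos] a_le])
    then show ?thesis unfolding iid_seq_def by (intro ctrunc_iid less_imp_le[OF a_pos]) auto
  qed
  have PA: "prob (A k) \<le> e k + exp (- ((\<eta> * \<alpha>' / 2) / \<rho> k))" for k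
  proof -
    have "prob (A k) \<le> (if H (c (m k)) = 0 then 0 else exp (- ((\<alpha>' * c (m k))\<^sup>2 / (2 * (1 + \<epsilon>) * (real (m k) * H (c (m k)))))))
       + exp (- (\<eta> * (\<alpha>' * c (m k)) / (2 * a k)))"
      unfolding A_def E_def
      by (rule \<eta>(2)[OF Yseq m_ge1]) (use a_pos[of k] cm_pos[of k] a' in auto)
    also have "\<eta> * (\<alpha>' * c (m k)) / (2 * a k) = (\<eta> * \<alpha>' / 2) / \<rho> k"
      using cm_pos[of k] \<rho>_pos[of k] by (simp add: a_def)
    finally show ?thesis unfolding e_def .
  qed
  have Ameas: "A k \<in> sets M" for k
  proof -
    interpret I: iid_seq M "NN (a k)" "2 * a k" "H (c (m k))" "ctrunc (a k)" "m k" by (rule Yseq)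
    have "{\<omega>\<in>space M. \<exists>j\<in>{..m k}. (1 + \<epsilon>) * E k + \<alpha>' * c (m k) \<le> norm (\<Sum>i\<in>{1..j}. ctrunc (a k) i \<omega>)} \<in> sets M"
    proof (rule sets.sets_Collect_finite_Ex)
      fix j assume "j \<in> {..m k}"
      then have [measurable]: "(\<lambda>\<omega>. \<Sum>i\<in>{1..j}. ctrunc (a k) i \<omega>) \<in> borel_measurable M" by (intro I.rv_sum) auto
      show "{\<omega> \<in> space M. (1 + \<epsilon>) * E k + \<alpha>' * c (m k) \<le> norm (\<Sum>i\<in>{1..j}. ctrunc (a k) i \<omega>)} \<in> sets M" by measurable
    qed auto
    then show ?thesis by (simp only: Bex_def atMost_iff A_def)
  qed
  have "summable (\<lambda>k. e k + exp (- ((\<eta> * \<alpha>' / 2) / \<rho> k)))"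
    using \<eta>(1) a' by (intro summable_add es exp_rho_summable) simp
  then have "summable (\<lambda>k. prob (A k))"
    by (rule summable_comparison_test'[where N=0]) (use PA in simp)
  then have AE1: "AE \<omega> in M. \<forall>\<^sub>F k in sequentially. \<omega> \<in> space M - A k"
    by (intro borel_cantelli_AE1 Ameas) (auto simp: less_top[symmetric])
  have ev1: "\<forall>\<^sub>F k in sequentially. real (m k) * R (a k) / c (m k) < \<epsilon> / 2"
    using drift_tendsto by (rule order_tendstoD) (use \<epsilon> in simp)
  have ev2: "\<forall>\<^sub>F k in sequentially. (\<integral>\<omega>. norm (S (m k) \<omega>) \<partial>M) / c (m k) \<le> \<beta>"
    using \<beta> m_tendsto by (rule eventually_compose_filterlim)
  define B where "B = \<kappa> * (\<beta> + \<epsilon>) + \<kappa>\<^sup>2 * \<alpha> + 2 * \<epsilon>"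
  show ?thesis using AE1 truncation_approx[OF \<epsilon>(1) less_imp_le[OF \<epsilon>(2)]]
  proof eventually_elim
    case (elim \<omega>)
    have "\<forall>\<^sub>F k in sequentially. \<forall>j\<le>m k. norm (S j \<omega>) \<le> B * c (m k)"
      using elim ev1 ev2
    proof eventually_elim
      case (elim k)
      have cm: "c (m k) > 0" by (rule cm_pos)
      have dr: "real (m k) * R (a k) \<le> \<epsilon> / 2 * c (m k)" using elim(3) cm by (simp add: pos_divide_less_eq)
      have eS: "(\<integral>\<omega>. norm (S (m k) \<omega>) \<partial>M) \<le> \<beta> * c (m k)" using elim(4) cm by (simp add: pos_divide_le_eq)
      have Ek: "E k \<le> (\<beta> + \<epsilon>) * c (m k)"
        using E_ctrunc_le[of "a k" "m k"] a_pos[of k] dr eS by (simp add: E_def algebra_simps)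
      show ?case
      proof (intro allI impI)
        fix j assume j: "j \<le> m k"
        have "norm (\<Sum>i\<in>{1..j}. ctrunc (a k) i \<omega>) < (1 + \<epsilon>) * E k + \<alpha>' * c (m k)"
        proof (rule ccontr)
          assume "\<not> ?thesis"
          then have "\<omega> \<in> A k" using elim(1) j unfolding A_def not_less by blast
          then show False using elim(1) by simp
        qed
        also have "\<dots> \<le> (1 + \<epsilon>) * ((\<beta> + \<epsilon>) * c (m k)) + \<alpha>' * c (m k)"
          using Ek \<epsilon> by (intro add_right_mono mult_left_mono) auto
        finally have 1: "norm (\<Sum>i\<in>{1..j}. ctrunc (a k) i \<omega>) \<le> (\<kappa> * (\<beta> + \<epsilon>) + \<kappa>\<^sup>2 * \<alpha>) * c (m k)"
          by (simp add: \<kappa>_def[symmetric] \<alpha>'_def algebra_simps)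
        have 2: "norm (real j *\<^sub>R mu (a k)) \<le> \<epsilon> * c (m k)"
        proof -
          have "norm (real j *\<^sub>R mu (a k)) = real j * norm (mu (a k))" by simp
          also have "\<dots> \<le> real (m k) * R (a k)" using j norm_mu_R by (intro mult_mono) auto
          also have "\<dots> \<le> \<epsilon> * c (m k)" using dr \<epsilon> cm by (simp add: mult_nonneg_nonneg) (smt (verit) mult_pos_pos)
          finally show ?thesis .
        qed
        have 3: "norm (S j \<omega> - (\<Sum>i\<in>{1..j}. trunc (a k) (Xs i \<omega>))) \<le> \<epsilon> * c (m k)" using elim(2) j by blast
        define x y z where "x = S j \<omega> - (\<Sum>i\<in>{1..j}. trunc (a k) (Xs i \<omega>))"
          and "y = (\<Sum>i\<in>{1..j}. ctrunc (a k) i \<omega>)" and "z = real j *\<^sub>R mu (a k)"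
        have S: "S j \<omega> = x + (y + z)"
          by (simp add: x_def y_def z_def ctrunc_def sum_subtractf sum_constant_scaleR)
        have "norm (S j \<omega>) \<le> norm x + norm (y + z)" unfolding S by (rule norm_triangle_ineq)
        also have "\<dots> \<le> norm x + (norm y + norm z)" by (intro add_left_mono norm_triangle_ineq)
        finally have "norm (S j \<omega>) \<le> norm x + (norm y + norm z)" .
        with 1 2 3 show "norm (S j \<omega>) \<le> B * c (m k)" unfolding x_def[symmetric] y_def[symmetric] z_def[symmetric]
          by (simp add: B_def algebra_simps)
      qed
    qed
    then obtain K where K: "\<And>k j. K \<le> k \<Longrightarrow> j \<le> m k \<Longrightarrow> norm (S j \<omega>) \<le> B * c (m k)"
      unfolding eventually_sequentially by blast
    \<comment> \<open>\<open>\<beta>\<close> is not assumed nonnegative; the sign of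
      \<open>B\<close> comes from the empty sum \<open>S 0\<close>.\<close>
    have B0: "B \<ge> 0"
    proof -
      have "0 \<le> norm (S 0 \<omega>)" by simp
      also have "\<dots> \<le> B * c (m K)" by (rule K) auto
      finally show ?thesis using cm_pos[of K] by (simp add: zero_le_mult_iff)
    qed
    have "\<forall>\<^sub>F n in sequentially. ereal (norm (S n \<omega>) / c n) \<le> ereal (\<kappa>\<^sup>2 * B)"
      using eventually_ge_at_top[of "m K"]
    proof eventually_elim
      case (elim n)
      obtain k where k: "K \<le> k" "m k \<le> n" "n < m (Suc k)" using block_index[OF elim] by blast
      have mk: "real (m k) > 0" using m_ge1[of k] by simp
      have cn: "c n > 0" using k m_ge1[of k] by (intro c_pos) auto
      \<comment> \<open>An index of block \<open>k\<close> is covered by the maximum up to the right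
        end; replacing \<open>c (m (Suc k))\<close> by \<open>c n\<close> costs the outer factor
        \<open>\<kappa>\<^sup>2\<close>.\<close>
      have "norm (S n \<omega>) \<le> B * c (m (Suc k))" using k by (intro K) auto
      also have "c (m (Suc k)) \<le> \<kappa>\<^sup>2 * c (m k)"
      proof -
        have "m 0 \<le> m k" using m_strict by (simp add: strict_mono_less_eq)
        then have "c (m (Suc k)) / c (m k) \<le> (1 + \<epsilon>) * (real (m (Suc k)) / real (m k))"
          using m_strict by (intro growth) (auto simp: strict_mono_less)
        also have "\<dots> \<le> (1 + \<epsilon>) * (1 + \<epsilon>)"
          using m_step2[of k] mk \<epsilon> unfolding r2 by (intro mult_left_mono) (auto simp: pos_divide_le_eq)
        finally show ?thesis using cm_pos[of k] by (simp add: pos_divide_le_eq \<kappa>_def power2_eq_square)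
      qed
      also have "c (m k) \<le> c n" using k m_ge1[of k] by (intro c_mono) auto
      finally have "norm (S n \<omega>) \<le> B * (\<kappa>\<^sup>2 * c n)" using B0 k1 by (simp add: mult_left_mono)
      then show ?case using cn by (simp add: pos_divide_le_eq mult_ac)
    qed
    then have "limsup (\<lambda>n. ereal (norm (S n \<omega>) / c n)) \<le> ereal (\<kappa>\<^sup>2 * B)" by (rule Limsup_bounded)
    then show ?case by (simp add: B_def \<kappa>_def)
  qed
qed

end

context lil_setup
begin

text \<open>The sequence iterates the ceiling of \<open>r * x\<close> with
  \<open>r = sqrt (1 + \<epsilon>)\<close>. Starting no earlier than
  \<open>1 / (r\<^sup>2 - r)\<close> makes the rounding error at most
  \<open>(r\<^sup>2 - r) * x\<close>, so the ratios do not exceed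
  \<open>1 + \<epsilon>\<close>.\<close>

lemma upper_eps:
  assumes \<epsilon>: "0 < \<epsilon>" "\<epsilon> < 1"
    and \<alpha>: "\<alpha> > 0" "summable (\<lambda>n. alpha_term c H \<alpha> (Suc n))"
    and \<beta>: "\<forall>\<^sub>F n in sequentially. (\<integral>\<omega>. norm (S n \<omega>) \<partial>M) / c n \<le> \<beta>"
  shows "AE \<omega> in M. limsup (\<lambda>n. ereal (norm (S n \<omega>) / c n))
    \<le> ereal ((1 + \<epsilon>)\<^sup>2 * ((1 + \<epsilon>) * (\<beta> + \<epsilon>) + (1 + \<epsilon>)\<^sup>2 * \<alpha> + 2 * \<epsilon>))"
proof -
  define r where "r = sqrt (1 + \<epsilon>)"
  have r: "r > 1" and r2: "r\<^sup>2 = 1 + \<epsilon>" using \<epsilon> by (auto simp: r_def)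
  have rr: "r\<^sup>2 - r > 0" using r by (simp add: power2_eq_square)
  obtain N where N: "N \<ge> 1" "\<And>i j. N \<le> i \<Longrightarrow> i < j \<Longrightarrow> c j / c i \<le> (1 + \<epsilon>) * (real j / real i)"
    using c_growth[OF \<epsilon>(1)] by blast
  obtain K :: nat where K: "1 / (r\<^sup>2 - r) \<le> real K" using real_arch_simple by blast
  define m where "m = rec_nat (max N K) (\<lambda>_ x. nat \<lceil>r * real x\<rceil>)"
  have mz: "m 0 = max N K" and mS: "m (Suc k) = nat \<lceil>r * real (m k)\<rceil>" for k by (auto simp: m_def)
  have st: "r * real (m k) \<le> real (m (Suc k))" for k unfolding mS by (rule real_nat_ceiling_ge)
  have mK: "real (m k) \<ge> real K" for k
  proof (induction k)
    case (Suc k)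
    have "1 * real (m k) \<le> r * real (m k)" using r by (intro mult_right_mono) auto
    then show ?case using Suc st[of k] by linarith
  qed (simp add: mz)
  have st2: "real (m (Suc k)) \<le> r\<^sup>2 * real (m k)" for k
  proof -
    have "1 / (r\<^sup>2 - r) \<le> real (m k)" using K mK[of k] by linarith
    then have "1 \<le> real (m k) * (r\<^sup>2 - r)" using rr by (simp add: pos_divide_le_eq)
    moreover have "real (m (Suc k)) \<le> r * real (m k) + 1"
    proof -
      define x where "x = r * real (m k)"
      have "0 \<le> x" using r by (simp add: x_def)
      then have "real (nat \<lceil>x\<rceil>) = of_int \<lceil>x\<rceil>" by simp
      then show ?thesis unfolding mS x_def[symmetric] using ceiling_correct[of x] by linarith
    qed
    ultimately show ?thesis by (simp add: algebra_simps)
  qed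
  interpret lil_geom M X Xs c m r
  proof unfold_locales
    show "1 < r" by (rule r)
    show "1 \<le> m 0" using N(1) mz by simp
    show "r * real (m k) \<le> real (m (Suc k))" for k by (rule st)
  qed
  show ?thesis
  proof (rule upper_blocks[OF \<epsilon> r2 st2 _ \<alpha> \<beta>])
    fix i j assume "m 0 \<le> i" "i < j"
    then show "c j / c i \<le> (1 + \<epsilon>) * (real j / real i)" using mz by (intro N(2)) auto
  qed
qed

end

subsection \<open>Lower exponential bounds\<close>

lemma exp_taylor3:
  fixes y :: real assumes y: "\<bar>y\<bar> \<le> \<kappa>" and k: "\<kappa> \<le> 1 / 4"
  shows "\<bar>exp y - 1 - y - y\<^sup>2 / 2\<bar> \<le> \<kappa> * y\<^sup>2"
proof -
  obtain t where t: "\<bar>t\<bar> \<le> \<bar>y\<bar>" "exp y = (\<Sum>m<3. y ^ m / fact m) + exp t / fact 3 * y ^ 3"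
    using Maclaurin_exp_le by blast
  have eq: "exp y - 1 - y - y\<^sup>2 / 2 = exp t / 6 * y ^ 3" using t(2) by (simp add: eval_nat_numeral)
  have "exp t \<le> exp 1" using t(1) y k by simp
  then have et: "exp t \<le> 6" using exp_le by linarith
  have "\<bar>exp y - 1 - y - y\<^sup>2 / 2\<bar> = exp t / 6 * (\<bar>y\<bar> * y\<^sup>2)"
    unfolding eq by (simp add: abs_mult power3_eq_cube power2_eq_square)
  also have "\<dots> \<le> 1 * (\<kappa> * y\<^sup>2)"
    using et y by (intro mult_mono mult_right_mono) auto
  finally show ?thesis by simp
qed

lemma ln_add_one_bounds:
  fixes z :: real assumes z: "\<bar>z\<bar> \<le> 1 / 2"
  shows "z - 2 * z\<^sup>2 \<le> ln (1 + z)" "ln (1 + z) \<le> z"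
proof -
  show "ln (1 + z) \<le> z" using z by (intro ln_add_one_self_le_self2) auto
  show "z - 2 * z\<^sup>2 \<le> ln (1 + z)"
  proof (cases "z \<ge> 0")
    case True
    then have "z - z\<^sup>2 \<le> ln (1 + z)" using ln_one_plus_pos_lower_bound[of z] z by simp
    then show ?thesis using zero_le_power2[of z] by linarith
  next
    case False
    then show ?thesis using ln_one_minus_pos_lower_bound[of "- z"] z by simp
  qed
qed

context prob_space
begin

text \<open>The transform is \<open>1 + z\<close> with \<open>z\<close> close to
  \<open>\<theta> * \<mu> + \<theta>\<^sup>2 * \<tau> / 2\<close>, and \<open>ln (1 + z)\<close>
  differs from \<open>z\<close> by at most \<open>2 * z\<^sup>2\<close>. The mean
  \<open>\<mu>\<close> is kept because the lower bound works with truncated summands that are not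
  centred.\<close>

lemma small_mgf:
  fixes Y :: "'a \<Rightarrow> real"
  assumes [measurable]: "Y \<in> borel_measurable M" and Y: "AE \<omega> in M. \<bar>Y \<omega>\<bar> \<le> b" and b: "b \<ge> 0"
    and k: "\<bar>\<theta>\<bar> * b \<le> \<kappa>" "\<kappa> \<le> 1 / 4"
  defines "\<mu> \<equiv> (\<integral>\<omega>. Y \<omega> \<partial>M)" and "\<tau> \<equiv> (\<integral>\<omega>. (Y \<omega>)\<^sup>2 \<partial>M)"
  shows "\<bar>ln (\<integral>\<omega>. exp (\<theta> * Y \<omega>) \<partial>M) - \<theta>\<^sup>2 * \<tau> / 2\<bar> \<le> 2 * (\<bar>\<theta>\<bar> * \<bar>\<mu>\<bar>) + 5 * \<kappa> * (\<theta>\<^sup>2 * \<tau>)"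
    and "(\<integral>\<omega>. exp (\<theta> * Y \<omega>) \<partial>M) > 0"
proof -
  have k0: "\<kappa> \<ge> 0" using k b by (smt (verit) abs_ge_zero mult_nonneg_nonneg)
  have iY: "integrable M Y" by (rule integrable_const_bound[of _ b]) (use Y in auto)
  have iY2: "integrable M (\<lambda>\<omega>. (Y \<omega>)\<^sup>2)"
    by (rule integrable_const_bound[of _ "b\<^sup>2"]) (use Y b in \<open>auto simp: abs_le_square_iff[symmetric] elim: eventually_mono\<close>)
  have ty: "AE \<omega> in M. \<bar>\<theta> * Y \<omega>\<bar> \<le> \<kappa>" using Y
  proof eventually_elim
    case (elim \<omega>)
    then have "\<bar>\<theta>\<bar> * \<bar>Y \<omega>\<bar> \<le> \<bar>\<theta>\<bar> * b" by (intro mult_left_mono) auto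
    then show ?case using k by (simp add: abs_mult)
  qed
  have iE: "integrable M (\<lambda>\<omega>. exp (\<theta> * Y \<omega>))"
    by (rule integrable_const_bound[of _ "exp \<kappa>"]) (use ty in \<open>auto elim!: eventually_mono\<close>)
  define z where "z = (\<integral>\<omega>. exp (\<theta> * Y \<omega>) \<partial>M) - 1"
  have \<tau>0: "\<tau> \<ge> 0" unfolding \<tau>_def by simp
  have "\<bar>z - \<theta> * \<mu> - \<theta>\<^sup>2 * \<tau> / 2\<bar> = \<bar>\<integral>\<omega>. exp (\<theta> * Y \<omega>) - 1 - \<theta> * Y \<omega> - (\<theta> * Y \<omega>)\<^sup>2 / 2 \<partial>M\<bar>"
    using iE iY iY2 by (simp add: z_def \<mu>_def \<tau>_def prob_space power_mult_distrib)
  also have "\<dots> \<le> (\<integral>\<omega>. \<bar>exp (\<theta> * Y \<omega>) - 1 - \<theta> * Y \<omega> - (\<theta> * Y \<omega>)\<^sup>2 / 2\<bar> \<partial>M)" by (rule integral_abs_bound)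
  also have "\<dots> \<le> (\<integral>\<omega>. \<kappa> * (\<theta>\<^sup>2 * (Y \<omega>)\<^sup>2) \<partial>M)"
  proof (rule integral_mono_AE)
    show "integrable M (\<lambda>\<omega>. \<bar>exp (\<theta> * Y \<omega>) - 1 - \<theta> * Y \<omega> - (\<theta> * Y \<omega>)\<^sup>2 / 2\<bar>)"
      using iE iY iY2 by (auto simp: power_mult_distrib)
    show "AE \<omega> in M. \<bar>exp (\<theta> * Y \<omega>) - 1 - \<theta> * Y \<omega> - (\<theta> * Y \<omega>)\<^sup>2 / 2\<bar> \<le> \<kappa> * (\<theta>\<^sup>2 * (Y \<omega>)\<^sup>2)"
      using ty by eventually_elim (use exp_taylor3[OF _ k(2)] in \<open>simp flip: power_mult_distrib\<close>)
  qed (use iY2 in auto)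
  also have "\<dots> = \<kappa> * (\<theta>\<^sup>2 * \<tau>)" by (simp add: \<tau>_def)
  finally have z1: "\<bar>z - \<theta> * \<mu> - \<theta>\<^sup>2 * \<tau> / 2\<bar> \<le> \<kappa> * (\<theta>\<^sup>2 * \<tau>)" .
  define p q where "p = \<bar>\<theta>\<bar> * \<bar>\<mu>\<bar>" and "q = \<theta>\<^sup>2 * \<tau>"
  have q0: "q \<ge> 0" and p0: "p \<ge> 0" using \<tau>0 by (auto simp: q_def p_def)
  have pk: "p \<le> \<kappa>"
  proof -
    have "\<bar>\<mu>\<bar> \<le> (\<integral>\<omega>. \<bar>Y \<omega>\<bar> \<partial>M)" unfolding \<mu>_def by (rule integral_abs_bound)
    also have "\<dots> \<le> (\<integral>\<omega>. b \<partial>M)" by (rule integral_mono_AE) (use iY Y in auto)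
    finally have "\<bar>\<mu>\<bar> \<le> b" by (simp add: prob_space)
    then have "p \<le> \<bar>\<theta>\<bar> * b" unfolding p_def by (intro mult_left_mono) auto
    then show ?thesis using k by simp
  qed
  have qk: "q \<le> \<kappa>\<^sup>2"
  proof -
    have "q = (\<integral>\<omega>. (\<theta> * Y \<omega>)\<^sup>2 \<partial>M)" by (simp add: q_def \<tau>_def power_mult_distrib)
    also have "\<dots> \<le> (\<integral>\<omega>. \<kappa>\<^sup>2 \<partial>M)"
    proof (rule integral_mono_AE)
      show "AE \<omega> in M. (\<theta> * Y \<omega>)\<^sup>2 \<le> \<kappa>\<^sup>2"
        using ty by eventually_elim (use k0 in \<open>simp add: abs_le_square_iff[symmetric]\<close>)
    qed (use iY2 in \<open>auto simp: power_mult_distrib\<close>)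
    finally show ?thesis by (simp add: prob_space)
  qed
  have kk: "\<kappa>\<^sup>2 \<le> \<kappa> / 4" unfolding power2_eq_square using mult_left_mono[OF k(2) k0] by simp
  have tm: "\<bar>\<theta> * \<mu>\<bar> = p" by (simp add: p_def abs_mult)
  have kq: "\<kappa> * q \<le> q / 4" using mult_right_mono[OF k(2) q0] by simp
  have z2: "\<bar>z\<bar> \<le> p + q" using z1 tm kq q0 unfolding q_def[symmetric] by linarith
  have z3: "\<bar>z\<bar> \<le> 2 * \<kappa>" using z2 pk qk kk k0 by linarith
  have zsq: "z\<^sup>2 \<le> 2 * \<kappa> * (p + q)"
  proof -
    have "z\<^sup>2 = \<bar>z\<bar> * \<bar>z\<bar>" by (simp add: power2_eq_square)
    also have "\<dots> \<le> (2 * \<kappa>) * (p + q)" using z2 z3 k0 by (intro mult_mono) auto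
    finally show ?thesis .
  qed
  have zh: "\<bar>z\<bar> \<le> 1 / 2" using z3 k by linarith
  note lb = ln_add_one_bounds[OF zh]
  have kp: "4 * \<kappa> * p \<le> p" using mult_right_mono[OF k(2) p0] p0 by simp
  have zz: "2 * (2 * \<kappa> * (p + q)) = 4 * \<kappa> * p + 4 * (\<kappa> * q)" by (simp add: algebra_simps)
  have kq0: "\<kappa> * q \<ge> 0" using k0 q0 by simp
  have e: "(\<integral>\<omega>. exp (\<theta> * Y \<omega>) \<partial>M) = 1 + z" by (simp add: z_def)
  \<comment> \<open>The Taylor estimate gives \<open>p + \<kappa> * q\<close> and
    \<open>2 * z\<^sup>2\<close> gives \<open>4 * \<kappa> * (p + q)\<close>; since
    \<open>\<kappa> <= 1 / 4\<close>, the total is at most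
    \<open>2 * p + 5 * \<kappa> * q\<close>.\<close>
  have "\<bar>ln (1 + z) - q / 2\<bar> \<le> 2 * p + 5 * (\<kappa> * q)"
    using lb zsq z1 tm kp kq0 p0 zz unfolding q_def[symmetric] abs_le_iff by linarith
  then show "\<bar>ln (\<integral>\<omega>. exp (\<theta> * Y \<omega>) \<partial>M) - \<theta>\<^sup>2 * \<tau> / 2\<bar> \<le> 2 * (\<bar>\<theta>\<bar> * \<bar>\<mu>\<bar>) + 5 * \<kappa> * (\<theta>\<^sup>2 * \<tau>)"
    unfolding e p_def q_def by simp
  show "(\<integral>\<omega>. exp (\<theta> * Y \<omega>) \<partial>M) > 0" unfolding e using zh by linarith
qed

lemma mgf_sum:
  fixes Y :: "nat \<Rightarrow> 'a \<Rightarrow> real" and b \<theta> \<kappa> \<mu> \<tau> :: real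
  assumes I: "finite I" and ind: "indep_vars (\<lambda>_. borel) Y I"
    and Y: "\<And>i. i \<in> I \<Longrightarrow> AE \<omega> in M. \<bar>Y i \<omega>\<bar> \<le> b" and b: "b \<ge> 0"
    and k: "\<bar>\<theta>\<bar> * b \<le> \<kappa>" "\<kappa> \<le> 1 / 4"
    and mu: "\<And>i. i \<in> I \<Longrightarrow> (\<integral>\<omega>. Y i \<omega> \<partial>M) = \<mu>"
    and tau: "\<And>i. i \<in> I \<Longrightarrow> (\<integral>\<omega>. (Y i \<omega>)\<^sup>2 \<partial>M) = \<tau>"
  shows "\<bar>ln (\<integral>\<omega>. exp (\<theta> * (\<Sum>i\<in>I. Y i \<omega>)) \<partial>M) - \<theta>\<^sup>2 * (card I * \<tau>) / 2\<bar>
      \<le> 2 * (\<bar>\<theta>\<bar> * (card I * \<bar>\<mu>\<bar>)) + 5 * \<kappa> * (\<theta>\<^sup>2 * (card I * \<tau>))"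
    and "(\<integral>\<omega>. exp (\<theta> * (\<Sum>i\<in>I. Y i \<omega>)) \<partial>M) > 0"
    and "integrable M (\<lambda>\<omega>. exp (\<theta> * (\<Sum>i\<in>I. Y i \<omega>)))"
proof -
  have Ym: "Y i \<in> borel_measurable M" if "i \<in> I" for i using ind that unfolding indep_vars_def by auto
  have ie: "integrable M (\<lambda>\<omega>. exp (\<theta> * Y i \<omega>))" if i: "i \<in> I" for i
  proof (rule integrable_const_bound[of _ "exp \<kappa>"])
    show "AE \<omega> in M. norm (exp (\<theta> * Y i \<omega>)) \<le> exp \<kappa>" using Y[OF i]
    proof eventually_elim
      case (elim \<omega>)
      then have "\<bar>\<theta>\<bar> * \<bar>Y i \<omega>\<bar> \<le> \<bar>\<theta>\<bar> * b" by (intro mult_left_mono) auto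
      then have "\<theta> * Y i \<omega> \<le> \<kappa>" using k abs_ge_self[of "\<theta> * Y i \<omega>"] by (simp add: abs_mult)
      then show ?case by simp
    qed
  qed (use Ym[OF i] in measurable)
  have ind': "indep_vars (\<lambda>_. borel) (\<lambda>i \<omega>. exp (\<theta> * Y i \<omega>)) I"
    using indep_vars_compose2[OF ind, of "\<lambda>_ x. exp (\<theta> * x)" "\<lambda>_. borel"] by simp
  have pr: "exp (\<theta> * (\<Sum>i\<in>I. Y i \<omega>)) = (\<Prod>i\<in>I. exp (\<theta> * Y i \<omega>))" for \<omega>
    by (simp add: sum_distrib_left exp_sum I)
  show "integrable M (\<lambda>\<omega>. exp (\<theta> * (\<Sum>i\<in>I. Y i \<omega>)))"
    unfolding pr by (rule indep_vars_integrable[OF I ind' ie])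
  have eq: "(\<integral>\<omega>. exp (\<theta> * (\<Sum>i\<in>I. Y i \<omega>)) \<partial>M) = (\<Prod>i\<in>I. \<integral>\<omega>. exp (\<theta> * Y i \<omega>) \<partial>M)"
    unfolding pr by (rule indep_vars_lebesgue_integral[OF I ind' ie])
  note sm = small_mgf[OF Ym Y b k]
  show pos: "(\<integral>\<omega>. exp (\<theta> * (\<Sum>i\<in>I. Y i \<omega>)) \<partial>M) > 0"
    unfolding eq by (intro prod_pos) (auto intro: sm(2))
  have "ln (\<integral>\<omega>. exp (\<theta> * (\<Sum>i\<in>I. Y i \<omega>)) \<partial>M) = (\<Sum>i\<in>I. ln (\<integral>\<omega>. exp (\<theta> * Y i \<omega>) \<partial>M))"
    unfolding eq by (rule ln_prod) (use I sm(2) in \<open>auto simp: less_imp_neq[symmetric]\<close>)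
  then have "ln (\<integral>\<omega>. exp (\<theta> * (\<Sum>i\<in>I. Y i \<omega>)) \<partial>M) - \<theta>\<^sup>2 * (card I * \<tau>) / 2
     = (\<Sum>i\<in>I. ln (\<integral>\<omega>. exp (\<theta> * Y i \<omega>) \<partial>M) - \<theta>\<^sup>2 * \<tau> / 2)" by (simp add: sum_subtractf)
  also have "\<bar>\<dots>\<bar> \<le> (\<Sum>i\<in>I. \<bar>ln (\<integral>\<omega>. exp (\<theta> * Y i \<omega>) \<partial>M) - \<theta>\<^sup>2 * \<tau> / 2\<bar>)" by (rule sum_abs)
  also have "\<dots> \<le> (\<Sum>i\<in>I. 2 * (\<bar>\<theta>\<bar> * \<bar>\<mu>\<bar>) + 5 * \<kappa> * (\<theta>\<^sup>2 * \<tau>))"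
    by (intro sum_mono) (use sm(1) mu tau in fastforce)
  finally show "\<bar>ln (\<integral>\<omega>. exp (\<theta> * (\<Sum>i\<in>I. Y i \<omega>)) \<partial>M) - \<theta>\<^sup>2 * (card I * \<tau>) / 2\<bar>
      \<le> 2 * (\<bar>\<theta>\<bar> * (card I * \<bar>\<mu>\<bar>)) + 5 * \<kappa> * (\<theta>\<^sup>2 * (card I * \<tau>))"
    by (simp add: algebra_simps)
qed

text \<open>The exponentially tilted law of \<open>Z\<close> concentrates near \<open>l * B\<close>, by Chernoff bounds at the
  neighbouring parameters \<open>(1 - \<delta>) * l\<close> and \<open>(1 + \<delta>) * l\<close>.\<close>

lemma tilting_lower_bound:
  fixes Z :: "'a \<Rightarrow> real"
  assumes [measurable]: "Z \<in> borel_measurable M"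
    and l: "l > 0" and B: "B > 0" and \<delta>: "0 < \<delta>" "\<delta> < 1"
    and int: "\<And>\<theta>. \<theta> \<in> {1 - \<delta>, 1, 1 + \<delta>} \<Longrightarrow> integrable M (\<lambda>\<omega>. exp (\<theta> * l * Z \<omega>))"
    and mgf: "\<And>\<theta>. \<theta> \<in> {1 - \<delta>, 1, 1 + \<delta>} \<Longrightarrow> \<bar>ln (\<integral>\<omega>. exp (\<theta> * l * Z \<omega>) \<partial>M) - \<theta>\<^sup>2 * (l\<^sup>2 * B) / 2\<bar> \<le> \<delta>\<^sup>2 / 8 * (l\<^sup>2 * B)"
    and pos: "\<And>\<theta>. \<theta> \<in> {1 - \<delta>, 1, 1 + \<delta>} \<Longrightarrow> (\<integral>\<omega>. exp (\<theta> * l * Z \<omega>) \<partial>M) > 0"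
    and large: "\<delta>\<^sup>2 / 4 * (l\<^sup>2 * B) \<ge> ln 4"
  shows "prob {\<omega>\<in>space M. (1 - \<delta>) * (l * B) \<le> Z \<omega>} \<ge> exp (- ((1 / 2 + \<delta> + \<delta>\<^sup>2 / 8) * (l\<^sup>2 * B))) / 2"
proof -
  define L where "L = l\<^sup>2 * B"
  define F where "F \<theta> = (\<integral>\<omega>. exp (\<theta> * l * Z \<omega>) \<partial>M)" for \<theta>
  have F1: "F 1 \<ge> exp ((1 / 2 - \<delta>\<^sup>2 / 8) * L)"
  proof -
    have "ln (F 1) \<ge> (1 / 2 - \<delta>\<^sup>2 / 8) * L"
    proof -
      have "\<bar>ln (F 1) - L / 2\<bar> \<le> \<delta>\<^sup>2 / 8 * L" using mgf[of 1] by (simp add: F_def L_def)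
      moreover have "(1 / 2 - \<delta>\<^sup>2 / 8) * L = L / 2 - \<delta>\<^sup>2 / 8 * L" by (simp add: algebra_simps)
      ultimately show ?thesis by linarith
    qed
    then have "exp ((1 / 2 - \<delta>\<^sup>2 / 8) * L) \<le> exp (ln (F 1))" by simp
    moreover have "F 1 > 0" using pos[of 1] by (simp add: F_def)
    ultimately show ?thesis by (simp only: exp_ln)
  qed
  have Fu: "F \<theta> \<le> exp ((\<theta>\<^sup>2 / 2 + \<delta>\<^sup>2 / 8) * L)" if "\<theta> \<in> {1 - \<delta>, 1, 1 + \<delta>}" for \<theta>
  proof -
    have "ln (F \<theta>) \<le> (\<theta>\<^sup>2 / 2 + \<delta>\<^sup>2 / 8) * L"
    proof -
      have "\<bar>ln (F \<theta>) - \<theta>\<^sup>2 * L / 2\<bar> \<le> \<delta>\<^sup>2 / 8 * L" using mgf[OF that] by (simp only: F_def L_def)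
      moreover have "(\<theta>\<^sup>2 / 2 + \<delta>\<^sup>2 / 8) * L = \<theta>\<^sup>2 * L / 2 + \<delta>\<^sup>2 / 8 * L" by (simp add: algebra_simps)
      ultimately show ?thesis by linarith
    qed
    then have "exp (ln (F \<theta>)) \<le> exp ((\<theta>\<^sup>2 / 2 + \<delta>\<^sup>2 / 8) * L)" by simp
    moreover have "F \<theta> > 0" using pos[OF that] by (simp add: F_def)
    ultimately show ?thesis by (simp only: exp_ln)
  qed
  define C where "C = {\<omega>\<in>space M. (1 - \<delta>) * (l * B) \<le> Z \<omega>}"
  have Cm: "C \<in> sets M" unfolding C_def by measurable
  \<comment> \<open>Outside the window around \<open>l * B\<close> the exponential is bounded by
    that of a neighbouring parameter, with the constant chosen so that the two agree at the edge of
    the window.\<close>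
  have pt: "exp (l * Z \<omega>) \<le> exp (- (\<delta> * (1 + \<delta>) * L)) * exp ((1 + \<delta>) * l * Z \<omega>)
      + exp (\<delta> * (1 - \<delta>) * L) * exp ((1 - \<delta>) * l * Z \<omega>) + exp ((1 + \<delta>) * L) * indicator C \<omega>"
    if w: "\<omega> \<in> space M" for \<omega>
  proof -
    consider "Z \<omega> \<ge> (1 + \<delta>) * (l * B)" | "Z \<omega> < (1 - \<delta>) * (l * B)" | "(1 - \<delta>) * (l * B) \<le> Z \<omega>" "Z \<omega> < (1 + \<delta>) * (l * B)" by linarith
    then show ?thesis
    proof cases
      case 1
      have "\<delta> * l * ((1 + \<delta>) * (l * B)) \<le> \<delta> * l * Z \<omega>" using 1 \<delta> l by (intro mult_left_mono) auto
      then have "l * Z \<omega> \<le> - (\<delta> * (1 + \<delta>) * L) + (1 + \<delta>) * l * Z \<omega>"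
        by (simp add: L_def power2_eq_square algebra_simps)
      then have "exp (l * Z \<omega>) \<le> exp (- (\<delta> * (1 + \<delta>) * L)) * exp ((1 + \<delta>) * l * Z \<omega>)"
        unfolding exp_add[symmetric] by simp
      then show ?thesis by (simp add: add_increasing2)
    next
      case 2
      have "\<delta> * l * Z \<omega> \<le> \<delta> * l * ((1 - \<delta>) * (l * B))" using 2 \<delta> l by (intro mult_left_mono) auto
      then have "l * Z \<omega> \<le> \<delta> * (1 - \<delta>) * L + (1 - \<delta>) * l * Z \<omega>"
        by (simp add: L_def power2_eq_square algebra_simps)
      then have "exp (l * Z \<omega>) \<le> exp (\<delta> * (1 - \<delta>) * L) * exp ((1 - \<delta>) * l * Z \<omega>)"
        unfolding exp_add[symmetric] by simp
      then show ?thesis by (simp add: add_increasing2 add_increasing)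
    next
      case 3
      have "l * Z \<omega> \<le> l * ((1 + \<delta>) * (l * B))" using 3 l by (intro mult_left_mono) auto
      then have "l * Z \<omega> \<le> (1 + \<delta>) * L" by (simp add: L_def power2_eq_square algebra_simps)
      then have "exp (l * Z \<omega>) \<le> exp ((1 + \<delta>) * L)" by simp
      moreover have "\<omega> \<in> C" using 3 w by (simp add: C_def)
      ultimately show ?thesis by (simp add: add_increasing)
    qed
  qed
  have i: "integrable M (\<lambda>\<omega>. exp ((1 + \<delta>) * l * Z \<omega>))" "integrable M (\<lambda>\<omega>. exp ((1 - \<delta>) * l * Z \<omega>))"
    "integrable M (\<lambda>\<omega>. exp (l * Z \<omega>))" using int[of "1 + \<delta>"] int[of "1 - \<delta>"] int[of 1] by auto
  have iC: "integrable M (\<lambda>\<omega>. exp ((1 + \<delta>) * L) * indicator C \<omega>)"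
    using integrable_real_mult_indicator[OF Cm integrable_const[of "exp ((1 + \<delta>) * L)"]] by simp
  have "F 1 \<le> (\<integral>\<omega>. exp (- (\<delta> * (1 + \<delta>) * L)) * exp ((1 + \<delta>) * l * Z \<omega>)
      + exp (\<delta> * (1 - \<delta>) * L) * exp ((1 - \<delta>) * l * Z \<omega>) + exp ((1 + \<delta>) * L) * indicator C \<omega> \<partial>M)"
    unfolding F_def mult_1 by (rule integral_mono) (use i iC pt in auto)
  also have "\<dots> = exp (- (\<delta> * (1 + \<delta>) * L)) * F (1 + \<delta>) + exp (\<delta> * (1 - \<delta>) * L) * F (1 - \<delta>) + exp ((1 + \<delta>) * L) * prob C"
    using i iC Cm by (simp add: F_def)
  also have "\<dots> \<le> exp ((1 / 2 - 3 * \<delta>\<^sup>2 / 8) * L) + exp ((1 / 2 - 3 * \<delta>\<^sup>2 / 8) * L) + exp ((1 + \<delta>) * L) * prob C"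
  proof (intro add_right_mono add_mono)
    have "exp (- (\<delta> * (1 + \<delta>) * L)) * F (1 + \<delta>) \<le> exp (- (\<delta> * (1 + \<delta>) * L)) * exp (((1 + \<delta>)\<^sup>2 / 2 + \<delta>\<^sup>2 / 8) * L)"
      by (intro mult_left_mono Fu) auto
    also have "\<dots> = exp ((1 / 2 - 3 * \<delta>\<^sup>2 / 8) * L)"
      unfolding exp_add[symmetric] by (simp add: power2_eq_square field_simps)
    finally show "exp (- (\<delta> * (1 + \<delta>) * L)) * F (1 + \<delta>) \<le> exp ((1 / 2 - 3 * \<delta>\<^sup>2 / 8) * L)" .
    have "exp (\<delta> * (1 - \<delta>) * L) * F (1 - \<delta>) \<le> exp (\<delta> * (1 - \<delta>) * L) * exp (((1 - \<delta>)\<^sup>2 / 2 + \<delta>\<^sup>2 / 8) * L)"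
      by (intro mult_left_mono Fu) auto
    also have "\<dots> = exp ((1 / 2 - 3 * \<delta>\<^sup>2 / 8) * L)"
      unfolding exp_add[symmetric] by (simp add: power2_eq_square field_simps)
    finally show "exp (\<delta> * (1 - \<delta>) * L) * F (1 - \<delta>) \<le> exp ((1 / 2 - 3 * \<delta>\<^sup>2 / 8) * L)" .
  qed
  \<comment> \<open>The hypothesis \<open>large\<close> makes each outer part at most a quarter of
    the lower bound for \<open>F 1\<close>, so at least half of that bound is left for the
    window.\<close>
  also have "exp ((1 / 2 - 3 * \<delta>\<^sup>2 / 8) * L) \<le> exp ((1 / 2 - \<delta>\<^sup>2 / 8) * L) / 4"
  proof -
    have "exp ((1 / 2 - 3 * \<delta>\<^sup>2 / 8) * L) = exp ((1 / 2 - \<delta>\<^sup>2 / 8) * L) * exp (- (\<delta>\<^sup>2 / 4 * L))"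
      unfolding exp_add[symmetric] by (simp add: algebra_simps)
    also have "\<dots> \<le> exp ((1 / 2 - \<delta>\<^sup>2 / 8) * L) * exp (- ln 4)"
      using large by (intro mult_left_mono) (auto simp: L_def)
    finally show ?thesis by (simp add: exp_minus)
  qed
  finally have "exp ((1 / 2 - \<delta>\<^sup>2 / 8) * L) / 2 \<le> exp ((1 + \<delta>) * L) * prob C" using F1 by linarith
  then have "exp (- ((1 + \<delta>) * L)) * (exp ((1 / 2 - \<delta>\<^sup>2 / 8) * L) / 2) \<le> exp (- ((1 + \<delta>) * L)) * (exp ((1 + \<delta>) * L) * prob C)"
    by (intro mult_left_mono) auto
  also have "\<dots> = prob C" unfolding mult.assoc[symmetric] exp_add[symmetric] by simp
  also have "exp (- ((1 + \<delta>) * L)) * (exp ((1 / 2 - \<delta>\<^sup>2 / 8) * L) / 2) = exp (- ((1 / 2 + \<delta> + \<delta>\<^sup>2 / 8) * L)) / 2"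
    unfolding times_divide_eq_right exp_add[symmetric] by (simp add: algebra_simps)
  finally show ?thesis unfolding C_def L_def .
qed

text \<open>If with probability \<open>p0 > 0\<close> no event from index \<open>K\<close> on
  occurs, then independence and \<open>1 - x <= exp (- x)\<close> bound all partial sums from
  \<open>K\<close> on by \<open>- ln p0\<close>.\<close>

lemma borel_cantelli_2:
  assumes ind: "indep_events A UNIV" and ns: "\<not> summable (\<lambda>k::nat. prob (A k))"
  shows "AE \<omega> in M. \<exists>\<^sub>F k in sequentially. \<omega> \<in> A k"
proof -
  have Am: "A k \<in> sets M" for k using ind unfolding indep_events_def by auto
  have pc: "prob (\<Inter>k\<in>{K..<K + n}. space M - A k) \<le> exp (- (\<Sum>k\<in>{K..<K + n}. prob (A k)))" if "n \<ge> 1" for K n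
  proof -
    have "indep_sets (\<lambda>k. {A k}) UNIV" using ind unfolding indep_events_def_alt .
    then have "indep_sets (\<lambda>k. sigma_sets (space M) {A k}) UNIV"
      by (rule indep_sets_sigma) (auto simp: Int_stable_def)
    then have "prob (\<Inter>k\<in>{K..<K + n}. space M - A k) = (\<Prod>k\<in>{K..<K + n}. prob (space M - A k))"
      by (rule indep_setsD) (use that in \<open>auto intro: sigma_sets.intros\<close>)
    also have "\<dots> = (\<Prod>k\<in>{K..<K + n}. 1 - prob (A k))" by (intro prod.cong refl prob_compl Am)
    also have "\<dots> \<le> (\<Prod>k\<in>{K..<K + n}. exp (- prob (A k)))"
      by (intro prod_mono) (use exp_ge_add_one_self[of "- prob (A _)"] in auto)
    also have "\<dots> = exp (- (\<Sum>k\<in>{K..<K + n}. prob (A k)))" by (simp add: exp_sum flip: sum_negf)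
    finally show ?thesis .
  qed
  have "prob (\<Inter>k\<in>{K..}. space M - A k) = 0" for K
  proof (rule ccontr)
    assume "prob (\<Inter>k\<in>{K..}. space M - A k) \<noteq> 0"
    then have p: "prob (\<Inter>k\<in>{K..}. space M - A k) > 0" by (simp add: less_le)
    define p0 where "p0 = prob (\<Inter>k\<in>{K..}. space M - A k)"
    have "(\<Sum>k<n. prob (A (k + K))) \<le> max 0 (- ln p0)" for n
    proof (cases "n \<ge> 1")
      case True
      have "p0 \<le> prob (\<Inter>k\<in>{K..<K + n}. space M - A k)" unfolding p0_def
        using True Am by (intro finite_measure_mono sets.finite_INT) auto
      also have "\<dots> \<le> exp (- (\<Sum>k\<in>{K..<K + n}. prob (A k)))" by (rule pc[OF True])
      finally have "ln p0 \<le> ln (exp (- (\<Sum>k\<in>{K..<K + n}. prob (A k))))"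
        using p unfolding p0_def[symmetric] by (subst ln_le_cancel_iff) auto
      then have "ln p0 \<le> - (\<Sum>k\<in>{K..<K + n}. prob (A k))" by (simp only: ln_exp)
      moreover have "(\<Sum>k\<in>{K..<K + n}. prob (A k)) = (\<Sum>k<n. prob (A (k + K)))"
        using sum.shift_bounds_nat_ivl[of "\<lambda>k. prob (A k)" 0 K n] by (simp add: add.commute atLeast0LessThan)
      ultimately show ?thesis by simp
    next
      case False
      then have "n = 0" by simp
      then show ?thesis by simp
    qed
    then have "summable (\<lambda>k. prob (A (k + K)))" by (intro summableI_nonneg_bounded[where x="max 0 (- ln p0)"]) auto
    then show False using ns summable_iff_shift[of "\<lambda>k. prob (A k)" K] by simp
  qed
  then have "AE \<omega> in M. \<omega> \<notin> (\<Inter>k\<in>{K..}. space M - A k)" for K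
    using Am by (intro AE_not_in) (auto simp: null_sets_def emeasure_eq_measure intro!: sets.countable_INT')
  then have "AE \<omega> in M. \<forall>K. \<omega> \<notin> (\<Inter>k\<in>{K..}. space M - A k)" by (simp add: AE_all_countable)
  moreover have "AE \<omega> in M. \<omega> \<in> space M" by simp
  ultimately show ?thesis
  proof eventually_elim
    case (elim \<omega>)
    then show ?case unfolding frequently_sequentially by auto
  qed
qed

end

section \<open>The probability that a block sum is large\<close>

context lil_setup
begin

text \<open>\<open>H\<close> is taken at \<open>c n\<close> but the summands are cut at
  \<open>\<rho> * c n\<close>. For the upper bound monotonicity of \<open>H\<close> settles this;
  here the opposite direction is needed, and the lost band is paid for by the fourth moment, as
  \<open>u\<^sup>2 <= u ^ 4 / \<rho>\<^sup>2\<close> on it.\<close>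

lemma trunc_band:
  fixes f :: "'b \<Rightarrow>\<^sub>L real"
  assumes n: "n \<ge> 1" and \<rho>: "0 < \<rho>" "\<rho> \<le> 1" and f: "norm f \<le> 1"
  shows "real n * (\<integral>\<omega>. (blinfun_apply f (trunc (c n) (X \<omega>)))\<^sup>2 \<partial>M)
    \<le> real n * (\<integral>\<omega>. (blinfun_apply f (trunc (\<rho> * c n) (X \<omega>)))\<^sup>2 \<partial>M) + (c n)\<^sup>2 * (G n / \<rho>\<^sup>2)"
proof -
  have cn: "c n > 0" by (rule c_pos[OF n])
  have "(\<integral>\<omega>. (blinfun_apply f (trunc (c n) (X \<omega>)))\<^sup>2 \<partial>M)
    \<le> (\<integral>\<omega>. (blinfun_apply f (trunc (\<rho> * c n) (X \<omega>)))\<^sup>2 + (c n)\<^sup>2 / \<rho>\<^sup>2 * (u n \<omega>) ^ 4 \<partial>M)"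
  proof (rule integral_mono[OF fsq_int[OF f]])
    show "integrable M (\<lambda>\<omega>. (blinfun_apply f (trunc (\<rho> * c n) (X \<omega>)))\<^sup>2 + (c n)\<^sup>2 / \<rho>\<^sup>2 * (u n \<omega>) ^ 4)"
      using cn \<rho> by (intro Bochner_Integration.integrable_add fsq_int[OF f] integrable_mult_right u_pow_integrable n) auto
    fix \<omega>
    define x where "x = norm (X \<omega>)"
    show "(blinfun_apply f (trunc (c n) (X \<omega>)))\<^sup>2 \<le> (blinfun_apply f (trunc (\<rho> * c n) (X \<omega>)))\<^sup>2 + (c n)\<^sup>2 / \<rho>\<^sup>2 * (u n \<omega>) ^ 4"
    proof (cases "\<rho> * c n < x \<and> x \<le> c n")
      case True
      then have u: "u n \<omega> = x / c n" using cn by (simp add: u_def x_def)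
      have "\<rho> \<le> u n \<omega>" using True cn by (simp add: u pos_le_divide_eq)
      then have "\<rho>\<^sup>2 \<le> (u n \<omega>)\<^sup>2" using \<rho> by (intro power_mono) auto
      then have "\<rho>\<^sup>2 * (u n \<omega>)\<^sup>2 \<le> (u n \<omega>)\<^sup>2 * (u n \<omega>)\<^sup>2" by (intro mult_right_mono) auto
      then have "(u n \<omega>)\<^sup>2 \<le> (u n \<omega>) ^ 4 / \<rho>\<^sup>2" using \<rho> by (simp add: pos_le_divide_eq mult_ac flip: power_add)
      then have "(c n)\<^sup>2 * (u n \<omega>)\<^sup>2 \<le> (c n)\<^sup>2 * ((u n \<omega>) ^ 4 / \<rho>\<^sup>2)" by (intro mult_left_mono) auto
      moreover have "(c n)\<^sup>2 * (u n \<omega>)\<^sup>2 = x\<^sup>2" using cn by (simp add: u power_divide)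
      moreover have "(blinfun_apply f (trunc (c n) (X \<omega>)))\<^sup>2 \<le> x\<^sup>2"
        using abs_blinfun_le[OF f, of "X \<omega>"] by (simp add: fsq_eq x_def abs_le_square_iff[symmetric])
      ultimately show ?thesis by (simp add: add_increasing)
    next
      case False
      then have "(blinfun_apply f (trunc (c n) (X \<omega>)))\<^sup>2 \<le> (blinfun_apply f (trunc (\<rho> * c n) (X \<omega>)))\<^sup>2"
        by (auto simp: fsq_eq x_def)
      then show ?thesis using u_range[OF n, of \<omega>] by (simp add: add_increasing2)
    qed
  qed (use cn in simp)
  also have "\<dots> = (\<integral>\<omega>. (blinfun_apply f (trunc (\<rho> * c n) (X \<omega>)))\<^sup>2 \<partial>M) + (c n)\<^sup>2 / \<rho>\<^sup>2 * (\<integral>\<omega>. (u n \<omega>) ^ 4 \<partial>M)"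
    using fsq_int[OF f, of "\<rho> * c n"] cn \<rho> u_pow_integrable[OF n, of 4] by simp
  finally have "real n * (\<integral>\<omega>. (blinfun_apply f (trunc (c n) (X \<omega>)))\<^sup>2 \<partial>M)
    \<le> real n * ((\<integral>\<omega>. (blinfun_apply f (trunc (\<rho> * c n) (X \<omega>)))\<^sup>2 \<partial>M) + (c n)\<^sup>2 / \<rho>\<^sup>2 * (\<integral>\<omega>. (u n \<omega>) ^ 4 \<partial>M))"
    by (intro mult_left_mono) auto
  then show ?thesis by (simp add: G_def algebra_simps)
qed

text \<open>\<open>v\<close> is the normalized variance. The conditions \<open>h1\<close> to
  \<open>h5\<close> make negligible, in this order, the variance lost by truncation, the drift, the
  size of a tilted summand, the Chernoff terms in \<open>tilting_lower_bound\<close> and its factor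
  \<open>1 / 2\<close>.\<close>

lemma block_prob:
  fixes I :: "nat set"
  assumes n: "n \<ge> 1" and \<rho>: "0 < \<rho>" "\<rho> \<le> 1"
    and I: "finite I" "I \<subseteq> {1..}" "card I \<le> n" "(1 - \<delta>) * real n \<le> real (card I)"
    and \<delta>: "0 < \<delta>" "\<delta> < 1" and \<alpha>': "\<alpha>' > 0"
  defines "v \<equiv> real n * H (c n) / (c n)\<^sup>2"
  defines "Q \<equiv> (1 + 2 * \<delta> + \<delta>\<^sup>2 / 4) * \<alpha>'\<^sup>2 / (1 - \<delta>) ^ 4"
  assumes v: "v > 0"
    and h1: "G n / \<rho>\<^sup>2 \<le> \<delta> / 2 * v"
    and h2: "real n * R (\<rho> * c n) / c n \<le> \<alpha>' * \<delta>\<^sup>2 / 64"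
    and h3: "2 * \<rho> * \<alpha>' / ((1 - \<delta>) ^ 3 * v) \<le> \<delta>\<^sup>2 / 320"
    and h4: "ln 4 * v \<le> \<delta>\<^sup>2 / 4 * \<alpha>'\<^sup>2"
    and h5: "ln 2 * v \<le> (\<alpha>\<^sup>2 - Q) / 2"
  shows "\<exists>f :: 'b \<Rightarrow>\<^sub>L real. norm f \<le> 1 \<and>
    exp (- (\<alpha>\<^sup>2 / (2 * v))) \<le> prob {\<omega>\<in>space M. \<alpha>' * c n \<le> blinfun_apply f (\<Sum>i\<in>I. trunc (\<rho> * c n) (Xs i \<omega>))}"
proof -
  have cn: "c n > 0" by (rule c_pos[OF n])
  define a where "a = \<rho> * c n"
  have a: "a > 0" using \<rho> cn by (simp add: a_def)
  have ac: "a \<le> c n" using \<rho> cn by (simp add: a_def)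
  have Hv: "real n * H (c n) = v * (c n)\<^sup>2" using cn by (simp add: v_def)
  have np: "real n > 0" using n by simp
  have Hp: "H (c n) > 0"
  proof -
    have "real n * H (c n) > 0" unfolding Hv using v cn by simp
    then show ?thesis using np by (simp add: zero_less_mult_iff)
  qed
  \<comment> \<open>Half of \<open>\<delta>\<close> is spent on the near-maximizer, as the supremum
    need not be attained; the other half is lost in the band, which leaves
    \<open>1 - \<delta>\<close> in \<open>nt\<close>.\<close>
  obtain f :: "'b \<Rightarrow>\<^sub>L real" where f: "norm f \<le> 1"
    and fH: "(1 - \<delta> / 2) * H (c n) < (\<integral>\<omega>. (blinfun_apply f (trunc (c n) (X \<omega>)))\<^sup>2 \<partial>M)"
    by (rule H_approx[of "c n" "(1 - \<delta> / 2) * H (c n)"]) (use cn Hp \<delta> in auto)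
  define Y where "Y i \<omega> = blinfun_apply f (trunc a (Xs i \<omega>))" for i \<omega>
  define \<mu> where "\<mu> = blinfun_apply f (mu a)"
  define \<tau> where "\<tau> = (\<integral>\<omega>. (blinfun_apply f (trunc a (X \<omega>)))\<^sup>2 \<partial>M)"
  define B where "B = real (card I) * \<tau>"
  have i1: "i \<ge> 1" if "i \<in> I" for i using I that by auto
  have "real n * ((1 - \<delta> / 2) * H (c n)) \<le> real n * (\<integral>\<omega>. (blinfun_apply f (trunc (c n) (X \<omega>)))\<^sup>2 \<partial>M)"
    using fH by (intro mult_left_mono) auto
  also have "\<dots> \<le> real n * \<tau> + (c n)\<^sup>2 * (G n / \<rho>\<^sup>2)"
    unfolding \<tau>_def a_def by (rule trunc_band[OF n \<rho> f])
  also have "\<dots> \<le> real n * \<tau> + (c n)\<^sup>2 * (\<delta> / 2 * v)" using h1 by (intro add_left_mono mult_left_mono) auto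
  finally have "(1 - \<delta> / 2) * (real n * H (c n)) \<le> real n * \<tau> + (c n)\<^sup>2 * (\<delta> / 2 * v)" by (simp add: mult_ac)
  then have nt: "(1 - \<delta>) * (v * (c n)\<^sup>2) \<le> real n * \<tau>" unfolding Hv by (simp add: algebra_simps)
  have \<tau>0: "\<tau> \<ge> 0" by (simp add: \<tau>_def)
  have \<tau>H: "\<tau> \<le> H (c n)"
  proof -
    have "\<tau> \<le> H a" unfolding \<tau>_def by (rule H_ge[OF f]) (use a in simp)
    also have "\<dots> \<le> H (c n)" by (rule H_mono) (use a ac in auto)
    finally show ?thesis .
  qed
  have Bu: "B \<le> v * (c n)\<^sup>2"
  proof -
    have "B \<le> real n * H (c n)" unfolding B_def using I \<tau>0 \<tau>H by (intro mult_mono) auto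
    then show ?thesis by (simp add: Hv)
  qed
  have Bl: "(1 - \<delta>)\<^sup>2 * (v * (c n)\<^sup>2) \<le> B"
  proof -
    have "(1 - \<delta>)\<^sup>2 * (v * (c n)\<^sup>2) = (1 - \<delta>) * ((1 - \<delta>) * (v * (c n)\<^sup>2))" by (simp add: power2_eq_square mult.assoc)
    also have "\<dots> \<le> (1 - \<delta>) * (real n * \<tau>)" using nt \<delta> by (intro mult_left_mono) auto
    also have "\<dots> = ((1 - \<delta>) * real n) * \<tau>" by (simp only: mult.assoc)
    also have "\<dots> \<le> B" unfolding B_def using I(4) \<tau>0 by (intro mult_right_mono)
    finally show ?thesis .
  qed
  have vc: "v * (c n)\<^sup>2 > 0" using v cn by simp
  have d1: "1 - \<delta> > 0" using \<delta> by simp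
  have Bpos: "B > 0"
  proof -
    have "(1 - \<delta>)\<^sup>2 * (v * (c n)\<^sup>2) > 0" using vc d1 by simp
    then show ?thesis using Bl by linarith
  qed
  \<comment> \<open>The tilt places the lower edge \<open>(1 - \<delta>) * (l * B)\<close> of the
    window at the required level \<open>\<alpha>' * c n\<close>.\<close>
  define l where "l = \<alpha>' * c n / ((1 - \<delta>) * B)"
  have l: "l > 0" using \<alpha>' cn d1 Bpos by (simp add: l_def)
  have lB: "(1 - \<delta>) * (l * B) = \<alpha>' * c n" using d1 Bpos by (simp add: l_def)
  define L where "L = l\<^sup>2 * B"
  have Leq: "L = \<alpha>'\<^sup>2 * (c n)\<^sup>2 / ((1 - \<delta>)\<^sup>2 * B)"
    using Bpos by (simp add: L_def l_def power2_eq_square mult_ac)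
  have Lu: "L \<le> \<alpha>'\<^sup>2 / ((1 - \<delta>) ^ 4 * v)"
  proof -
    have "L \<le> \<alpha>'\<^sup>2 * (c n)\<^sup>2 / ((1 - \<delta>)\<^sup>2 * ((1 - \<delta>)\<^sup>2 * (v * (c n)\<^sup>2)))"
      unfolding Leq using Bl d1 vc v cn by (intro divide_left_mono mult_left_mono mult_pos_pos Bpos) auto
    also have "\<dots> = \<alpha>'\<^sup>2 / ((1 - \<delta>) ^ 4 * v)"
      using cn by (simp add: power4_eq_xxxx power2_eq_square)
    finally show ?thesis .
  qed
  have Ll: "\<alpha>'\<^sup>2 / v \<le> L"
  proof -
    have "(1 - \<delta>)\<^sup>2 * B \<le> 1 * (v * (c n)\<^sup>2)"
      using Bu \<delta> Bpos by (intro mult_mono) (auto simp: power_le_one)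
    then have "\<alpha>'\<^sup>2 * (c n)\<^sup>2 / (1 * (v * (c n)\<^sup>2)) \<le> L"
      unfolding Leq using d1 Bpos vc by (intro divide_left_mono) auto
    then show ?thesis using cn by simp
  qed
  have L0: "L > 0" using l Bpos by (simp add: L_def)
  \<comment> \<open>The tilting parameters used are all at most \<open>2 * l\<close>, whence the
    factor \<open>2\<close>.\<close>
  define \<kappa> where "\<kappa> = 2 * l * a"
  have kb: "\<kappa> \<le> \<delta>\<^sup>2 / 320"
  proof -
    have "\<kappa> = 2 * \<rho> * \<alpha>' * (c n)\<^sup>2 / ((1 - \<delta>) * B)" by (simp add: \<kappa>_def l_def a_def power2_eq_square mult_ac)
    also have "\<dots> \<le> 2 * \<rho> * \<alpha>' * (c n)\<^sup>2 / ((1 - \<delta>) * ((1 - \<delta>)\<^sup>2 * (v * (c n)\<^sup>2)))"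
      using Bl d1 vc v cn \<rho> \<alpha>' by (intro divide_left_mono mult_left_mono mult_pos_pos Bpos) auto
    also have "\<dots> = 2 * \<rho> * \<alpha>' / ((1 - \<delta>) ^ 3 * v)" using cn by (simp add: power3_eq_cube power2_eq_square mult_ac)
    finally show ?thesis using h3 by simp
  qed
  have k0: "\<kappa> \<ge> 0" using l a by (simp add: \<kappa>_def)
  have k14: "\<kappa> \<le> 1 / 4"
  proof -
    have "\<delta>\<^sup>2 \<le> 1" using \<delta> by (simp add: power_le_one)
    then show ?thesis using kb by simp
  qed
  have Ym: "Y i \<in> borel_measurable M" if "i \<in> I" for i
    using Xs_meas[OF i1[OF that]] unfolding Y_def by measurable
  have ind: "indep_vars (\<lambda>_. borel) Y I"
  proof -
    have "indep_vars (\<lambda>_. borel) (\<lambda>i \<omega>. (\<lambda>x. blinfun_apply f (trunc a x)) (Xs i \<omega>)) I"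
      by (rule indep_vars_compose2[OF indep_vars_subset[OF Xs_indep I(2)]]) simp
    then show ?thesis by (simp add: Y_def[abs_def])
  qed
  have Yb: "AE \<omega> in M. \<bar>Y i \<omega>\<bar> \<le> a" for i
    unfolding Y_def using order_trans[OF abs_blinfun_le[OF f] norm_trunc[OF less_imp_le[OF a]]] by simp
  have Y\<mu>: "(\<integral>\<omega>. Y i \<omega> \<partial>M) = \<mu>" if "i \<in> I" for i
  proof -
    have "(\<integral>\<omega>. Y i \<omega> \<partial>M) = (\<integral>\<omega>. blinfun_apply f (trunc a (X \<omega>)) \<partial>M)"
      unfolding Y_def by (rule expectation_Xs[OF i1[OF that]]) simp
    also have "\<dots> = \<mu>" unfolding \<mu>_def mu_def
      by (rule integral_bounded_linear[OF blinfun.bounded_linear_right trunc_int])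
    finally show ?thesis .
  qed
  have Y\<tau>: "(\<integral>\<omega>. (Y i \<omega>)\<^sup>2 \<partial>M) = \<tau>" if "i \<in> I" for i
    unfolding Y_def \<tau>_def by (rule expectation_Xs[OF i1[OF that]]) simp
  have nmu: "real (card I) * \<bar>\<mu>\<bar> \<le> \<alpha>' * \<delta>\<^sup>2 / 64 * c n"
  proof -
    have "real (card I) * \<bar>\<mu>\<bar> \<le> real n * R a"
      unfolding \<mu>_def using I(3) order_trans[OF abs_blinfun_le[OF f] norm_mu_R] by (intro mult_mono) auto
    also have "\<dots> \<le> \<alpha>' * \<delta>\<^sup>2 / 64 * c n" using h2 cn by (simp add: pos_divide_le_eq a_def)
    finally show ?thesis .
  qed
  define Z where "Z \<omega> = (\<Sum>i\<in>I. Y i \<omega>)" for \<omega>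
  have [measurable]: "Z \<in> borel_measurable M" unfolding Z_def using Ym by (intro borel_measurable_sum)
  have th: "\<bar>\<theta> * l\<bar> * a \<le> \<kappa>" if "\<theta> \<in> {1 - \<delta>, 1, 1 + \<delta>}" for \<theta>
  proof -
    have "\<bar>\<theta>\<bar> \<le> 2" using that \<delta> by auto
    then have "\<bar>\<theta>\<bar> * (l * a) \<le> 2 * (l * a)" using l a by (intro mult_right_mono) auto
    then show ?thesis using l by (simp add: \<kappa>_def abs_mult)
  qed
  note ms = mgf_sum[OF I(1) ind Yb less_imp_le[OF a] th k14 Y\<mu> Y\<tau>, folded Z_def B_def]
  have "exp (- ((1 / 2 + \<delta> + \<delta>\<^sup>2 / 8) * (l\<^sup>2 * B))) / 2 \<le> prob {\<omega>\<in>space M. (1 - \<delta>) * (l * B) \<le> Z \<omega>}"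
  proof (rule tilting_lower_bound[OF _ l Bpos \<delta>])
    show "Z \<in> borel_measurable M" by measurable
    fix \<theta> assume t: "\<theta> \<in> {1 - \<delta>, 1, 1 + \<delta>}"
    show "integrable M (\<lambda>\<omega>. exp (\<theta> * l * Z \<omega>))" by (rule ms(3)[OF t])
    show "(\<integral>\<omega>. exp (\<theta> * l * Z \<omega>) \<partial>M) > 0" by (rule ms(2)[OF t])
    have t2: "\<bar>\<theta>\<bar> \<le> 2" "\<theta>\<^sup>2 \<le> 4" using t \<delta> abs_le_square_iff[of \<theta> 2] by auto
    have "\<bar>ln (\<integral>\<omega>. exp (\<theta> * l * Z \<omega>) \<partial>M) - (\<theta> * l)\<^sup>2 * B / 2\<bar>
      \<le> 2 * (\<bar>\<theta> * l\<bar> * (real (card I) * \<bar>\<mu>\<bar>)) + 5 * \<kappa> * ((\<theta> * l)\<^sup>2 * B)"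
      by (rule ms(1)[OF t])
    \<comment> \<open>The constants \<open>64\<close> in \<open>h2\<close> and \<open>320\<close> in
      \<open>h3\<close> are chosen so that drift and Taylor error contribute
      \<open>\<delta>\<^sup>2 / 16\<close> each, together what \<open>tilting_lower_bound\<close>
      allows.\<close>
    also have "\<dots> \<le> \<delta>\<^sup>2 / 16 * L + \<delta>\<^sup>2 / 16 * L"
    proof (rule add_mono)
      have "\<bar>\<theta> * l\<bar> * (real (card I) * \<bar>\<mu>\<bar>) \<le> (2 * l) * (\<alpha>' * \<delta>\<^sup>2 / 64 * c n)"
      proof (rule mult_mono[OF _ nmu])
        show "\<bar>\<theta> * l\<bar> \<le> 2 * l" using t2 l by (simp add: abs_mult)
      qed (use l in auto)
      also have "\<dots> = \<delta>\<^sup>2 / 32 * (l * (\<alpha>' * c n))" by simp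
      also have "l * (\<alpha>' * c n) = (1 - \<delta>) * L" unfolding lB[symmetric] by (simp add: L_def power2_eq_square)
      also have "\<delta>\<^sup>2 / 32 * ((1 - \<delta>) * L) \<le> \<delta>\<^sup>2 / 32 * (1 * L)"
        using \<delta> L0 by (intro mult_left_mono mult_right_mono) auto
      finally show "2 * (\<bar>\<theta> * l\<bar> * (real (card I) * \<bar>\<mu>\<bar>)) \<le> \<delta>\<^sup>2 / 16 * L" by simp
      have "5 * \<kappa> * ((\<theta> * l)\<^sup>2 * B) = (5 * \<kappa>) * (\<theta>\<^sup>2 * L)" by (simp add: L_def power_mult_distrib)
      also have "\<dots> \<le> (5 * (\<delta>\<^sup>2 / 320)) * (4 * L)"
        using kb k0 t2 L0 by (intro mult_mono) auto
      finally show "5 * \<kappa> * ((\<theta> * l)\<^sup>2 * B) \<le> \<delta>\<^sup>2 / 16 * L" by (simp add: mult_ac)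
    qed
    finally show "\<bar>ln (\<integral>\<omega>. exp (\<theta> * l * Z \<omega>) \<partial>M) - \<theta>\<^sup>2 * (l\<^sup>2 * B) / 2\<bar> \<le> \<delta>\<^sup>2 / 8 * (l\<^sup>2 * B)"
      by (simp add: L_def power_mult_distrib mult_ac)
  next
    have "ln 4 \<le> \<delta>\<^sup>2 / 4 * (\<alpha>'\<^sup>2 / v)" using h4 v by (simp add: pos_le_divide_eq)
    also have "\<dots> \<le> \<delta>\<^sup>2 / 4 * L" using Ll by (intro mult_left_mono) auto
    finally show "ln 4 \<le> \<delta>\<^sup>2 / 4 * (l\<^sup>2 * B)" by (simp add: L_def)
  qed
  moreover have "exp (- (\<alpha>\<^sup>2 / (2 * v))) \<le> exp (- ((1 / 2 + \<delta> + \<delta>\<^sup>2 / 8) * (l\<^sup>2 * B))) / 2"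
  proof -
    have "(1 / 2 + \<delta> + \<delta>\<^sup>2 / 8) * L \<le> (1 / 2 + \<delta> + \<delta>\<^sup>2 / 8) * (\<alpha>'\<^sup>2 / ((1 - \<delta>) ^ 4 * v))"
      using Lu \<delta> by (intro mult_left_mono) auto
    also have "\<dots> = Q / (2 * v)" unfolding Q_def using v d1 by (simp add: field_simps)
    finally have 1: "(1 / 2 + \<delta> + \<delta>\<^sup>2 / 8) * L \<le> Q / (2 * v)" .
    have "ln 2 \<le> (\<alpha>\<^sup>2 - Q) / 2 / v" using h5 v by (simp add: pos_le_divide_eq)
    then have "Q / (2 * v) + ln 2 \<le> \<alpha>\<^sup>2 / (2 * v)" by (simp add: diff_divide_distrib)
    with 1 have "- (\<alpha>\<^sup>2 / (2 * v)) \<le> - ((1 / 2 + \<delta> + \<delta>\<^sup>2 / 8) * L) + - ln 2" by linarith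
    then have "exp (- (\<alpha>\<^sup>2 / (2 * v))) \<le> exp (- ((1 / 2 + \<delta> + \<delta>\<^sup>2 / 8) * L) + - ln 2)" by simp
    also have "\<dots> = exp (- ((1 / 2 + \<delta> + \<delta>\<^sup>2 / 8) * L)) / 2" unfolding exp_add by (simp add: exp_minus)
    finally show ?thesis by (simp add: L_def)
  qed
  moreover have "Z \<omega> = blinfun_apply f (\<Sum>i\<in>I. trunc (\<rho> * c n) (Xs i \<omega>))" for \<omega>
    unfolding Z_def Y_def a_def by (simp add: blinfun.sum_right)
  ultimately show ?thesis using f lB by (intro exI[of _ f]) auto
qed

end

context lil_geom
begin

definition blk :: "nat \<Rightarrow> nat set" where "blk k = {m k<..m (Suc k)}"

text \<open>There is nothing to prove if \<open>t \<le> \<gamma>\<close>. Otherwise \<open>\<alpha>\<^sup>2 / (2 * v) < - ln \<gamma>\<close> for the normalized variance \<open>v\<close>,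
  so \<open>v\<close> dominates \<open>sqrt \<rho>\<close> and the truncation at level \<open>\<rho>\<close> is negligible on the scale of \<open>v\<close>.\<close>

lemma block_events:
  assumes \<delta>: "0 < \<delta>" "\<delta> < 1" and r\<delta>: "1 / r \<le> \<delta>" and \<alpha>': "\<alpha>' > 0"
    and Q: "(1 + 2 * \<delta> + \<delta>\<^sup>2 / 4) * \<alpha>'\<^sup>2 / (1 - \<delta>) ^ 4 < \<alpha>\<^sup>2"
  defines "t \<equiv> \<lambda>k. real (m k) * alpha_term c H \<alpha> (m k)"
  shows "\<forall>\<^sub>F k in sequentially. \<exists>f :: 'b \<Rightarrow>\<^sub>L real. norm f \<le> 1 \<and>
     t (Suc k) - \<gamma> (Suc k) \<le> prob {\<omega>\<in>space M. \<alpha>' * c (m (Suc k)) \<le> blinfun_apply f (\<Sum>i\<in>blk k. trunc (a (Suc k)) (Xs i \<omega>))}"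
proof -
  define Q' where "Q' = (1 + 2 * \<delta> + \<delta>\<^sup>2 / 4) * \<alpha>'\<^sup>2 / (1 - \<delta>) ^ 4"
  have Q'0: "Q' \<ge> 0" unfolding Q'_def using \<delta> by (intro divide_nonneg_pos mult_nonneg_nonneg) auto
  have \<alpha>2: "\<alpha>\<^sup>2 > 0" using Q Q'0 unfolding Q'_def by linarith
  \<comment> \<open>Since \<open>\<gamma> = sqrt \<rho> ^ 16\<close>, the bound derived below is
    \<open>\<alpha>\<^sup>2 / (2 * v) <= 16 / sqrt \<rho>\<close>, that is
    \<open>sqrt \<rho> <= C * v\<close>.\<close>
  define C where "C = 32 / \<alpha>\<^sup>2"
  have C: "C > 0" using \<alpha>2 by (simp add: C_def)
  define v where "v k = real (m k) * H (c (m k)) / (c (m k))\<^sup>2" for k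
  have vt: "v \<longlonglongrightarrow> 0" unfolding v_def using LIMSEQ_subseq_LIMSEQ[OF H_tendsto m_strict] by (simp add: comp_def)
  have d1: "1 - \<delta> > 0" using \<delta> by simp
  have sq: "(\<lambda>k. sqrt (\<rho> k)) \<longlonglongrightarrow> 0" using tendsto_real_sqrt[OF \<rho>_tendsto] by simp
  have e1: "\<forall>\<^sub>F k in sequentially. C * sqrt (\<rho> k) < \<delta> / 2"
    by (rule order_tendstoD(2)[where y=0]) (use tendsto_mult[OF tendsto_const sq, of C] \<delta> in auto)
  have e2: "\<forall>\<^sub>F k in sequentially. real (m k) * R (a k) / c (m k) < \<alpha>' * \<delta>\<^sup>2 / 64"
    by (rule order_tendstoD(2)[OF drift_tendsto]) (use \<delta> \<alpha>' in auto)
  have e3: "\<forall>\<^sub>F k in sequentially. (2 * \<alpha>' * C / (1 - \<delta>) ^ 3) * sqrt (\<rho> k) < \<delta>\<^sup>2 / 320"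
    by (rule order_tendstoD(2)[where y=0]) (use tendsto_mult[OF tendsto_const sq, of "2 * \<alpha>' * C / (1 - \<delta>) ^ 3"] \<delta> in auto)
  have e4: "\<forall>\<^sub>F k in sequentially. ln 4 * v k < \<delta>\<^sup>2 / 4 * \<alpha>'\<^sup>2"
    by (rule order_tendstoD(2)[where y=0]) (use tendsto_mult[OF tendsto_const vt, of "ln 4"] \<delta> \<alpha>' in auto)
  have e5: "\<forall>\<^sub>F k in sequentially. ln 2 * v k < (\<alpha>\<^sup>2 - Q') / 2"
    by (rule order_tendstoD(2)[where y=0]) (use tendsto_mult[OF tendsto_const vt, of "ln 2"] Q in \<open>auto simp: Q'_def\<close>)
  \<comment> \<open>All index sets of nearly full size are treated at once, because the block with
    index \<open>k\<close> lives at the scale of \<open>Suc k\<close>; the shift is made at the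
    end.\<close>
  have "\<forall>\<^sub>F k in sequentially. \<forall>I. finite I \<longrightarrow> I \<subseteq> {1..} \<longrightarrow> card I \<le> m k \<longrightarrow> (1 - \<delta>) * real (m k) \<le> real (card I) \<longrightarrow>
     (\<exists>f :: 'b \<Rightarrow>\<^sub>L real. norm f \<le> 1 \<and>
     t k - \<gamma> k \<le> prob {\<omega>\<in>space M. \<alpha>' * c (m k) \<le> blinfun_apply f (\<Sum>i\<in>I. trunc (a k) (Xs i \<omega>))})"
    using e1 e2 e3 e4 e5 \<rho>_eventually G_div[of 2, simplified]
  proof eventually_elim
    case (elim k)
    show ?case
    proof (intro allI impI)
      fix I :: "nat set" assume I: "finite I" "I \<subseteq> {1..}" "card I \<le> m k" "(1 - \<delta>) * real (m k) \<le> real (card I)"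
      show "\<exists>f :: 'b \<Rightarrow>\<^sub>L real. norm f \<le> 1 \<and>
        t k - \<gamma> k \<le> prob {\<omega>\<in>space M. \<alpha>' * c (m k) \<le> blinfun_apply f (\<Sum>i\<in>I. trunc (a k) (Xs i \<omega>))}"
      proof (cases "t k \<le> \<gamma> k")
        case True
        then show ?thesis by (intro exI[of _ 0]) (auto intro: order_trans[OF _ measure_nonneg])
      next
        case False
        have g0: "\<gamma> k > 0" by (rule \<gamma>_pos)
        have mk: "real (m k) > 0" using m_ge1[of k] by simp
        have cm: "c (m k) > 0" by (rule cm_pos)
        have H0: "H (c (m k)) \<noteq> 0"
        proof
          assume "H (c (m k)) = 0"
          then have "t k = 0" using cm \<alpha>2 by (simp add: t_def alpha_term_def)
          then show False using False g0 by simp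
        qed
        then have H1: "H (c (m k)) > 0" using H_nonneg[of "c (m k)"] cm by (simp add: less_le)
        have v0: "v k > 0" unfolding v_def using H1 mk cm by simp
        have tk: "t k = exp (- (\<alpha>\<^sup>2 / (2 * v k)))"
          using H0 mk cm by (simp add: t_def alpha_term_def v_def)
        have sp: "sqrt (\<rho> k) > 0" using \<rho>_pos[of k] by simp
        \<comment> \<open>\<open>\<rho>\<close> is split into two square roots: one is bounded by
          \<open>C * v\<close>, the other tends to \<open>0\<close> and absorbs the
          constants.\<close>
        have rs: "\<rho> k = sqrt (\<rho> k) * sqrt (\<rho> k)" using \<rho>_pos[of k] by simp
        have g16: "\<gamma> k = sqrt (\<rho> k) ^ 16"
        proof -
          have "sqrt (\<rho> k) ^ 16 = ((sqrt (\<rho> k))\<^sup>2) ^ 8" by (simp flip: power_mult)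
          then show ?thesis using elim(6) \<rho>_pos[of k] by simp
        qed
        have "\<gamma> k < exp (- (\<alpha>\<^sup>2 / (2 * v k)))" using False tk by simp
        then have "ln (\<gamma> k) < ln (exp (- (\<alpha>\<^sup>2 / (2 * v k))))" using g0 by (subst ln_less_cancel_iff) auto
        then have "\<alpha>\<^sup>2 / (2 * v k) < - ln (\<gamma> k)" by simp
        also have "- ln (\<gamma> k) = 16 * ln (1 / sqrt (\<rho> k))" unfolding g16 using sp by (simp add: ln_realpow ln_div)
        also have "\<dots> \<le> 16 * (1 / sqrt (\<rho> k))" using sp ln_le_minus_one[of "1 / sqrt (\<rho> k)"] by simp
        finally have "\<alpha>\<^sup>2 / (2 * v k) \<le> 16 / sqrt (\<rho> k)" by simp
        then have sv: "sqrt (\<rho> k) \<le> C * v k" using v0 sp \<alpha>2 by (simp add: C_def field_simps)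
        have inv: "sqrt (\<rho> k) / v k \<le> C" using sv v0 by (simp add: pos_divide_le_eq)
        have h1: "G (m k) / (\<rho> k)\<^sup>2 \<le> \<delta> / 2 * v k"
        proof -
          have "G (m k) / (\<rho> k)\<^sup>2 \<le> \<rho> k ^ 6" using elim(7) by simp
          also have "\<dots> \<le> \<rho> k" using power_decreasing[of 1 6 "\<rho> k"] \<rho>_pos[of k] \<rho>_le1[of k] by simp
          also have "\<dots> = sqrt (\<rho> k) * sqrt (\<rho> k)" by (rule rs)
          also have "\<dots> \<le> sqrt (\<rho> k) * (C * v k)" using sv sp by (intro mult_left_mono) auto
          also have "\<dots> = (C * sqrt (\<rho> k)) * v k" by simp
          also have "\<dots> \<le> \<delta> / 2 * v k" using elim(1) v0 by (intro mult_right_mono) auto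
          finally show ?thesis .
        qed
        have h3: "2 * \<rho> k * \<alpha>' / ((1 - \<delta>) ^ 3 * v k) \<le> \<delta>\<^sup>2 / 320"
        proof -
          have "2 * \<rho> k * \<alpha>' / ((1 - \<delta>) ^ 3 * v k) = (2 * \<alpha>' / (1 - \<delta>) ^ 3 * sqrt (\<rho> k)) * (sqrt (\<rho> k) / v k)"
            by (subst rs) simp
          also have "\<dots> \<le> (2 * \<alpha>' / (1 - \<delta>) ^ 3 * sqrt (\<rho> k)) * C"
            using inv sp \<alpha>' d1 by (intro mult_left_mono mult_nonneg_nonneg) auto
          also have "\<dots> = (2 * \<alpha>' * C / (1 - \<delta>) ^ 3) * sqrt (\<rho> k)" by simp
          finally show ?thesis using elim(3) by linarith
        qed
        have "\<exists>f :: 'b \<Rightarrow>\<^sub>L real. norm f \<le> 1 \<and>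
            exp (- (\<alpha>\<^sup>2 / (2 * (real (m k) * H (c (m k)) / (c (m k))\<^sup>2)))) \<le> prob {\<omega>\<in>space M. \<alpha>' * c (m k) \<le> blinfun_apply f (\<Sum>i\<in>I. trunc (\<rho> k * c (m k)) (Xs i \<omega>))}"
        proof (rule block_prob[OF m_ge1 \<rho>_pos \<rho>_le1 I \<delta> \<alpha>'])
          show "0 < real (m k) * H (c (m k)) / (c (m k))\<^sup>2" using v0 by (simp add: v_def)
          show "G (m k) / (\<rho> k)\<^sup>2 \<le> \<delta> / 2 * (real (m k) * H (c (m k)) / (c (m k))\<^sup>2)" using h1 by (simp add: v_def)
          show "real (m k) * R (\<rho> k * c (m k)) / c (m k) \<le> \<alpha>' * \<delta>\<^sup>2 / 64" using elim(2) by (simp add: a_def)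
          show "2 * \<rho> k * \<alpha>' / ((1 - \<delta>) ^ 3 * (real (m k) * H (c (m k)) / (c (m k))\<^sup>2)) \<le> \<delta>\<^sup>2 / 320" using h3 unfolding v_def .
          show "ln 4 * (real (m k) * H (c (m k)) / (c (m k))\<^sup>2) \<le> \<delta>\<^sup>2 / 4 * \<alpha>'\<^sup>2" using elim(4) unfolding v_def by simp
          show "ln 2 * (real (m k) * H (c (m k)) / (c (m k))\<^sup>2) \<le> (\<alpha>\<^sup>2 - (1 + 2 * \<delta> + \<delta>\<^sup>2 / 4) * \<alpha>'\<^sup>2 / (1 - \<delta>) ^ 4) / 2"
            using elim(5) unfolding v_def Q'_def by simp
        qed
        then obtain f :: "'b \<Rightarrow>\<^sub>L real" where f: "norm f \<le> 1" "t k \<le> prob {\<omega>\<in>space M. \<alpha>' * c (m k) \<le> blinfun_apply f (\<Sum>i\<in>I. trunc (a k) (Xs i \<omega>))}"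
          unfolding tk v_def a_def by blast
        then show ?thesis using g0 by (intro exI[of _ f]) auto
      qed
    qed
  qed
  then have "\<forall>\<^sub>F k in sequentially. \<forall>I. finite I \<longrightarrow> I \<subseteq> {1..} \<longrightarrow> card I \<le> m (Suc k) \<longrightarrow> (1 - \<delta>) * real (m (Suc k)) \<le> real (card I) \<longrightarrow>
     (\<exists>f :: 'b \<Rightarrow>\<^sub>L real. norm f \<le> 1 \<and>
     t (Suc k) - \<gamma> (Suc k) \<le> prob {\<omega>\<in>space M. \<alpha>' * c (m (Suc k)) \<le> blinfun_apply f (\<Sum>i\<in>I. trunc (a (Suc k)) (Xs i \<omega>))})"
    by (rule eventually_compose_filterlim[OF _ filterlim_Suc])
  then show ?thesis
  proof eventually_elim
    case (elim k)
    have lt: "m k < m (Suc k)" using m_strict by (simp add: strict_mono_less)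
    have mp: "real (m (Suc k)) > 0" using lt by simp
    have "real (m k) \<le> (1 / r) * real (m (Suc k))" using m_step[of k] r by (simp add: field_simps)
    also have "\<dots> \<le> \<delta> * real (m (Suc k))" using r\<delta> by (intro mult_right_mono) auto
    finally have "(1 - \<delta>) * real (m (Suc k)) \<le> real (card (blk k))" using lt by (simp add: blk_def algebra_simps of_nat_diff)
    moreover have "finite (blk k)" "blk k \<subseteq> {1..}" "card (blk k) \<le> m (Suc k)" by (auto simp: blk_def)
    ultimately show ?case using elim by blast
  qed
qed

text \<open>If \<open>norm (S n) / c n\<close> stayed below \<open>b\<close>, this would hold at
  both ends of each block; as \<open>c (m k) <= sqrt \<delta> * c (m (Suc k))\<close>, the block sum
  would eventually miss the level \<open>\<alpha>' * c (m (Suc k))\<close>, although the independent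
  events occur infinitely often.\<close>

lemma lower_blocks:
  assumes \<delta>: "0 < \<delta>" "\<delta> < 1" and r\<delta>: "1 / r \<le> \<delta>" and \<alpha>': "\<alpha>' > 0"
    and Q: "(1 + 2 * \<delta> + \<delta>\<^sup>2 / 4) * \<alpha>'\<^sup>2 / (1 - \<delta>) ^ 4 < \<alpha>\<^sup>2"
    and ns: "\<not> summable (\<lambda>k. real (m k) * alpha_term c H \<alpha> (m k))"
  shows "AE \<omega> in M. ereal ((\<alpha>' - 2 * \<delta>) / (1 + sqrt \<delta>)) \<le> limsup (\<lambda>n. ereal (norm (S n \<omega>) / c n))"
proof -
  define t where "t k = real (m k) * alpha_term c H \<alpha> (m k)" for k
  define E where "E f k = {\<omega>\<in>space M. \<alpha>' * c (m (Suc k)) \<le> blinfun_apply f (\<Sum>i\<in>blk k. trunc (a (Suc k)) (Xs i \<omega>))}"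
    for f :: "'b \<Rightarrow>\<^sub>L real" and k
  define f where "f k = (SOME f :: 'b \<Rightarrow>\<^sub>L real. norm f \<le> 1 \<and> t (Suc k) - \<gamma> (Suc k) \<le> prob (E f k))" for k
  have ev: "\<forall>\<^sub>F k in sequentially. norm (f k) \<le> 1 \<and> t (Suc k) - \<gamma> (Suc k) \<le> prob (E (f k) k)"
    using block_events[OF \<delta> r\<delta> \<alpha>' Q]
  proof eventually_elim
    case (elim k)
    then have "\<exists>f :: 'b \<Rightarrow>\<^sub>L real. norm f \<le> 1 \<and> t (Suc k) - \<gamma> (Suc k) \<le> prob (E f k)"
      unfolding E_def t_def .
    then show ?case unfolding f_def by (rule someI_ex)
  qed
  have ns': "\<not> summable (\<lambda>k. prob (E (f k) k))"
  proof
    assume s: "summable (\<lambda>k. prob (E (f k) k))"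
    \<comment> \<open>\<open>\<gamma>\<close> is summable, so the correction in
      \<open>block_events\<close> does not destroy divergence.\<close>
    have gs: "summable (\<lambda>k. \<gamma> (Suc k))" using \<gamma>_summable by (simp add: summable_Suc_iff)
    have t0: "t k \<ge> 0" for k by (simp add: t_def alpha_term_def)
    have "summable (\<lambda>k. t (Suc k))"
    proof (rule summable_comparison_test_ev[OF _ summable_add[OF s gs]])
      show "\<forall>\<^sub>F k in sequentially. norm (t (Suc k)) \<le> prob (E (f k) k) + \<gamma> (Suc k)"
        using ev by eventually_elim (use t0 in auto)
    qed
    then have "summable t" by (rule summable_Suc_iff[THEN iffD1])
    then show False using ns by (simp add: t_def[abs_def])
  qed
  have blk1: "blk k \<subseteq> {1..}" "finite (blk k)" for k by (auto simp: blk_def)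
  have dis: "disjoint_family_on blk UNIV"
  proof -
    have "blk i \<inter> blk j = {}" if "i < j" for i j
    proof -
      have "m (Suc i) \<le> m j" using that m_strict by (simp add: strict_mono_less_eq)
      then show ?thesis by (auto simp: blk_def)
    qed
    then show ?thesis unfolding disjoint_family_on_def by (metis inf_commute linorder_neqE_nat)
  qed
  have ind: "indep_events (\<lambda>k. E (f k) k) UNIV"
  proof -
    define Z where "Z k x = blinfun_apply (f k) (\<Sum>i\<in>blk k. trunc (a (Suc k)) (x i))" for k and x :: "nat \<Rightarrow> 'b"
    have "indep_vars (\<lambda>k. PiM (blk k) (\<lambda>_. borel)) (\<lambda>k \<omega>. restrict (\<lambda>i. Xs i \<omega>) (blk k)) UNIV"
      by (rule indep_vars_restrict[OF Xs_indep blk1(1) dis])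
    then have "indep_vars (\<lambda>_. borel) (\<lambda>k \<omega>. Z k (restrict (\<lambda>i. Xs i \<omega>) (blk k))) UNIV"
    proof (rule indep_vars_compose2)
      fix k
      have [measurable]: "(\<lambda>x. \<Sum>i\<in>blk k. trunc (a (Suc k)) (x i)) \<in> borel_measurable (PiM (blk k) (\<lambda>_. borel))"
        by (intro borel_measurable_sum) measurable
      show "Z k \<in> borel_measurable (PiM (blk k) (\<lambda>_. borel))" unfolding Z_def by measurable
    qed
    moreover have "Z k (restrict (\<lambda>i. Xs i \<omega>) (blk k)) = blinfun_apply (f k) (\<Sum>i\<in>blk k. trunc (a (Suc k)) (Xs i \<omega>))" for k \<omega>
      by (simp add: Z_def)
    ultimately have "indep_vars (\<lambda>_. borel) (\<lambda>k \<omega>. blinfun_apply (f k) (\<Sum>i\<in>blk k. trunc (a (Suc k)) (Xs i \<omega>))) UNIV" by simp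
    then show ?thesis unfolding E_def
      by (rule indep_eventsI_indep_vars) auto
  qed
  \<comment> \<open>Solves \<open>b * (1 + sqrt \<delta>) + 2 * \<delta> = \<alpha>'\<close>: the
    two ends of a block contribute \<open>1\<close> and \<open>sqrt \<delta>\<close>, the two
    truncation errors \<open>\<delta>\<close> each.\<close>
  define b where "b = (\<alpha>' - 2 * \<delta>) / (1 + sqrt \<delta>)"
  have s1: "1 + sqrt \<delta> > 0" using \<delta> by (simp add: add_pos_nonneg)
  show ?thesis
    using borel_cantelli_2[OF ind ns'] truncation_approx[OF \<delta>(1) less_imp_le[OF \<delta>(2)]]
  proof eventually_elim
    case (elim \<omega>)
    have apS: "\<forall>\<^sub>F k in sequentially. \<forall>j\<le>m (Suc k). norm (S j \<omega> - (\<Sum>i\<in>{1..j}. trunc (a (Suc k)) (Xs i \<omega>))) \<le> \<delta> * c (m (Suc k))"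
      using elim(2) by (rule eventually_compose_filterlim[OF _ filterlim_Suc])
    show "ereal ((\<alpha>' - 2 * \<delta>) / (1 + sqrt \<delta>)) \<le> limsup (\<lambda>n. ereal (norm (S n \<omega>) / c n))"
    proof (rule ccontr)
      assume "\<not> ?thesis"
      then have "limsup (\<lambda>n. ereal (norm (S n \<omega>) / c n)) < ereal b" by (simp add: b_def)
      then have evb: "\<forall>\<^sub>F n in sequentially. ereal (norm (S n \<omega>) / c n) < ereal b" by (rule Limsup_lessD)
      have ev1: "\<forall>\<^sub>F k in sequentially. norm (S (m k) \<omega>) / c (m k) < b"
        using eventually_compose_filterlim[OF evb m_tendsto] by simp
      have ev2: "\<forall>\<^sub>F k in sequentially. norm (S (m (Suc k)) \<omega>) / c (m (Suc k)) < b"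
        using eventually_compose_filterlim[OF ev1 filterlim_Suc] .
      have "\<forall>\<^sub>F k in sequentially. \<omega> \<notin> E (f k) k"
        using ev1 ev2 apS ev
      proof eventually_elim
        case (elim k)
        have lt: "m k < m (Suc k)" using m_strict by (simp add: strict_mono_less)
        have c1: "c (m k) > 0" "c (m (Suc k)) > 0" by (rule cm_pos)+
        have fn: "norm (f k) \<le> 1" using elim(4) by blast
        have n1: "norm (S (m k) \<omega>) < b * c (m k)" "norm (S (m (Suc k)) \<omega>) < b * c (m (Suc k))"
          using elim(1,2) c1 by (simp_all add: pos_divide_less_eq)
        \<comment> \<open>\<open>\<alpha>'\<close> may be smaller than \<open>2 * \<delta>\<close>;
          but here a norm lies below \<open>b * c (m k)\<close>, which excludes a negative
          \<open>b\<close>.\<close>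
        have b0: "b \<ge> 0"
        proof (rule ccontr)
          assume "\<not> b \<ge> 0"
          then have "b * c (m k) < 0" using c1 by (intro mult_neg_pos) auto
          then show False using n1(1) norm_ge_zero[of "S (m k) \<omega>"] by linarith
        qed
        have cr: "c (m k) \<le> sqrt \<delta> * c (m (Suc k))"
        proof -
          have mp: "real (m (Suc k)) > 0" using lt by simp
          have "c (m k) \<le> sqrt (real (m k) / real (m (Suc k))) * c (m (Suc k))" using lt m_ge1[of k] by (intro c_ratio) auto
          also have "\<dots> \<le> sqrt \<delta> * c (m (Suc k))"
          proof (intro mult_right_mono real_sqrt_le_mono)
            have "real (m k) / real (m (Suc k)) \<le> 1 / r" using m_step[of k] r mp by (simp add: field_simps)
            then show "real (m k) / real (m (Suc k)) \<le> \<delta>" using r\<delta> by linarith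
          qed (use c1 in simp)
          finally show ?thesis .
        qed
        define x where "x = S (m (Suc k)) \<omega> - (\<Sum>i\<in>{1..m (Suc k)}. trunc (a (Suc k)) (Xs i \<omega>))"
        define y where "y = S (m k) \<omega> - (\<Sum>i\<in>{1..m k}. trunc (a (Suc k)) (Xs i \<omega>))"
        define w where "w = (\<Sum>i\<in>blk k. trunc (a (Suc k)) (Xs i \<omega>))"
        have xy: "norm x \<le> \<delta> * c (m (Suc k))" "norm y \<le> \<delta> * c (m (Suc k))"
          unfolding x_def y_def using elim(3) lt by auto
        have "(\<Sum>i\<in>{1..m (Suc k)}. trunc (a (Suc k)) (Xs i \<omega>)) = (\<Sum>i\<in>{1..m k}. trunc (a (Suc k)) (Xs i \<omega>)) + w"
        proof -
          have "{1..m (Suc k)} = {1..m k} \<union> blk k" using lt by (auto simp: blk_def)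
          then show ?thesis unfolding w_def by (subst sum.union_disjoint[symmetric]) (auto simp: blk_def)
        qed
        then have weq: "w = (S (m (Suc k)) \<omega> - S (m k) \<omega>) - (x - y)" by (simp add: x_def y_def)
        have "blinfun_apply (f k) w \<le> norm w" using abs_blinfun_le[OF fn, of w] by simp
        also have "\<dots> \<le> norm (S (m (Suc k)) \<omega> - S (m k) \<omega>) + norm (x - y)" unfolding weq by (rule norm_triangle_ineq4)
        also have "\<dots> \<le> (norm (S (m (Suc k)) \<omega>) + norm (S (m k) \<omega>)) + (norm x + norm y)"
          by (intro add_mono norm_triangle_ineq4)
        also have "\<dots> < (b * c (m (Suc k)) + b * c (m k)) + (\<delta> * c (m (Suc k)) + \<delta> * c (m (Suc k)))"
          using n1 xy by linarith
        also have "\<dots> \<le> (b * c (m (Suc k)) + b * (sqrt \<delta> * c (m (Suc k)))) + (\<delta> * c (m (Suc k)) + \<delta> * c (m (Suc k)))"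
          using cr b0 \<delta> by (intro add_mono mult_left_mono) auto
        also have "\<dots> = (b * (1 + sqrt \<delta>) + 2 * \<delta>) * c (m (Suc k))" by (simp add: algebra_simps)
        also have "b * (1 + sqrt \<delta>) + 2 * \<delta> = \<alpha>'" using s1 by (simp add: b_def)
        finally show ?case unfolding E_def w_def by simp
      qed
      then show False using elim(1) by (simp add: frequently_def)
    qed
  qed
qed

end

subsection \<open>The two bounds\<close>

lemma summable_even_odd:
  fixes f :: "nat \<Rightarrow> real"
  assumes f: "\<And>k. f k \<ge> 0" and e: "summable (\<lambda>k. f (2 * k))" and o: "summable (\<lambda>k. f (2 * k + 1))"
  shows "summable f"
proof (rule summableI_nonneg_bounded[OF f])
  fix K
  have "(\<Sum>k<K. f k) \<le> (\<Sum>k<2 * K. f k)" by (rule sum_mono2) (use f in auto)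
  also have "\<dots> = (\<Sum>k<K. f (2 * k) + f (2 * k + 1))" by (induction K) auto
  also have "\<dots> = (\<Sum>k<K. f (2 * k)) + (\<Sum>k<K. f (2 * k + 1))" by (rule sum.distrib)
  also have "\<dots> \<le> (\<Sum>k. f (2 * k)) + (\<Sum>k. f (2 * k + 1))"
    by (intro add_mono sum_le_suminf e o) (use f in auto)
  finally show "(\<Sum>k<K. f k) \<le> (\<Sum>k. f (2 * k)) + (\<Sum>k. f (2 * k + 1))" .
qed

context lil_setup
begin

lemma limsup_nonneg: "limsup (\<lambda>n. ereal (norm (S n \<omega>) / c n)) \<ge> 0"
proof (rule le_Limsup)
  show "\<forall>\<^sub>F n in sequentially. 0 \<le> ereal (norm (S n \<omega>) / c n)"
    using eventually_ge_at_top[of 1] by eventually_elim (use c_pos in \<open>auto simp: less_imp_le\<close>)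
qed simp

lemma alpha_term_nonneg: "alpha_term c H \<alpha> n \<ge> 0" by (simp add: alpha_term_def)

text \<open>The series has weights \<open>1 / n\<close> and factors without known monotonicity, so a
  fixed geometric sequence might miss the large ones. On \<open>{R ^ k..<R ^ Suc k}\<close> the
  weights sum to at most \<open>R\<close>, so the largest factors of these intervals already
  diverge.\<close>

lemma block_maximizers:
  fixes R :: nat
  assumes R: "R \<ge> 2" and ns: "\<not> summable (\<lambda>n. alpha_term c H \<alpha> (Suc n))"
  obtains N where "\<And>k. R ^ k \<le> N k" "\<And>k. N k < R ^ Suc k"
    "\<not> summable (\<lambda>k. real (N k) * alpha_term c H \<alpha> (N k))"
proof -
  define t where "t n = real n * alpha_term c H \<alpha> n" for n
  define D where "D k = {R ^ k..<R ^ Suc k}" for k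
  have Rk: "R ^ k < R ^ Suc k" "R ^ k \<ge> 1" for k using R by auto
  have "\<exists>n\<in>D k. \<forall>n'\<in>D k. t n' \<le> t n" for k
  proof -
    have fin: "finite (t ` D k)" "t ` D k \<noteq> {}" using Rk[of k] by (auto simp: D_def)
    then obtain n where "n \<in> D k" "t n = Max (t ` D k)" using Max_in by (metis imageE)
    then show ?thesis using fin(1) by (intro bexI[of _ n]) auto
  qed
  then obtain N where N: "\<And>k. N k \<in> D k" "\<And>k n'. n' \<in> D k \<Longrightarrow> t n' \<le> t (N k)" by metis
  have blk: "(\<Sum>n\<in>D k. alpha_term c H \<alpha> n) \<le> real R * t (N k)" for k
  proof -
    have t0: "t (N k) \<ge> 0" by (simp add: t_def alpha_term_nonneg)
    have p: "real (R ^ k) > 0" using R by simp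
    have "(\<Sum>n\<in>D k. alpha_term c H \<alpha> n) \<le> (\<Sum>n\<in>D k. t (N k) / real (R ^ k))"
    proof (rule sum_mono)
      fix n assume n: "n \<in> D k"
      then have n1: "real n \<ge> real (R ^ k)" by (simp add: D_def del: of_nat_power)
      have np: "real n > 0" using n1 p by linarith
      then have "alpha_term c H \<alpha> n = t n / real n" by (simp add: t_def)
      also have "\<dots> \<le> t (N k) / real n" using N(2)[OF n] by (intro divide_right_mono) auto
      also have "\<dots> \<le> t (N k) / real (R ^ k)" using n1 p t0 np by (intro divide_left_mono mult_pos_pos)
      finally show "alpha_term c H \<alpha> n \<le> t (N k) / real (R ^ k)" .
    qed
    also have "\<dots> = real (card (D k)) * (t (N k) / real (R ^ k))" by simp
    also have "\<dots> \<le> real (R ^ Suc k) * (t (N k) / real (R ^ k))"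
      using t0 p by (intro mult_right_mono) (auto simp: D_def simp del: of_nat_power power_Suc)
    also have "\<dots> = real R * t (N k)" using p by simp
    finally show ?thesis .
  qed
  have cat: "(\<Sum>k<K. \<Sum>n\<in>D k. alpha_term c H \<alpha> n) = (\<Sum>n\<in>{1..<R ^ K}. alpha_term c H \<alpha> n)" for K
  proof (induction K)
    case (Suc K)
    have "(\<Sum>n\<in>{1..<R ^ K}. alpha_term c H \<alpha> n) + (\<Sum>n\<in>{R ^ K..<R ^ Suc K}. alpha_term c H \<alpha> n)
      = (\<Sum>n\<in>{1..<R ^ Suc K}. alpha_term c H \<alpha> n)"
      using Rk[of K] by (intro sum.atLeastLessThan_concat) auto
    then show ?case using Suc by (simp add: D_def del: power_Suc)
  qed simp
  have "\<not> summable (\<lambda>k. t (N k))"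
  proof
    assume s: "summable (\<lambda>k. t (N k))"
    have "summable (\<lambda>n. alpha_term c H \<alpha> (Suc n))"
    proof (rule summableI_nonneg_bounded[OF alpha_term_nonneg])
      fix n
      have "(\<Sum>i<n. alpha_term c H \<alpha> (Suc i)) = (\<Sum>i\<in>{1..<Suc n}. alpha_term c H \<alpha> i)"
        using sum.shift_bounds_Suc_ivl[of "alpha_term c H \<alpha>" 0 n] by (simp add: atLeast0LessThan)
      also have "\<dots> \<le> (\<Sum>i\<in>{1..<R ^ n}. alpha_term c H \<alpha> i)"
      proof (rule sum_mono2)
        have "n < 2 ^ n" by (rule less_exp)
        also have "(2::nat) ^ n \<le> R ^ n" using R by (rule power_mono) simp
        finally show "{1..<Suc n} \<subseteq> {1..<R ^ n}" by auto
      qed (auto simp: alpha_term_nonneg)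
      also have "\<dots> \<le> (\<Sum>k<n. real R * t (N k))" unfolding cat[symmetric] by (intro sum_mono blk)
      also have "\<dots> = real R * (\<Sum>k<n. t (N k))" by (simp add: sum_distrib_left)
      also have "\<dots> \<le> real R * (\<Sum>k. t (N k))"
        by (intro mult_left_mono sum_le_suminf s) (auto simp: t_def alpha_term_nonneg)
      finally show "(\<Sum>i<n. alpha_term c H \<alpha> (Suc i)) \<le> real R * (\<Sum>k. t (N k))" .
    qed
    then show False using ns by simp
  qed
  then show thesis using N(1) by (intro that[of N]) (auto simp: D_def t_def)
qed

text \<open>Keeping only every other maximizer makes the sequence grow geometrically with ratio \<open>R\<close>.\<close>

lemma lower_delta:
  assumes \<delta>: "0 < \<delta>" "\<delta> < 1" and \<alpha>': "\<alpha>' > 0"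
    and Q: "(1 + 2 * \<delta> + \<delta>\<^sup>2 / 4) * \<alpha>'\<^sup>2 / (1 - \<delta>) ^ 4 < \<alpha>\<^sup>2"
    and ns: "\<not> summable (\<lambda>n. alpha_term c H \<alpha> (Suc n))"
  shows "AE \<omega> in M. ereal ((\<alpha>' - 2 * \<delta>) / (1 + sqrt \<delta>)) \<le> limsup (\<lambda>n. ereal (norm (S n \<omega>) / c n))"
proof -
  obtain R0 :: nat where R0: "1 / \<delta> \<le> real R0" using real_arch_simple by blast
  define R where "R = max R0 2"
  have R: "R \<ge> 2" "1 / \<delta> \<le> real R" using R0 by (auto simp: R_def)
  obtain N where N: "\<And>k. R ^ k \<le> N k" "\<And>k. N k < R ^ Suc k"
    and nsN: "\<not> summable (\<lambda>k. real (N k) * alpha_term c H \<alpha> (N k))"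
    using block_maximizers[OF R(1) ns] by metis
  \<comment> \<open>\<open>p\<close> is a parity for which the maximizers still carry the
    divergence.\<close>
  obtain p where nsp: "\<not> summable (\<lambda>k. real (N (2 * k + p)) * alpha_term c H \<alpha> (N (2 * k + p)))"
  proof -
    have "\<not> summable (\<lambda>k. real (N (2 * k)) * alpha_term c H \<alpha> (N (2 * k))) \<or>
       \<not> summable (\<lambda>k. real (N (2 * k + 1)) * alpha_term c H \<alpha> (N (2 * k + 1)))"
      using summable_even_odd[of "\<lambda>k. real (N k) * alpha_term c H \<alpha> (N k)"] nsN alpha_term_nonneg by fastforce
    then show thesis using that[of 0] that[of 1] by auto
  qed
  define m where "m k = N (2 * k + p)" for k
  interpret lil_geom M X Xs c m "real R"
  proof unfold_locales
    show "1 < real R" using R by simp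
    have "1 \<le> R ^ p" using R by simp
    then show "1 \<le> m 0" using N(1)[of p] unfolding m_def by simp
    fix k
    \<comment> \<open>A full interval lies between two maximizers that are kept, which gives the
      ratio \<open>R\<close>.\<close>
    have "R * m k \<le> R * R ^ Suc (2 * k + p)" using N(2)[of "2 * k + p"] by (simp add: m_def)
    also have "\<dots> = R ^ (2 * Suc k + p)" by simp
    also have "\<dots> \<le> m (Suc k)" unfolding m_def by (rule N(1))
    finally show "real R * real (m k) \<le> real (m (Suc k))" by (simp flip: of_nat_mult)
  qed
  have "1 / real R \<le> \<delta>" using R \<delta> by (simp add: field_simps)
  then show ?thesis
    by (rule lower_blocks[OF \<delta> _ \<alpha>' Q]) (use nsp in \<open>simp add: m_def\<close>)
qed

text \<open>\<open>\<delta>\<close> tends to \<open>0\<close> with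
  \<open>\<alpha>' = \<alpha> * (1 - \<delta>) ^ 4\<close>; this power satisfies the condition on
  \<open>\<alpha>'\<close> since \<open>(1 + \<delta>)\<^sup>2 * (1 - \<delta>) ^ 4 < 1\<close>.
  Countably many values of \<open>\<delta>\<close> keep the exceptional set null.\<close>

lemma alpha_lower_single:
  assumes \<alpha>: "\<alpha> \<ge> 0" and ns: "\<not> summable (\<lambda>n. alpha_term c H \<alpha> (Suc n))"
  shows "AE \<omega> in M. ereal \<alpha> \<le> limsup (\<lambda>n. ereal (norm (S n \<omega>) / c n))"
proof (cases "\<alpha> = 0")
  case True
  then show ?thesis using limsup_nonneg by (simp add: zero_ereal_def[symmetric])
next
  case False
  with \<alpha> have \<alpha>: "\<alpha> > 0" by simp
  define \<delta> where "\<delta> j = 1 / real (j + 2)" for j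
  have d: "0 < \<delta> j" "\<delta> j < 1" for j by (auto simp: \<delta>_def)
  have "(\<lambda>j. 1 / real (j + 2)) \<longlonglongrightarrow> 0"
    using LIMSEQ_ignore_initial_segment[OF lim_1_over_n, of 2] .
  then have dt: "\<delta> \<longlonglongrightarrow> 0" by (simp add: \<delta>_def[abs_def])
  define b where "b j = (\<alpha> * (1 - \<delta> j) ^ 4 - 2 * \<delta> j) / (1 + sqrt (\<delta> j))" for j
  have "b \<longlonglongrightarrow> (\<alpha> * (1 - 0) ^ 4 - 2 * 0) / (1 + sqrt 0)"
    unfolding b_def by (intro tendsto_intros dt) auto
  then have bt: "(\<lambda>j. ereal (b j)) \<longlonglongrightarrow> ereal \<alpha>" by simp
  have "AE \<omega> in M. ereal (b j) \<le> limsup (\<lambda>n. ereal (norm (S n \<omega>) / c n))" for j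
    unfolding b_def
  proof (rule lower_delta[OF d _ _ ns])
    define x where "x = \<delta> j"
    have x: "0 < x" "x < 1" using d[of j] by (auto simp: x_def)
    show "0 < \<alpha> * (1 - \<delta> j) ^ 4" using \<alpha> d[of j] by simp
    have "(1 + 2 * x + x\<^sup>2 / 4) * (1 - x) ^ 4 \<le> (1 + x)\<^sup>2 * (1 - x) ^ 4"
      by (intro mult_right_mono) (auto simp: power2_eq_square algebra_simps)
    also have "\<dots> = (1 - x\<^sup>2)\<^sup>2 * (1 - x)\<^sup>2" by (simp add: power4_eq_xxxx power2_eq_square algebra_simps)
    also have "\<dots> \<le> 1 * (1 - x)\<^sup>2"
    proof (rule mult_right_mono)
      have "0 \<le> x\<^sup>2" "x\<^sup>2 \<le> 1" using x by (auto simp: power_le_one)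
      then show "(1 - x\<^sup>2)\<^sup>2 \<le> 1" by (intro power_le_one) auto
    qed simp
    also have "\<dots> < 1" using x by (simp add: power_less_one_iff)
    finally have lt: "(1 + 2 * x + x\<^sup>2 / 4) * (1 - x) ^ 4 < 1" .
    have "(1 + 2 * x + x\<^sup>2 / 4) * (\<alpha> * (1 - x) ^ 4)\<^sup>2 / (1 - x) ^ 4 = \<alpha>\<^sup>2 * ((1 + 2 * x + x\<^sup>2 / 4) * (1 - x) ^ 4)"
      using x by (simp add: power_mult_distrib power2_eq_square)
    also have "\<dots> < \<alpha>\<^sup>2 * 1" using lt \<alpha> by (intro mult_strict_left_mono) auto
    finally show "(1 + 2 * \<delta> j + (\<delta> j)\<^sup>2 / 4) * (\<alpha> * (1 - \<delta> j) ^ 4)\<^sup>2 / (1 - \<delta> j) ^ 4 < \<alpha>\<^sup>2" by (simp add: x_def)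
  qed
  then have "AE \<omega> in M. \<forall>j. ereal (b j) \<le> limsup (\<lambda>n. ereal (norm (S n \<omega>) / c n))" by (simp add: AE_all_countable)
  then show ?thesis
  proof eventually_elim
    case (elim \<omega>)
    then show ?case by (intro LIMSEQ_le_const2[OF bt]) auto
  qed
qed

text \<open>The set defining the supremum may be uncountable; a countable subset has the same
  supremum, so the exceptional null sets can be united.\<close>

lemma alpha_lower: "AE \<omega> in M. alpha0 c H \<le> limsup (\<lambda>n. ereal (norm (S n \<omega>) / c n))"
proof -
  define A where "A = {\<alpha>. \<alpha> \<ge> 0 \<and> \<not> summable (\<lambda>n. alpha_term c H \<alpha> (Suc n))}"
  show ?thesis
  proof (cases "A = {}")
    case True
    then show ?thesis unfolding alpha0_def A_def[symmetric] by (simp add: bot_ereal_def)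
  next
    case False
    then obtain f :: "nat \<Rightarrow> ereal" where f: "range f \<subseteq> ereal ` A" "Sup (ereal ` A) = Sup (range f)"
      using Sup_countable_SUP[of "ereal ` A"] by auto
    have "AE \<omega> in M. f j \<le> limsup (\<lambda>n. ereal (norm (S n \<omega>) / c n))" for j
    proof -
      obtain \<alpha> where "f j = ereal \<alpha>" "\<alpha> \<in> A" using f(1) by auto
      then show ?thesis using alpha_lower_single[of \<alpha>] by (auto simp: A_def)
    qed
    then have "AE \<omega> in M. \<forall>j. f j \<le> limsup (\<lambda>n. ereal (norm (S n \<omega>) / c n))" by (simp add: AE_all_countable)
    then show ?thesis
      unfolding alpha0_def A_def[symmetric] f(2) by eventually_elim (auto intro: SUP_least)
  qed
qed

text \<open>Nothing is to be shown if one of the two quantities is infinite. Otherwise the series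
  converges at every \<open>\<alpha> + \<epsilon>\<close> beyond the supremum, whatever the shape of
  the set, and \<open>upper_eps\<close> is applied along a sequence of \<open>\<epsilon>\<close>
  tending to \<open>0\<close>.\<close>

lemma upper:
  "AE \<omega> in M. limsup (\<lambda>n. ereal (norm (S n \<omega>) / c n))
    \<le> alpha0 c H + limsup (\<lambda>n. ereal ((\<integral>\<omega>. norm (S n \<omega>) \<partial>M) / c n))"
proof -
  define A where "A = {\<alpha>. \<alpha> \<ge> 0 \<and> \<not> summable (\<lambda>n. alpha_term c H \<alpha> (Suc n))}"
  define \<beta>0 where "\<beta>0 = limsup (\<lambda>n. ereal ((\<integral>\<omega>. norm (S n \<omega>) \<partial>M) / c n))"
  have b0: "\<beta>0 \<ge> 0" unfolding \<beta>0_def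
  proof (rule le_Limsup)
    show "\<forall>\<^sub>F n in sequentially. 0 \<le> ereal ((\<integral>\<omega>. norm (S n \<omega>) \<partial>M) / c n)"
      using eventually_ge_at_top[of 1]
    proof eventually_elim
      case (elim n)
      then show ?case using c_pos[of n] by (auto intro!: divide_nonneg_pos)
    qed
  qed simp
  have al: "alpha0 c H = Sup (ereal ` A)" by (simp add: alpha0_def A_def)
  \<comment> \<open>At \<open>\<alpha> = 0\<close> the series is harmonic, also where
    \<open>H\<close> vanishes, by the convention \<open>0 / 0 = 0\<close>. So the supremum is not
    that of the empty set, and the sum is infinite as soon as one of its terms is.\<close>
  have a0: "alpha0 c H \<ge> 0"
  proof -
    have "\<not> summable (\<lambda>n. alpha_term c H 0 (Suc n))"
    proof
      assume s: "summable (\<lambda>n. alpha_term c H 0 (Suc n))"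
      have "alpha_term c H 0 (Suc n) = inverse (real (Suc n))" for n by (simp add: alpha_term_def field_simps)
      then have "summable (\<lambda>n. inverse (real (Suc n)))" using s by simp
      then have "summable (\<lambda>n. inverse (real n))" using summable_Suc_iff[of "\<lambda>n. inverse (real n)"] by simp
      then show False using not_summable_harmonic[where 'a=real] by (simp add: inverse_eq_divide)
    qed
    then have "0 \<in> A" by (simp add: A_def)
    then have "ereal 0 \<le> Sup (ereal ` A)" by (intro Sup_upper) auto
    then show ?thesis by (simp add: al zero_ereal_def)
  qed
  show ?thesis
  proof (cases "alpha0 c H = \<infinity> \<or> \<beta>0 = \<infinity>")
    case True
    then have eq: "alpha0 c H + \<beta>0 = \<infinity>" using a0 b0 by auto
    show ?thesis unfolding \<beta>0_def[symmetric] eq by simp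
  next
    case False
    obtain \<alpha> where \<alpha>: "alpha0 c H = ereal \<alpha>" using False a0 by (cases "alpha0 c H") auto
    obtain \<beta> where \<beta>: "\<beta>0 = ereal \<beta>" using False b0 by (cases \<beta>0) auto
    have ap: "\<alpha> \<ge> 0" using a0 \<alpha> by simp
    define \<epsilon> where "\<epsilon> j = 1 / real (j + 2)" for j
    have e: "0 < \<epsilon> j" "\<epsilon> j < 1" for j by (auto simp: \<epsilon>_def)
    have "(\<lambda>j. 1 / real (j + 2)) \<longlonglongrightarrow> 0"
      using LIMSEQ_ignore_initial_segment[OF lim_1_over_n, of 2] .
    then have et: "\<epsilon> \<longlonglongrightarrow> 0" by (simp add: \<epsilon>_def[abs_def])
    define b where "b j = (1 + \<epsilon> j)\<^sup>2 * ((1 + \<epsilon> j) * ((\<beta> + \<epsilon> j) + \<epsilon> j) + (1 + \<epsilon> j)\<^sup>2 * (\<alpha> + \<epsilon> j) + 2 * \<epsilon> j)" for j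
    have "b \<longlonglongrightarrow> (1 + 0)\<^sup>2 * ((1 + 0) * ((\<beta> + 0) + 0) + (1 + 0)\<^sup>2 * (\<alpha> + 0) + 2 * 0)"
      unfolding b_def by (intro tendsto_intros et)
    then have bt: "(\<lambda>j. ereal (b j)) \<longlonglongrightarrow> ereal (\<alpha> + \<beta>)" by (simp add: add.commute)
    have "AE \<omega> in M. limsup (\<lambda>n. ereal (norm (S n \<omega>) / c n)) \<le> ereal (b j)" for j
      unfolding b_def
    proof (rule upper_eps[OF e])
      show "0 < \<alpha> + \<epsilon> j" using ap e(1)[of j] by linarith
      show "summable (\<lambda>n. alpha_term c H (\<alpha> + \<epsilon> j) (Suc n))"
      proof (rule ccontr)
        assume "\<not> ?thesis"
        then have "\<alpha> + \<epsilon> j \<in> A" using ap e(1)[of j] by (auto simp: A_def)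
        then have "ereal (\<alpha> + \<epsilon> j) \<le> Sup (ereal ` A)" by (intro Sup_upper) auto
        then show False using \<alpha> e(1)[of j] by (simp add: al)
      qed
      have "\<beta>0 < ereal (\<beta> + \<epsilon> j)" using \<beta> e(1)[of j] by simp
      then have "\<forall>\<^sub>F n in sequentially. ereal ((\<integral>\<omega>. norm (S n \<omega>) \<partial>M) / c n) < ereal (\<beta> + \<epsilon> j)"
        unfolding \<beta>0_def by (rule Limsup_lessD)
      then show "\<forall>\<^sub>F n in sequentially. (\<integral>\<omega>. norm (S n \<omega>) \<partial>M) / c n \<le> \<beta> + \<epsilon> j"
        by eventually_elim simp
    qed
    then have "AE \<omega> in M. \<forall>j. limsup (\<lambda>n. ereal (norm (S n \<omega>) / c n)) \<le> ereal (b j)" by (simp add: AE_all_countable)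
    then show ?thesis
    proof eventually_elim
      case (elim \<omega>)
      then have "limsup (\<lambda>n. ereal (norm (S n \<omega>) / c n)) \<le> ereal (\<alpha> + \<beta>)"
        by (intro LIMSEQ_le_const[OF bt]) auto
      then show ?case by (simp add: \<alpha> \<beta> \<beta>0_def[symmetric])
    qed
  qed
qed

end

theorem theorem5:
  fixes M :: "'a measure"
    and X :: "'a \<Rightarrow> 'b::{banach,second_countable_topology}"
    and Xs :: "nat \<Rightarrow> 'a \<Rightarrow> 'b"
    and c :: "nat \<Rightarrow> real"
  assumes "prob_space M"
    and "X \<in> borel_measurable M"
    and "\<And>i. i \<ge> 1 \<Longrightarrow> Xs i \<in> borel_measurable M"
    and "prob_space.indep_vars M (\<lambda>_. borel) Xs {1..}"
    and "\<And>i. i \<ge> 1 \<Longrightarrow> distr M borel (Xs i) = distr M borel X"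
    and "integrable M X" and "integral\<^sup>L M X = 0"
    and "\<And>n. n \<ge> 1 \<Longrightarrow> c n > 0"
    and "\<And>n. n \<ge> 1 \<Longrightarrow> c n / sqrt (real n) \<le> c (Suc n) / sqrt (real (Suc n))"
    and "filterlim (\<lambda>n. c n / sqrt (real n)) at_top sequentially"
    and "\<And>\<epsilon>. \<epsilon> > 0 \<Longrightarrow> \<exists>m\<epsilon>\<ge>1. \<forall>m n. m\<epsilon> \<le> m \<and> m < n \<longrightarrow>
            c n / c m \<le> (1 + \<epsilon>) * (real n / real m)"
    and "summable (\<lambda>n. measure M {\<omega> \<in> space M. norm (X \<omega>) \<ge> c (Suc n)})"
  shows "AE \<omega> in M.
     max (alpha0 c (trunc_var M X))
         (limsup (\<lambda>n. ereal (integral\<^sup>L M (\<lambda>\<omega>'. norm (\<Sum>i\<in>{1..n}. Xs i \<omega>')) / c n)))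
       \<le> limsup (\<lambda>n. ereal (norm (\<Sum>i\<in>{1..n}. Xs i \<omega>) / c n)) \<and>
     limsup (\<lambda>n. ereal (norm (\<Sum>i\<in>{1..n}. Xs i \<omega>) / c n))
       \<le> alpha0 c (trunc_var M X)
         + limsup (\<lambda>n. ereal (integral\<^sup>L M (\<lambda>\<omega>'. norm (\<Sum>i\<in>{1..n}. Xs i \<omega>')) / c n))"
proof -
  interpret lil_setup M X Xs c
    by (intro lil_setup.intro lil_setup_axioms.intro assms)
  show ?thesis
    using alpha_lower beta_lower upper
    unfolding H_def S_def by eventually_elim simp
qed

end
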